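(* Let $X$ be a complex manifold, $D\subset X$ a reduced divisor, $L$ a rank 1 local system on $U:=X\setminus D$, and $\alpha_k\in\mathbb C$ a choice of residues with $e^{-2\pi i\alpha_k}=\lambda_k$, where $\lambda_k$ is the local monodromy eigenvalue of $L$ around the irreducible component $D_k$ of $D$. Let $p\in D$ and assume $D$ is positively weighted homogeneous around $p$. Let $\widetilde\alpha_p$ and $e_p$ be the numbers defined in the context. If $$e_p\,\widetilde\alpha_p\notin\mathbb Z,$$ then the stalks at $p$ of the source and of the target of the comparison morphism $$\bigl(\mathcal M^{\bullet}_{X,\log}(L),\nabla^{(\alpha)}\bigr)\hookrightarrow\bigl(\mathcal M^{\bullet}_X(L),\nabla^{(\alpha)}\bigr)$$ are both acyclic (hence this morphism is a quasi-isomorphism at $p$).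
   Context: Twisted complexes: $\mathcal L_X$ is the locally free $\mathcal O_X$-module of rank 1 with meromorphic integrable connection $\nabla^{(\alpha)}$ having a pole along $D$, whose horizontal sections on $U$ form $L$, and which locally (with $f_k$ local defining functions of $D_k$) is isomorphic to $\mathcal O_X$ with $\nabla^{(\alpha)}=d+\sum_k\alpha_k\,(df_k/f_k)\wedge$. Put $\mathcal M^j_X(L):=\Omega^j_X\otimes_{\mathcal O_X}\mathcal L_X( *D)$ (the meromorphic de Rham complex, computing $\mathbf R(j_U)_*L$ with $j_U:U\hookrightarrow X$) and $\mathcal M^j_{X,\log}(L):=\Omega^j_X(\log D)\otimes_{\mathcal O_X}\mathcal L_X$, where $\Omega_X^j(\log D)$ is K. Saito's sheaf of logarithmic forms: meromorphic $j$-forms $\eta$ with $f\eta$ and $f\,d\eta$ holomorphic, $f$ a local reduced equation of $D$. Both have differential induced by $\nabla^{(\alpha)}$. Positively weighted homogeneous around $p$: there are local coordinates $x_1,\dots,x_n$ of $X$ centered at $p$ such that $D$ is locally defined by a (reduced) weighted homogeneous polynomial $f_p$ with strictly positive rational weights $w_{p,i}$, i.e. $f_p$ is a linear combination of monomials $\prod_i x_i^{\nu_i}$ with $\sum_i w_{p,i}\nu_i=1$. Let $f_p=\prod_k f_{p,k}$ be the irreducible factorization at $p$, let $\alpha_{p,k}$ be the residue $\alpha_l$ of the global component $D_l$ containing $\{f_{p,k}=0\}$, and let $d_{p,k}$ be the weighted degree of $f_{p,k}$, i.e. its eigenvalue under $\sum_i w_{p,i}x_i\partial_{x_i}$ (so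 $\sum_kd_{p,k}=1$). Set $$\widetilde\alpha_p:=\sum_k d_{p,k}\,\alpha_{p,k},\qquad e_p:=\min\{e\in\mathbb Z_{>0}\mid e\,w_{p,i}\in\mathbb Z\ \text{for all } i\}.$$ *)

theory Defs
  imports "HOL-Analysis.Analysis"
begin

section \<open>Holomorphic functions of several variables and complex manifolds\<close>

definition cholo_on :: "(complex^'n \<Rightarrow> complex) \<Rightarrow> (complex^'n) set \<Rightarrow> bool" where
  "cholo_on g S \<longleftrightarrow> open S \<and>
     (\<forall>z\<in>S. \<exists>g'. (g has_derivative g') (at z) \<and> (\<forall>c v. g' (c *s v) = c * g' v))"

definition cholo_map_on :: "(complex^'n \<Rightarrow> complex^'n) \<Rightarrow> (complex^'n) set \<Rightarrow> bool" where
  "cholo_map_on F S \<longleftrightarrow> (\<forall>i. cholo_on (\<lambda>z. F z $ i) S)"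

text \<open>A chart is a pair of a domain and a coordinate map (whose values outside the domain are
  irrelevant). The manifold is the whole type, given by its topology and an atlas; it has pure
  dimension \<open>CARD('n)\<close>. Second countability is not needed and not imposed.\<close>

type_synonym ('a, 'n) chart = "'a set \<times> ('a \<Rightarrow> complex^'n)"

definition topological_chart :: "('a::t2_space, 'n::finite) chart \<Rightarrow> bool" where
  "topological_chart = (\<lambda>(U, \<phi>). open U \<and> open (\<phi> ` U) \<and>
     homeomorphism U (\<phi> ` U) \<phi> (inv_into U \<phi>))"

definition transition_holo :: "('a::t2_space, 'n::finite) chart \<Rightarrow> ('a, 'n) chart \<Rightarrow> bool" where
  "transition_holo = (\<lambda>(U, \<phi>) (V, \<psi>). cholo_map_on (\<psi> \<circ> inv_into U \<phi>) (\<phi> ` (U \<inter> V)))"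

definition complex_manifold :: "('a::t2_space, 'n::finite) chart set \<Rightarrow> bool" where
  "complex_manifold A \<longleftrightarrow> (\<Union>c\<in>A. fst c) = UNIV \<and>
     (\<forall>c\<in>A. topological_chart c) \<and> (\<forall>c\<in>A. \<forall>c'\<in>A. transition_holo c c')"

text \<open>The local coordinate systems of the manifold: charts of the maximal atlas.\<close>

definition holo_chart :: "('a::t2_space, 'n::finite) chart set \<Rightarrow> ('a, 'n) chart \<Rightarrow> bool" where
  "holo_chart A c \<longleftrightarrow> topological_chart c \<and>
     (\<forall>c'\<in>A. transition_holo c c' \<and> transition_holo c' c)"

definition mholo_on ::
  "('a::t2_space, 'n::finite) chart set \<Rightarrow> ('a \<Rightarrow> complex) \<Rightarrow> 'a set \<Rightarrow> bool" where
  "mholo_on A g W \<longleftrightarrow> open W \<and>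
     (\<forall>(U, \<phi>)\<in>A. cholo_on (g \<circ> inv_into U \<phi>) (\<phi> ` (U \<inter> W)))"


section \<open>Reduced divisors\<close>

text \<open>A reduced divisor is identified with its support, a closed analytic subset of pure
  codimension one (or empty).\<close>

definition reduced_divisor :: "('a::t2_space, 'n::finite) chart set \<Rightarrow> 'a set \<Rightarrow> bool" where
  "reduced_divisor A D \<longleftrightarrow> (\<forall>q. \<exists>W f. q \<in> W \<and> mholo_on A f W \<and> D \<inter> W = {y\<in>W. f y = 0} \<and>
     (\<forall>V. open V \<and> V \<subseteq> W \<and> V \<noteq> {} \<longrightarrow> (\<exists>y\<in>V. f y \<noteq> 0)))"

text \<open>A reduced local equation of \<open>D\<close> on \<open>W\<close>: a generator, at every point of \<open>W\<close>, of the ideal of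
  germs of holomorphic functions vanishing on \<open>D\<close>.\<close>

definition reduced_eq ::
  "('a::t2_space, 'n::finite) chart set \<Rightarrow> 'a set \<Rightarrow> 'a set \<Rightarrow> ('a \<Rightarrow> complex) \<Rightarrow> bool" where
  "reduced_eq A D W f \<longleftrightarrow> mholo_on A f W \<and> D \<inter> W = {y\<in>W. f y = 0} \<and>
     (\<forall>q\<in>W. \<forall>g V. q \<in> V \<and> mholo_on A g V \<and> (\<forall>y\<in>V \<inter> D. g y = 0) \<longrightarrow>
        (\<exists>h V'. q \<in> V' \<and> V' \<subseteq> V \<inter> W \<and> mholo_on A h V' \<and> (\<forall>y\<in>V'. g y = h y * f y)))"

definition smooth_chart :: "('a::t2_space, 'n::finite) chart set \<Rightarrow> 'a set \<Rightarrow> 'a \<Rightarrow>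
    ('a, 'n) chart \<Rightarrow> 'n \<Rightarrow> bool" where
  "smooth_chart A D q = (\<lambda>(U, \<phi>) i. holo_chart A (U, \<phi>) \<and> q \<in> U \<and> \<phi> q = 0 \<and>
     D \<inter> U = {y\<in>U. \<phi> y $ i = 0})"

definition regular_locus :: "('a::t2_space, 'n::finite) chart set \<Rightarrow> 'a set \<Rightarrow> 'a set" where
  "regular_locus A D = {q\<in>D. \<exists>c i. smooth_chart A D q c i}"

text \<open>The global irreducible components of \<open>D\<close>: closures of the connected components of its
  regular locus.\<close>

definition irr_components :: "('a::t2_space, 'n::finite) chart set \<Rightarrow> 'a set \<Rightarrow> 'a set set" where
  "irr_components A D = closure ` components (regular_locus A D)"


section \<open>Rank one local systems\<close>

text \<open>\<open>F V\<close> is the set of sections over \<open>V\<close> of a sheaf on the open set \<open>T\<close> of complex valued,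
  not necessarily continuous, functions. Only their values on \<open>U\<close> matter: \<open>F\<close> is a subsheaf of
  the direct image of the sheaf of all functions on \<open>U\<close>.\<close>

definition function_sheaf ::
  "'a::topological_space set \<Rightarrow> 'a set \<Rightarrow> ('a set \<Rightarrow> ('a \<Rightarrow> complex) set) \<Rightarrow> bool" where
  "function_sheaf T U F \<longleftrightarrow> (\<forall>V. open V \<and> V \<subseteq> T \<longrightarrow>
     (\<forall>s s'. s \<in> F V \<and> (\<forall>y\<in>V \<inter> U. s' y = s y) \<longrightarrow> s' \<in> F V) \<and>
     (\<forall>s W. s \<in> F V \<and> open W \<and> W \<subseteq> V \<longrightarrow> s \<in> F W) \<and>
     (\<forall>s. (\<forall>q\<in>V. \<exists>W. open W \<and> q \<in> W \<and> W \<subseteq> V \<and> s \<in> F W) \<longrightarrow> s \<in> F V))"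

text \<open>A rank one local system on \<open>U\<close>. Choosing a basis vector in each stalk (with no
  compatibility between different points) turns the sections of an arbitrary rank one local system
  into complex valued functions; the topology of the local system is what the sheaf records.\<close>

definition rank1_local_system ::
  "'a::topological_space set \<Rightarrow> ('a set \<Rightarrow> ('a \<Rightarrow> complex) set) \<Rightarrow> bool" where
  "rank1_local_system U L \<longleftrightarrow> open U \<and> function_sheaf U U L \<and>
     (\<forall>q\<in>U. \<exists>W e. open W \<and> q \<in> W \<and> W \<subseteq> U \<and> (\<forall>y\<in>W. e y \<noteq> 0) \<and>
        (\<forall>V. open V \<and> V \<subseteq> W \<longrightarrow>
           L V = {s. \<exists>c. (\<forall>y\<in>V. s y = c y * e y) \<and>
                         (\<forall>y\<in>V. \<forall>\<^sub>F y' in nhds y. c y' = c y)}))"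

definition horizontal_frame_at :: "'a::topological_space set \<Rightarrow>
    ('a set \<Rightarrow> ('a \<Rightarrow> complex) set) \<Rightarrow> 'a \<Rightarrow> ('a \<Rightarrow> complex) \<Rightarrow> bool" where
  "horizontal_frame_at U L q e \<longleftrightarrow> (\<exists>V. open V \<and> V \<subseteq> U \<and> q \<in> V \<and> e \<in> L V \<and> (\<forall>y\<in>V. e y \<noteq> 0))"

text \<open>\<open>\<tau>\<close> is a horizontal section of \<open>L\<close> along the path \<open>\<gamma>\<close> on the unit interval.\<close>

definition horizontal_along :: "'a::topological_space set \<Rightarrow> ('a set \<Rightarrow> ('a \<Rightarrow> complex) set) \<Rightarrow>
    (real \<Rightarrow> 'a) \<Rightarrow> (real \<Rightarrow> complex) \<Rightarrow> bool" where
  "horizontal_along U L \<gamma> \<tau> \<longleftrightarrow> (\<forall>t\<in>{0..1}. \<exists>V e. open V \<and> V \<subseteq> U \<and> \<gamma> t \<in> V \<and> e \<in> L V \<and>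
     (\<forall>\<^sub>F u in nhds t. u \<in> {0..1} \<longrightarrow> \<gamma> u \<in> V \<and> \<tau> u = e (\<gamma> u)))"

text \<open>\<open>l\<close> is the local monodromy eigenvalue of \<open>L\<close> around the component \<open>C\<close> of \<open>D\<close>: horizontal
  sections get multiplied by \<open>l\<close> along a small positively oriented circle in a transversal disc at
  a smooth point of \<open>D\<close> lying on \<open>C\<close>.\<close>

definition local_monodromy :: "('a::t2_space, 'n::finite) chart set \<Rightarrow> 'a set \<Rightarrow>
    ('a set \<Rightarrow> ('a \<Rightarrow> complex) set) \<Rightarrow> 'a set \<Rightarrow> complex \<Rightarrow> bool" where
  "local_monodromy A D L C l \<longleftrightarrow> (\<exists>q U \<phi> i r \<tau>. q \<in> C \<and> smooth_chart A D q (U, \<phi>) i \<and> 0 < r \<and>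
     (\<forall>c. norm c \<le> r \<longrightarrow> axis i c \<in> \<phi> ` U) \<and>
     horizontal_along (- D) L
       (\<lambda>t. inv_into U \<phi> (axis i (complex_of_real r * cis (2 * pi * t)))) \<tau> \<and>
     \<tau> 0 \<noteq> 0 \<and> \<tau> 1 = l * \<tau> 0)"


section \<open>Differential forms in coordinates\<close>

text \<open>A \<open>j\<close>-form on an open subset of \<open>\<complex>\<^sup>n\<close> maps a point and a list of \<open>j\<close> tangent vectors to
  a number; its values on lists of other lengths are irrelevant.\<close>

type_synonym 'n form = "complex^'n \<Rightarrow> (complex^'n) list \<Rightarrow> complex"

definition alternating :: "nat \<Rightarrow> ((complex^'n) list \<Rightarrow> complex) \<Rightarrow> bool" where
  "alternating j m \<longleftrightarrow> (\<forall>vs. length vs = j \<longrightarrow>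
     (\<forall>i<j. \<forall>a b x y. m (vs[i := a *s x + b *s y]) = a * m (vs[i := x]) + b * m (vs[i := y])) \<and>
     (\<forall>i<j. \<forall>k<i. vs ! i = vs ! k \<longrightarrow> m vs = 0))"

definition holo_form :: "nat \<Rightarrow> (complex^'n::finite) set \<Rightarrow> 'n form \<Rightarrow> bool" where
  "holo_form j S \<omega> \<longleftrightarrow> open S \<and> (\<forall>z\<in>S. alternating j (\<omega> z)) \<and>
     (\<forall>vs. length vs = j \<longrightarrow> cholo_on (\<lambda>z. \<omega> z vs) S)"

definition ext_d :: "'n::finite form \<Rightarrow> 'n form" where
  "ext_d \<omega> z vs = (\<Sum>i<length vs. (-1) ^ i *
     frechet_derivative (\<lambda>z'. \<omega> z' (take i vs @ drop (Suc i) vs)) (at z) (vs ! i))"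

text \<open>Sections of \<open>\<Omega>\<^sup>j \<otimes> L\<close> outside \<open>D\<close> are written as forms as well, with values in the stalks
  of \<open>L\<close>. The connection with horizontal sections \<open>L\<close> is \<open>d\<close> in any local horizontal frame (two frames differ by a locally
  constant factor, so the choice does not matter).\<close>

definition nabla :: "'a::t2_space set \<Rightarrow> ('a set \<Rightarrow> ('a \<Rightarrow> complex) set) \<Rightarrow> ('a, 'n::finite) chart \<Rightarrow>
    'n form \<Rightarrow> 'n form" where
  "nabla D L = (\<lambda>(U, \<phi>) \<omega> z vs.
     (let q = inv_into U \<phi> z; e = (SOME e. horizontal_frame_at (- D) L q e)
      in e q * ext_d (\<lambda>z' us. \<omega> z' us / e (inv_into U \<phi> z')) z vs))"


section \<open>The extension of the local system with residues along the divisor\<close>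

text \<open>Sections of \<open>\<O>\<^bsub>U\<^esub> \<otimes> L\<close> over an open set \<open>V\<close> of \<open>U\<close>.\<close>

definition twisted_holo_on :: "('a::t2_space, 'n::finite) chart set \<Rightarrow>
    ('a set \<Rightarrow> ('a \<Rightarrow> complex) set) \<Rightarrow> ('a \<Rightarrow> complex) \<Rightarrow> 'a set \<Rightarrow> bool" where
  "twisted_holo_on A L \<sigma> V \<longleftrightarrow> (\<forall>W e. open W \<and> W \<subseteq> V \<and> e \<in> L W \<and> (\<forall>y\<in>W. e y \<noteq> 0) \<longrightarrow>
     mholo_on A (\<lambda>y. \<sigma> y / e y) W)"

text \<open>\<open>LX\<close> is the locally free rank one module with connection extending \<open>\<O>\<^bsub>U\<^esub> \<otimes> L\<close>,
  where \<open>U = - D\<close>. It is torsion free, hence a subsheaf of the direct image of \<open>\<O>\<^bsub>U\<^esub> \<otimes> L\<close>.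
  Locally it has a free generator \<open>\<sigma>\<close> satisfying
  \<open>\<nabla> \<sigma> = (\<Sum>\<^sub>C \<alpha>\<^sub>C dg\<^sub>C / g\<^sub>C) \<sigma>\<close>, with \<open>g\<^sub>C\<close> a reduced local equation of the component \<open>C\<close>.\<close>

definition residue_extension :: "('a::t2_space, 'n::finite) chart set \<Rightarrow> 'a set \<Rightarrow>
    ('a set \<Rightarrow> ('a \<Rightarrow> complex) set) \<Rightarrow> ('a set \<Rightarrow> complex) \<Rightarrow>
    ('a set \<Rightarrow> ('a \<Rightarrow> complex) set) \<Rightarrow> bool" where
  "residue_extension A D L \<alpha> LX \<longleftrightarrow> function_sheaf UNIV (- D) LX \<and>
     (\<forall>q. \<exists>V \<sigma> g. open V \<and> q \<in> V \<and>
        twisted_holo_on A L \<sigma> (V - D) \<and> (\<forall>y\<in>V - D. \<sigma> y \<noteq> 0) \<and>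
        finite {C\<in>irr_components A D. C \<inter> V \<noteq> {}} \<and>
        (\<forall>C\<in>irr_components A D. C \<inter> V \<noteq> {} \<longrightarrow> reduced_eq A C V (g C)) \<and>
        (\<forall>(U, \<phi>)\<in>A. \<forall>y\<in>U \<inter> V - D. \<forall>v.
           nabla D L (U, \<phi>) (\<lambda>z us. \<sigma> (inv_into U \<phi> z)) (\<phi> y) [v] =
           (\<Sum>C | C \<in> irr_components A D \<and> C \<inter> V \<noteq> {}.
              \<alpha> C * frechet_derivative (\<lambda>z. g C (inv_into U \<phi> z)) (at (\<phi> y)) v / g C y) * \<sigma> y) \<and>
        (\<forall>W. open W \<and> W \<subseteq> V \<longrightarrow>
           LX W = {s. \<exists>h. mholo_on A h W \<and> (\<forall>y\<in>W - D. s y = h y * \<sigma> y)}))"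


section \<open>Stalks of the meromorphic and logarithmic complexes\<close>

text \<open>Stalks at \<open>p\<close> are described by representatives, in a coordinate system \<open>(U, \<phi>)\<close> around \<open>p\<close>;
  two representatives define the same germ iff their difference satisfies \<open>zero_germ\<close>. Since a
  meromorphic form with poles along \<open>D\<close> is determined by its restriction to the complement of
  \<open>D\<close>, only values outside \<open>D\<close> matter.\<close>

definition zero_germ :: "'a::t2_space set \<Rightarrow> 'a \<Rightarrow> ('a, 'n::finite) chart \<Rightarrow> nat \<Rightarrow>
    'n form \<Rightarrow> bool" where
  "zero_germ D p = (\<lambda>(U, \<phi>) j \<omega>. \<exists>V. open V \<and> p \<in> V \<and> V \<subseteq> U \<and>
     (\<forall>y\<in>V - D. \<forall>vs. length vs = j \<longrightarrow> \<omega> (\<phi> y) vs = 0))"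

definition extends_holo :: "'a::t2_space set \<Rightarrow> ('a, 'n::finite) chart \<Rightarrow> nat \<Rightarrow> 'a set \<Rightarrow>
    ('a \<Rightarrow> complex) \<Rightarrow> 'n form \<Rightarrow> bool" where
  "extends_holo D = (\<lambda>(U, \<phi>) j V f \<eta>. \<exists>\<omega>. holo_form j (\<phi> ` V) \<omega> \<and>
     (\<forall>y\<in>V - D. \<forall>vs. length vs = j \<longrightarrow> f y * \<eta> (\<phi> y) vs = \<omega> (\<phi> y) vs))"

definition mero_forms :: "('a::t2_space, 'n::finite) chart set \<Rightarrow> 'a set \<Rightarrow> 'a \<Rightarrow>
    ('a, 'n) chart \<Rightarrow> nat \<Rightarrow> 'n form set" where
  "mero_forms A D p c j = {\<eta>. \<exists>V f m. p \<in> V \<and> V \<subseteq> fst c \<and> reduced_eq A D V f \<and>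
     extends_holo D c j V (\<lambda>y. f y ^ m) \<eta>}"

definition log_forms :: "('a::t2_space, 'n::finite) chart set \<Rightarrow> 'a set \<Rightarrow> 'a \<Rightarrow>
    ('a, 'n) chart \<Rightarrow> nat \<Rightarrow> 'n form set" where
  "log_forms A D p c j = {\<eta>. \<exists>V f. p \<in> V \<and> V \<subseteq> fst c \<and> reduced_eq A D V f \<and>
     extends_holo D c j V f \<eta> \<and> extends_holo D c (Suc j) V f (ext_d \<eta>)}"

text \<open>The stalk of the tensor product with \<open>LX\<close>; as \<open>LX\<close> is locally free of rank one, every
  element is a pure tensor.\<close>

definition tensor_stalk :: "'a::t2_space set \<Rightarrow> ('a set \<Rightarrow> ('a \<Rightarrow> complex) set) \<Rightarrow> 'a \<Rightarrow>
    ('a, 'n::finite) chart \<Rightarrow> (nat \<Rightarrow> 'n form set) \<Rightarrow> nat \<Rightarrow> 'n form set" where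
  "tensor_stalk D LX p = (\<lambda>(U, \<phi>) \<Omega> j. {\<omega>. \<exists>\<eta>\<in>\<Omega> j. \<exists>V s. open V \<and> p \<in> V \<and> V \<subseteq> U \<and> s \<in> LX V \<and>
     (\<forall>y\<in>V - D. \<forall>vs. length vs = j \<longrightarrow> \<omega> (\<phi> y) vs = s y * \<eta> (\<phi> y) vs)})"

definition mero_stalk :: "('a::t2_space, 'n::finite) chart set \<Rightarrow> 'a set \<Rightarrow>
    ('a set \<Rightarrow> ('a \<Rightarrow> complex) set) \<Rightarrow> 'a \<Rightarrow> ('a, 'n) chart \<Rightarrow> nat \<Rightarrow> 'n form set" where
  "mero_stalk A D LX p c = tensor_stalk D LX p c (mero_forms A D p c)"

definition log_stalk :: "('a::t2_space, 'n::finite) chart set \<Rightarrow> 'a set \<Rightarrow>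
    ('a set \<Rightarrow> ('a \<Rightarrow> complex) set) \<Rightarrow> 'a \<Rightarrow> ('a, 'n) chart \<Rightarrow> nat \<Rightarrow> 'n form set" where
  "log_stalk A D LX p c = tensor_stalk D LX p c (log_forms A D p c)"

text \<open>Cohomology of a complex of forms \<open>M\<close> with differential \<open>\<delta>\<close>, whose elements are regarded
  modulo the null elements \<open>Z\<close>.\<close>

definition cocycle :: "(nat \<Rightarrow> 'n form \<Rightarrow> bool) \<Rightarrow> ('n form \<Rightarrow> 'n form) \<Rightarrow>
    (nat \<Rightarrow> 'n form set) \<Rightarrow> nat \<Rightarrow> 'n form \<Rightarrow> bool" where
  "cocycle Z \<delta> M j \<omega> \<longleftrightarrow> \<omega> \<in> M j \<and> Z (Suc j) (\<delta> \<omega>)"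

definition coboundary :: "(nat \<Rightarrow> 'n form \<Rightarrow> bool) \<Rightarrow> ('n form \<Rightarrow> 'n form) \<Rightarrow>
    (nat \<Rightarrow> 'n form set) \<Rightarrow> nat \<Rightarrow> 'n form \<Rightarrow> bool" where
  "coboundary Z \<delta> M j \<omega> \<longleftrightarrow> (case j of 0 \<Rightarrow> Z 0 \<omega>
     | Suc i \<Rightarrow> (\<exists>\<xi>\<in>M i. Z j (\<lambda>z vs. \<omega> z vs - \<delta> \<xi> z vs)))"

definition acyclic_complex :: "(nat \<Rightarrow> 'n form \<Rightarrow> bool) \<Rightarrow> ('n form \<Rightarrow> 'n form) \<Rightarrow>
    (nat \<Rightarrow> 'n form set) \<Rightarrow> bool" where
  "acyclic_complex Z \<delta> M \<longleftrightarrow> (\<forall>j \<omega>. cocycle Z \<delta> M j \<omega> \<longrightarrow> coboundary Z \<delta> M j \<omega>)"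

text \<open>The inclusion of \<open>M\<close> into \<open>M'\<close> induces bijections on cohomology.\<close>

definition quasi_iso_inclusion :: "(nat \<Rightarrow> 'n form \<Rightarrow> bool) \<Rightarrow> ('n form \<Rightarrow> 'n form) \<Rightarrow>
    (nat \<Rightarrow> 'n form set) \<Rightarrow> (nat \<Rightarrow> 'n form set) \<Rightarrow> bool" where
  "quasi_iso_inclusion Z \<delta> M M' \<longleftrightarrow> (\<forall>j. M j \<subseteq> M' j) \<and>
     (\<forall>j \<omega>. cocycle Z \<delta> M j \<omega> \<and> coboundary Z \<delta> M' j \<omega> \<longrightarrow> coboundary Z \<delta> M j \<omega>) \<and>
     (\<forall>j \<omega>. cocycle Z \<delta> M' j \<omega> \<longrightarrow>
        (\<exists>\<omega>'. cocycle Z \<delta> M j \<omega>' \<and> coboundary Z \<delta> M' j (\<lambda>z vs. \<omega> z vs - \<omega>' z vs)))"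


section \<open>Positively weighted homogeneous divisors\<close>

text \<open>In the coordinates \<open>(U, \<phi>)\<close> centered at \<open>p\<close>, the function \<open>f\<close> is a weighted homogeneous
  polynomial of degree 1 for the positive weights \<open>w\<close>, and a reduced equation of \<open>D\<close> near \<open>p\<close>.\<close>

definition weighted_homogeneous_eq :: "('a::t2_space, 'n::finite) chart set \<Rightarrow> 'a set \<Rightarrow> 'a \<Rightarrow>
    ('a, 'n) chart \<Rightarrow> ('n \<Rightarrow> rat) \<Rightarrow> ('a \<Rightarrow> complex) \<Rightarrow> bool" where
  "weighted_homogeneous_eq A D p = (\<lambda>(U, \<phi>) w f. holo_chart A (U, \<phi>) \<and> p \<in> U \<and> \<phi> p = 0 \<and>
     (\<forall>i. 0 < w i) \<and>
     (\<exists>W S a. p \<in> W \<and> W \<subseteq> U \<and> reduced_eq A D W f \<and> finite S \<and>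
        (\<forall>\<nu>\<in>S. (\<Sum>i\<in>UNIV. w i * of_nat (\<nu> i)) = 1) \<and>
        (\<forall>y\<in>W. f y = (\<Sum>\<nu>\<in>S. a \<nu> * (\<Prod>i\<in>UNIV. (\<phi> y $ i) ^ \<nu> i)))))"

definition irreducible_germ ::
  "('a::t2_space, 'n::finite) chart set \<Rightarrow> 'a \<Rightarrow> ('a \<Rightarrow> complex) \<Rightarrow> bool" where
  "irreducible_germ A p g \<longleftrightarrow> (\<exists>W. p \<in> W \<and> mholo_on A g W) \<and>
     g p = 0 \<and> \<not> (\<forall>\<^sub>F y in nhds p. g y = 0) \<and>
     (\<forall>W u v. p \<in> W \<and> mholo_on A u W \<and> mholo_on A v W \<and> (\<forall>y\<in>W. g y = u y * v y) \<longrightarrow>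
        u p \<noteq> 0 \<or> v p \<noteq> 0)"

definition irreducible_factorization :: "('a::t2_space, 'n::finite) chart set \<Rightarrow> 'a \<Rightarrow>
    ('a \<Rightarrow> complex) \<Rightarrow> nat \<Rightarrow> (nat \<Rightarrow> 'a \<Rightarrow> complex) \<Rightarrow> bool" where
  "irreducible_factorization A p f m fs \<longleftrightarrow> (\<forall>k<m. irreducible_germ A p (fs k)) \<and>
     (\<forall>\<^sub>F y in nhds p. f y = (\<Prod>k<m. fs k y))"

text \<open>\<open>d\<close> is the weighted degree of \<open>g\<close>: its eigenvalue under the Euler field
  \<open>\<Sum>\<^sub>i w\<^sub>i x\<^sub>i \<partial>\<^sub>i\<close>.\<close>

definition weighted_degree :: "('a::t2_space, 'n::finite) chart \<Rightarrow> 'a \<Rightarrow> ('n \<Rightarrow> rat) \<Rightarrow>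
    ('a \<Rightarrow> complex) \<Rightarrow> complex \<Rightarrow> bool" where
  "weighted_degree = (\<lambda>(U, \<phi>) p w g d. \<forall>\<^sub>F y in nhds p.
     (\<Sum>i\<in>UNIV. of_rat (w i) * (\<phi> y $ i) *
        frechet_derivative (\<lambda>z. g (inv_into U \<phi> z)) (at (\<phi> y)) (axis i 1)) = d * g y)"

definition weight_denominator :: "('n::finite \<Rightarrow> rat) \<Rightarrow> nat" where
  "weight_denominator w = (LEAST e. 0 < e \<and> (\<forall>i. of_nat e * w i \<in> \<int>))"

end

theory Submission
  imports Defs "HOL-Complex_Analysis.Cauchy_Integral_Formula"
begin

text \<open>In the weighted coordinates the flow of the Euler field \<open>\<xi> = \<Sum>\<^sub>i w\<^sub>i x\<^sub>i \<partial>\<^sub>i\<close>, run in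
  imaginary time, is a circle action \<open>\<rho>\<close> of period \<open>T = 2 \<pi> e\<^sub>p\<close> that preserves \<open>D\<close>. After multiplication
  by a unit the local generator \<open>\<sigma>\<close> of \<open>\<L>\<^sub>X\<close> satisfies \<open>\<nabla> \<sigma> = \<theta> \<sigma>\<close> with
  \<open>\<theta> = \<Sum>\<^sub>k \<alpha>\<^sub>k df\<^sub>k / f\<^sub>k\<close>, which is invariant under the action and has \<open>\<theta>(\<xi>) = a\<close>, the weighted sum
  of the residues. For \<open>A \<eta> = \<integral>\<^sub>0\<^sup>T exp (\<i> a t) \<rho>\<^sub>t\<^sup>* \<eta> dt\<close> integration of a total derivative along closed
  orbits gives \<open>(L\<^sub>\<xi> + a) A \<eta> = c \<eta>\<close> with \<open>c = - \<i> (exp (\<i> a T) - 1)\<close>, and \<open>c \<noteq> 0\<close> exactly because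
  \<open>e\<^sub>p a\<close> is not an integer. Since \<open>A\<close> commutes with \<open>d + \<theta> \<and>\<close>, Cartan's formula makes
  \<open>\<iota>\<^sub>\<xi> A / c\<close> a contracting homotopy. It respects poles along \<open>D\<close> and the logarithmic condition because
  \<open>f (\<rho>\<^sub>t z) = exp (\<i> t) f z\<close>. The comparison of the global equations of the components with the local
  factors \<open>f\<^sub>k\<close> only uses that a regular point of \<open>D\<close> lies on a single component.\<close>

section \<open>Holomorphic functions of several variables\<close>

text \<open>Why an integral inverts \<open>L + a\<close>: on an eigenform of the Euler field with
  eigenvalue \<nu> in (1 / e) Z, the period T = 2 pi e gives exp (i \<nu> T) = 1, so integrating exp
  (i (a + \<nu>) t) over [0, T] yields c / (\<nu> + a) with one and the same c for all \<nu>. The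
  usual argument expands a form into eigenforms and divides each by \<nu> + a, which requires
  convergence of the divided series, also for forms with poles. The average performs all these
  divisions at once and uses no series. Imaginary time matters for a second reason: the circle
  action is isometric, so it preserves every ball about the origin and the complement of D in it.
  The homotopy therefore acts on forms over a fixed set and no orbit approaches the origin. Sections
  of L are functions without any continuity. Every twisted form is therefore divided by a generator
  first, and the analysis concerns only scalar forms off D that become holomorphic after
  multiplication by a power of f.\<close>

abbreviation fd :: "(complex^'n \<Rightarrow> complex) \<Rightarrow> complex^'n \<Rightarrow> complex^'n \<Rightarrow> complex" where
  "fd g z v \<equiv> frechet_derivative g (at z) v"

lemma norm_vector_scalar_mult [simp]: "norm (c *s v) = norm c * norm (v :: complex^'n)"
  by (simp add: norm_vec_def norm_mult L2_set_right_distrib)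

lemma continuous_on_vector_scalar_mult [continuous_intros]:
  fixes g :: "'a::topological_space \<Rightarrow> complex^'n"
  assumes "continuous_on S c" "continuous_on S g"
  shows "continuous_on S (\<lambda>x. c x *s g x)"
  unfolding vector_scalar_mult_def using assms by (intro continuous_intros)

lemma sum_axis_scalar: "(\<Sum>a\<in>UNIV. (v $ a) *s axis a 1) = (v :: complex^'n)"
  by (simp add: vec_eq_iff axis_def if_distrib[of "\<lambda>x. _ * x"] sum.delta cong: if_cong)

lemma has_derivative_vec_lambda_iff:
  fixes F :: "'a::real_normed_vector \<Rightarrow> complex^'n"
  assumes "\<And>i. ((\<lambda>z. F z $ i) has_derivative (\<lambda>v. F' v $ i)) (at z)"
  shows "(F has_derivative F') (at z)"
proof -
  have "((\<lambda>z. F z \<bullet> b) has_derivative (\<lambda>v. F' v \<bullet> b)) (at z)" if bB: "b \<in> Basis" for b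
  proof -
    obtain i u where b: "b = axis i u" "u \<in> Basis" using bB by (auto simp: Basis_vec_def)
    show ?thesis unfolding b inner_axis
      by (intro has_derivative_inner_left assms)
  qed
  then show ?thesis using has_derivative_componentwise_within[of F F' z UNIV] by blast
qed

lemma cholo_onI:
  assumes "open S"
    and "\<And>z. z \<in> S \<Longrightarrow> (g has_derivative g' z) (at z)"
    and "\<And>z c v. z \<in> S \<Longrightarrow> g' z (c *s v) = c * g' z v"
  shows "cholo_on g S"
  using assms unfolding cholo_on_def by blast

lemma cholo_on_open: "cholo_on g S \<Longrightarrow> open S"
  by (simp add: cholo_on_def)

lemma cholo_on_has_derivative:
  "cholo_on g S \<Longrightarrow> z \<in> S \<Longrightarrow> (g has_derivative frechet_derivative g (at z)) (at z)"
  unfolding cholo_on_def by (metis frechet_derivative_at)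

lemma cholo_on_fd_scale:
  "cholo_on g S \<Longrightarrow> z \<in> S \<Longrightarrow> fd g z (c *s v) = c * fd g z v"
  unfolding cholo_on_def by (metis frechet_derivative_at)

lemma fdI: "(g has_derivative g') (at z) \<Longrightarrow> fd g z v = g' v"
  by (metis frechet_derivative_at)

lemma cholo_on_fd_add:
  "cholo_on g S \<Longrightarrow> z \<in> S \<Longrightarrow> fd g z (u + v) = fd g z u + fd g z v"
  by (meson cholo_on_has_derivative has_derivative_linear linear_add)

lemma cholo_on_subset: "cholo_on g S \<Longrightarrow> open T \<Longrightarrow> T \<subseteq> S \<Longrightarrow> cholo_on g T"
  unfolding cholo_on_def by blast

lemma fd_cong:
  assumes "open S" "z \<in> S" "\<And>y. y \<in> S \<Longrightarrow> g y = h y"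
  shows "frechet_derivative g (at z) = frechet_derivative h (at z)"
proof -
  have "(g has_derivative g') (at z) \<longleftrightarrow> (h has_derivative g') (at z)" for g'
    using has_derivative_transform_within_open[OF _ assms(1,2)] assms(3) by metis
  then show ?thesis unfolding frechet_derivative_def by simp
qed

lemma cholo_on_cong:
  assumes "\<And>z. z \<in> S \<Longrightarrow> g z = h z" "cholo_on g S"
  shows "cholo_on h S"
proof (rule cholo_onI[where g' = "\<lambda>z. frechet_derivative g (at z)"])
  show "open S" using assms(2) by (rule cholo_on_open)
  then show "(h has_derivative frechet_derivative g (at z)) (at z)" if "z \<in> S" for z
    by (rule has_derivative_transform_within_open[OF cholo_on_has_derivative[OF assms(2) that] _ that])
      (use \<open>open S\<close> assms(1) in auto)
qed (use cholo_on_fd_scale[OF assms(2)] in auto)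

lemma cholo_on_local:
  assumes "open S" "\<And>z. z \<in> S \<Longrightarrow> \<exists>T. z \<in> T \<and> cholo_on g T"
  shows "cholo_on g S"
  using assms unfolding cholo_on_def by blast

lemma cholo_on_continuous: "cholo_on g S \<Longrightarrow> continuous_on S g"
  by (meson continuous_at_imp_continuous_on cholo_on_has_derivative has_derivative_continuous)

section \<open>Closure properties and differentiation rules for scalar holomorphic functions\<close>

lemma cholo_on_const [intro]: "open S \<Longrightarrow> cholo_on (\<lambda>z. c) S"
  by (rule cholo_onI[where g' = "\<lambda>z v. 0"]) auto

lemma has_derivative_nth: "((\<lambda>z. (z :: complex^'n) $ i) has_derivative (\<lambda>v. v $ i)) (at z)"
  by (simp add: bounded_linear_imp_has_derivative bounded_linear_vec_nth)

lemma cholo_on_nth [intro]: "open S \<Longrightarrow> cholo_on (\<lambda>z. z $ i) S"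
  by (rule cholo_onI[where g' = "\<lambda>z v. v $ i"]) (auto intro: has_derivative_nth)

lemma fd_nth: "fd (\<lambda>z. z $ i) z v = v $ i"
  by (rule fdI has_derivative_nth)+

lemma has_derivative_cholo_add:
  assumes "cholo_on g S" "cholo_on h S" "z \<in> S"
  shows "((\<lambda>z. g z + h z) has_derivative (\<lambda>v. fd g z v + fd h z v)) (at z)"
  by (intro has_derivative_add cholo_on_has_derivative[OF assms(1,3)] cholo_on_has_derivative[OF assms(2,3)])

lemma cholo_on_add [intro]:
  assumes "cholo_on g S" "cholo_on h S"
  shows "cholo_on (\<lambda>z. g z + h z) S"
  by (rule cholo_onI[where g' = "\<lambda>z v. fd g z v + fd h z v"])
    (use assms in \<open>auto intro: cholo_on_open has_derivative_cholo_add
        simp: cholo_on_fd_scale[OF assms(1)] cholo_on_fd_scale[OF assms(2)] algebra_simps\<close>)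

lemma has_derivative_cholo_mult:
  assumes "cholo_on g S" "cholo_on h S" "z \<in> S"
  shows "((\<lambda>z. g z * h z) has_derivative (\<lambda>v. g z * fd h z v + fd g z v * h z)) (at z)"
  by (intro has_derivative_mult cholo_on_has_derivative[OF assms(1,3)] cholo_on_has_derivative[OF assms(2,3)])

lemma cholo_on_mult [intro]:
  assumes "cholo_on g S" "cholo_on h S"
  shows "cholo_on (\<lambda>z. g z * h z) S"
  by (rule cholo_onI[OF cholo_on_open[OF assms(1)] has_derivative_cholo_mult[OF assms]])
    (simp_all add: cholo_on_fd_scale[OF assms(1)] cholo_on_fd_scale[OF assms(2)] algebra_simps)

lemma fd_mult:
  "cholo_on g S \<Longrightarrow> cholo_on h S \<Longrightarrow> z \<in> S \<Longrightarrow>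
    fd (\<lambda>z. g z * h z) z v = g z * fd h z v + fd g z v * h z"
  by (rule fdI[OF has_derivative_cholo_mult])

lemma fd_const [simp]: "fd (\<lambda>z. c) z v = 0"
  by (rule fdI) (rule has_derivative_const)

lemma fd_cmult: "cholo_on g S \<Longrightarrow> z \<in> S \<Longrightarrow> fd (\<lambda>z. c * g z) z v = c * fd g z v"
  using fd_mult[of "\<lambda>z. c" S g z v] cholo_on_const cholo_on_open by fastforce

lemma cholo_on_cmult [intro]: "cholo_on g S \<Longrightarrow> cholo_on (\<lambda>z. c * g z) S"
  using cholo_on_mult[OF cholo_on_const] cholo_on_open by blast

lemma cholo_on_sum [intro]:
  assumes "open S" "\<And>i. i \<in> I \<Longrightarrow> cholo_on (g i) S"
  shows "cholo_on (\<lambda>z. \<Sum>i\<in>I. g i z) S"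
  using assms(2) by (induction I rule: infinite_finite_induct) (auto intro: assms(1))

lemma fd_sum:
  assumes "z \<in> S" "\<And>i. i \<in> I \<Longrightarrow> cholo_on (g i) S"
  shows "fd (\<lambda>z. \<Sum>i\<in>I. g i z) z v = (\<Sum>i\<in>I. fd (g i) z v)"
  by (rule fdI, intro has_derivative_sum) (use assms cholo_on_has_derivative in blast)

lemma cholo_on_prod [intro]:
  assumes "open S" "\<And>i. i \<in> I \<Longrightarrow> cholo_on (g i) S"
  shows "cholo_on (\<lambda>z. \<Prod>i\<in>I. g i z) S"
  using assms(2) by (induction I rule: infinite_finite_induct) (auto intro: assms(1))

lemma cholo_on_power [intro]: "cholo_on g S \<Longrightarrow> cholo_on (\<lambda>z. g z ^ m) S"
  by (induction m) (auto dest: cholo_on_open)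

lemma has_derivative_cholo_outer:
  assumes "cholo_on g S" "z \<in> S" "(h has_field_derivative h') (at (g z))"
  shows "((\<lambda>z. h (g z)) has_derivative (\<lambda>v. h' * fd g z v)) (at z)"
  using has_derivative_compose[OF cholo_on_has_derivative[OF assms(1,2)], of h "(*) h'"]
    assms(3) by (simp add: has_field_derivative_def)

lemma fd_outer:
  "cholo_on g S \<Longrightarrow> z \<in> S \<Longrightarrow> (h has_field_derivative h') (at (g z)) \<Longrightarrow>
    fd (\<lambda>z. h (g z)) z v = h' * fd g z v"
  by (rule fdI[OF has_derivative_cholo_outer])

lemma cholo_on_outer:
  assumes "cholo_on g S" "\<And>z. z \<in> S \<Longrightarrow> h field_differentiable at (g z)"
  shows "cholo_on (\<lambda>z. h (g z)) S"
proof (rule cholo_onI[where g' = "\<lambda>z v. deriv h (g z) * fd g z v"])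
  show "open S" using assms(1) by (rule cholo_on_open)
  show "((\<lambda>z. h (g z)) has_derivative (\<lambda>v. deriv h (g z) * fd g z v)) (at z)" if "z \<in> S" for z
    using has_derivative_cholo_outer[OF assms(1) that] assms(2)[OF that]
    by (simp add: field_differentiable_derivI)
qed (simp add: cholo_on_fd_scale[OF assms(1)])

lemma cholo_on_exp [intro]: "cholo_on g S \<Longrightarrow> cholo_on (\<lambda>z. exp (g z)) S"
  by (rule cholo_on_outer) (auto intro: field_differentiable_within_exp)

lemma cholo_on_inverse [intro]:
  "cholo_on g S \<Longrightarrow> (\<And>z. z \<in> S \<Longrightarrow> g z \<noteq> 0) \<Longrightarrow> cholo_on (\<lambda>z. inverse (g z)) S"
  by (rule cholo_on_outer) (auto intro: field_differentiable_inverse field_differentiable_ident)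

section \<open>Holomorphic maps and the chain rule\<close>

lemma has_derivative_cholo_map:
  assumes "cholo_map_on F S" "z \<in> S"
  shows "(F has_derivative (\<lambda>v. \<chi> i. fd (\<lambda>z. F z $ i) z v)) (at z)"
proof (rule has_derivative_vec_lambda_iff)
  fix i
  have "cholo_on (\<lambda>z. F z $ i) S" using assms(1) unfolding cholo_map_on_def by blast
  from cholo_on_has_derivative[OF this assms(2)]
  show "((\<lambda>z. F z $ i) has_derivative (\<lambda>v. (\<chi> i. fd (\<lambda>z. F z $ i) z v) $ i)) (at z)" by simp
qed

lemma cholo_map_fd:
  "cholo_map_on F S \<Longrightarrow> z \<in> S \<Longrightarrow> frechet_derivative F (at z) v = (\<chi> i. fd (\<lambda>z. F z $ i) z v)"
  using frechet_derivative_at[OF has_derivative_cholo_map, THEN fun_cong, symmetric] .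

lemma cholo_map_has_derivative:
  "cholo_map_on F S \<Longrightarrow> z \<in> S \<Longrightarrow> (F has_derivative frechet_derivative F (at z)) (at z)"
  using has_derivative_cholo_map frechet_derivative_works differentiableI by blast

lemma cholo_map_fd_scale:
  "cholo_map_on F S \<Longrightarrow> z \<in> S \<Longrightarrow> frechet_derivative F (at z) (c *s v) = c *s frechet_derivative F (at z) v"
  by (auto simp: cholo_map_fd vec_eq_iff cholo_map_on_def intro: cholo_on_fd_scale)

lemma cholo_map_fd_add:
  "cholo_map_on F S \<Longrightarrow> z \<in> S \<Longrightarrow>
    frechet_derivative F (at z) (u + v) = frechet_derivative F (at z) u + frechet_derivative F (at z) v"
  by (meson cholo_map_has_derivative has_derivative_linear linear_add)

lemma cholo_map_continuous: "cholo_map_on F S \<Longrightarrow> continuous_on S F"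
  by (meson continuous_at_imp_continuous_on cholo_map_has_derivative has_derivative_continuous)

lemma has_derivative_cholo_compose:
  assumes "cholo_on g T" "F z \<in> T" "(F has_derivative F') (at z)"
  shows "((\<lambda>z. g (F z)) has_derivative (\<lambda>v. fd g (F z) (F' v))) (at z)"
  using has_derivative_compose[OF assms(3) cholo_on_has_derivative[OF assms(1,2)]] .

lemma fd_compose:
  assumes "cholo_on g T" "F z \<in> T" "cholo_map_on F S" "z \<in> S"
  shows "fd (\<lambda>z. g (F z)) z v = fd g (F z) (frechet_derivative F (at z) v)"
  by (rule fdI, rule has_derivative_cholo_compose[where F = F, OF assms(1,2)])
    (rule cholo_map_has_derivative[OF assms(3,4)])

lemma cholo_on_compose:
  assumes "cholo_on g T" "cholo_map_on F S" "\<And>z. z \<in> S \<Longrightarrow> F z \<in> T"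
  shows "cholo_on (\<lambda>z. g (F z)) S"
proof (rule cholo_onI)
  show "open S" using assms(2) unfolding cholo_map_on_def by (blast dest: cholo_on_open)
  show "((\<lambda>z. g (F z)) has_derivative (\<lambda>v. fd g (F z) (frechet_derivative F (at z) v))) (at z)"
    if "z \<in> S" for z
    using has_derivative_cholo_compose[where F = F, OF assms(1) assms(3)[OF that]]
      cholo_map_has_derivative[OF assms(2) that] by blast
qed (use assms in \<open>simp add: cholo_map_fd_scale cholo_on_fd_scale\<close>)

lemma cholo_map_compose:
  assumes "cholo_map_on G T" "cholo_map_on F S" "\<And>z. z \<in> S \<Longrightarrow> F z \<in> T"
  shows "cholo_map_on (\<lambda>z. G (F z)) S"
  using assms cholo_on_compose[of "\<lambda>z. G z $ i" T F S for i] unfolding cholo_map_on_def by blast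

lemma cholo_map_subset: "cholo_map_on F S \<Longrightarrow> open T \<Longrightarrow> T \<subseteq> S \<Longrightarrow> cholo_map_on F T"
  unfolding cholo_map_on_def using cholo_on_subset by blast

lemma cholo_map_cong:
  "(\<And>z. z \<in> S \<Longrightarrow> F z = G z) \<Longrightarrow> cholo_map_on F S \<Longrightarrow> cholo_map_on G S"
  unfolding cholo_map_on_def using cholo_on_cong[of S "\<lambda>z. F z $ i" "\<lambda>z. G z $ i" for i] by metis


subsection \<open>Cauchy's formula and derivatives of holomorphic functions\<close>

lemma has_field_derivative_along_line:
  assumes "cholo_on g S" "z + t *s v \<in> S"
  shows "((\<lambda>t. g (z + t *s v)) has_field_derivative fd g (z + t *s v) v) (at t)"
proof -
  have "((\<lambda>t. z + t *s v) has_derivative (\<lambda>h. h *s v)) (at t)"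
    by (rule has_derivative_vec_lambda_iff) (auto intro!: derivative_eq_intros)
  from has_derivative_cholo_compose[OF assms(1) _ this] assms(2)
  show ?thesis
    by (simp add: has_field_derivative_def cholo_on_fd_scale[OF assms] mult_commute_abs)
qed

lemma cauchy_directional_derivative:
  assumes g: "cholo_on g S" and r: "0 < r" and S: "\<And>t. norm t \<le> r \<Longrightarrow> z + t *s v \<in> S"
  shows "fd g z v = (1 / of_real r) *
    integral {0..1} (\<lambda>t. g (z + (of_real r * cis (2 * pi * t)) *s v) * cis (- (2 * pi * t)))"
proof -
  define h where "h = (\<lambda>t. g (z + t *s v))"
  have hd: "(h has_field_derivative fd g (z + t *s v) v) (at t)" if "norm t \<le> r" for t
    unfolding h_def by (rule has_field_derivative_along_line[OF g S[OF that]])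
  have cont: "continuous_on (cball 0 r) h"
    by (rule DERIV_continuous_on) (use hd in \<open>auto intro: has_field_derivative_at_within\<close>)
  have hol: "h holomorphic_on ball 0 r"
  proof (rule holomorphic_onI)
    fix t :: complex assume "t \<in> ball 0 r"
    then have "(h has_field_derivative fd g (z + t *s v) v) (at t)" by (intro hd) simp
    then show "h field_differentiable at t within ball 0 r"
      unfolding field_differentiable_def using has_field_derivative_at_within by blast
  qed
  have "(h has_field_derivative (1 / (2 * of_real pi * \<i>) *
      contour_integral (circlepath 0 r) (\<lambda>u. h u / (u - 0)^2))) (at 0)"
    by (rule Cauchy_derivative_integral_circlepath(2)[OF cont hol]) (use r in auto)
  moreover have "(h has_field_derivative fd g z v) (at 0)"
    using hd[of 0] r by simp
  ultimately have "fd g z v = 1 / (2 * of_real pi * \<i>) *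
      contour_integral (circlepath 0 r) (\<lambda>u. h u / (u - 0)^2)"
    using DERIV_unique by blast
  also have "\<dots> = integral {0..1} (\<lambda>t. 1 / (2 * of_real pi * \<i>) *
      (h (of_real r * cis (2 * pi * t)) / (of_real r * cis (2 * pi * t))^2 *
       (2 * of_real pi * \<i> * r * cis (2 * pi * t))))"
    unfolding contour_integral_integral vector_derivative_circlepath integral_mult_right
    by (simp add: circlepath cis_conv_exp mult_ac)
  also have "\<dots> = integral {0..1} (\<lambda>t. (1 / of_real r) * (h (of_real r * cis (2 * pi * t)) * cis (- (2 * pi * t))))"
  proof (rule integral_cong)
    fix t
    have "cis (- (2 * pi * t)) = inverse (cis (2 * pi * t))" by (simp add: cis_inverse)
    then show "1 / (2 * of_real pi * \<i>) *
      (h (of_real r * cis (2 * pi * t)) / (of_real r * cis (2 * pi * t))^2 *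
       (2 * of_real pi * \<i> * r * cis (2 * pi * t))) = (1 / of_real r) * (h (of_real r * cis (2 * pi * t)) * cis (- (2 * pi * t)))"
      using r by (simp add: field_simps power2_eq_square)
  qed
  finally show ?thesis unfolding h_def integral_mult_right .
qed

lemma cauchy_radius:
  assumes "open S" "(z0 :: complex^'n) \<in> S"
  obtains \<rho> r where "0 < \<rho>" "0 < r" "ball z0 \<rho> \<subseteq> S"
    "\<And>z t. z \<in> ball z0 \<rho> \<Longrightarrow> norm t \<le> r \<Longrightarrow> z + t *s v \<in> S"
proof -
  obtain \<epsilon> where e: "0 < \<epsilon>" "ball z0 \<epsilon> \<subseteq> S" using assms openE by blast
  \<comment> \<open>Dividing by \<open>norm v + 1\<close> instead of \<open>norm v\<close> covers
    the direction \<open>v = 0\<close> as well.\<close>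
  define r where "r = \<epsilon> / 2 / (norm v + 1)"
  have r0: "0 < r" unfolding r_def using e by (intro divide_pos_pos add_nonneg_pos) auto
  have "z + t *s v \<in> S" if "z \<in> ball z0 (\<epsilon> / 2)" "norm t \<le> r" for z t
  proof -
    have "norm (t *s v) \<le> r * norm v" using that by (simp add: mult_right_mono)
    also have "\<dots> \<le> r * (norm v + 1)" using r0 by (simp add: mult_left_mono)
    also have "\<dots> = \<epsilon> / 2"
      using norm_ge_zero[of v] by (simp add: r_def field_simps del: norm_ge_zero)
    finally have 1: "norm (t *s v) \<le> \<epsilon> / 2" .
    have "dist z0 (z + t *s v) \<le> dist z0 z + norm (t *s v)"
      using dist_triangle[of z0 "z + t *s v" z] by (simp add: dist_norm)
    also have "\<dots> < \<epsilon>" using that(1) 1 by simp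
    finally show ?thesis using e by auto
  qed
  moreover have "ball z0 (\<epsilon> / 2) \<subseteq> S" using e by (auto simp: subset_eq)
  ultimately show ?thesis using that[of "\<epsilon> / 2" r] e r0 by auto
qed

text \<open>Joint continuity passes to the derivative because Cauchy's formula makes it an integral
  over a compact circle of the jointly continuous \<open>K\<close>. The radius of the circle depends
  on the point, so the claim is proved near each \<open>z0\<close> and then glued.\<close>

lemma continuous_on_fd_param:
  fixes K :: "complex^'n \<Rightarrow> 'q::t2_space \<Rightarrow> complex"
  assumes S: "open S" and K: "\<And>t. t \<in> Q \<Longrightarrow> cholo_on (\<lambda>z. K z t) S"
    and cont: "continuous_on (S \<times> Q) (\<lambda>(z, t). K z t)"
  shows "continuous_on (S \<times> Q) (\<lambda>(z, t). fd (\<lambda>z. K z t) z v)"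
proof -
  have "\<exists>U. open U \<and> z0 \<in> U \<and> continuous_on (U \<times> Q) (\<lambda>(z, t). fd (\<lambda>z. K z t) z v)" if z0: "z0 \<in> S" for z0
  proof -
    obtain \<rho> r where \<rho>: "0 < \<rho>" "0 < r" "ball z0 \<rho> \<subseteq> S"
      "\<And>z t. z \<in> ball z0 \<rho> \<Longrightarrow> norm t \<le> r \<Longrightarrow> z + t *s v \<in> S"
      using cauchy_radius[OF S z0] by blast
    have "continuous_on ((ball z0 \<rho> \<times> Q) \<times> cbox 0 1) (\<lambda>x. K
        (fst (fst x) + (of_real r * cis (2 * pi * snd x)) *s v) (snd (fst x)))"
    proof -
      have *: "continuous_on ((ball z0 \<rho> \<times> Q) \<times> cbox 0 1)
          (\<lambda>x. (fst (fst x) + (of_real r * cis (2 * pi * snd x)) *s v, snd (fst x)))"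
        by (intro continuous_intros)
      show ?thesis
      proof -
        have "(\<lambda>x. (fst (fst x) + (of_real r * cis (2 * pi * snd x)) *s v, snd (fst x))) `
            ((ball z0 \<rho> \<times> Q) \<times> cbox 0 1) \<subseteq> S \<times> Q"
          using \<rho>(2,4) by (auto simp: norm_mult)
        from continuous_on_compose2[OF cont * this] show ?thesis by simp
      qed
    qed
    then have "continuous_on ((ball z0 \<rho> \<times> Q) \<times> cbox 0 1) (\<lambda>(x, s). K
        (fst x + (of_real r * cis (2 * pi * s)) *s v) (snd x) * cis (- (2 * pi * s)))"
      unfolding case_prod_unfold by (intro continuous_intros)
    from integral_continuous_on_param[OF this]
    have "continuous_on (ball z0 \<rho> \<times> Q) (\<lambda>x. (1 / of_real r) * integral {0..1} (\<lambda>s. K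
        (fst x + (of_real r * cis (2 * pi * s)) *s v) (snd x) * cis (- (2 * pi * s))))"
      unfolding cbox_interval by (intro continuous_intros)
    then have "continuous_on (ball z0 \<rho> \<times> Q) (\<lambda>(z, t). fd (\<lambda>z. K z t) z v)"
      by (rule continuous_on_eq)
        (use \<rho> in \<open>auto simp: cauchy_directional_derivative[OF K \<rho>(2)]\<close>)
    then show ?thesis using \<rho>(1) by (intro exI[of _ "ball z0 \<rho>"]) auto
  qed
  then obtain U where U: "\<And>z. z \<in> S \<Longrightarrow> open (U z)" "\<And>z. z \<in> S \<Longrightarrow> z \<in> U z"
    "\<And>z. z \<in> S \<Longrightarrow> continuous_on (U z \<times> Q) (\<lambda>(z, t). fd (\<lambda>z. K z t) z v)" by metis
  show ?thesis unfolding continuous_on_eq_continuous_within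
  proof (intro ballI)
    fix x assume x: "x \<in> S \<times> Q"
    then have "fst x \<in> S" by auto
    note U' = U[OF this]
    have "continuous (at x within U (fst x) \<times> Q) (\<lambda>(z, t). fd (\<lambda>z. K z t) z v)"
      using U'(2,3) x by (auto simp: continuous_on_eq_continuous_within)
    \<comment> \<open>The local set is open in the first variable, so it does not change the
      relative neighbourhoods of \<open>x\<close>.\<close>
    moreover have "at x within (U (fst x) \<times> Q) = at x within (UNIV \<times> Q)"
      by (rule at_within_nhd[of _ "U (fst x) \<times> UNIV"]) (use U' x in \<open>auto intro: open_Times\<close>)
    ultimately have "continuous (at x within UNIV \<times> Q) (\<lambda>(z, t). fd (\<lambda>z. K z t) z v)"
      by (simp add: continuous_within)
    then show "continuous (at x within S \<times> Q) (\<lambda>(z, t). fd (\<lambda>z. K z t) z v)"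
      by (rule continuous_within_subset) auto
  qed
qed

section \<open>Differentiation under the integral sign\<close>

lemma has_derivative_cholo_integral:
  fixes K :: "complex^'n \<Rightarrow> real \<Rightarrow> complex"
  assumes S: "open S" and K: "\<And>t. t \<in> {a..b} \<Longrightarrow> cholo_on (\<lambda>z. K z t) S"
    and cont: "continuous_on (S \<times> {a..b}) (\<lambda>(z, t). K z t)" and z: "z \<in> S"
  shows "((\<lambda>z. integral {a..b} (K z)) has_derivative
    (\<lambda>v. integral {a..b} (\<lambda>t. fd (\<lambda>z. K z t) z v))) (at z)"
proof -
  obtain \<rho> where \<rho>: "0 < \<rho>" "ball z \<rho> \<subseteq> S" using S z openE by blast
  \<comment> \<open>The Leibniz rule wants the derivative as a bounded linear map that depends
    continuously on both variables. In finite dimension this follows from continuity of every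
    directional derivative.\<close>
  define fx where "fx = (\<lambda>y t. Blinfun (frechet_derivative (\<lambda>z. K z t) (at y)))"
  have fx: "blinfun_apply (fx y t) = frechet_derivative (\<lambda>z. K z t) (at y)"
    if "y \<in> S" "t \<in> {a..b}" for y t
    unfolding fx_def using cholo_on_has_derivative[OF K[OF that(2)] that(1)] has_derivative_bounded_linear
    by (metis bounded_linear_Blinfun_apply)
  have c: "continuous_on (ball z \<rho> \<times> cbox a b) (\<lambda>(y, t). fx y t)"
  proof (rule continuous_on_blinfun_componentwise)
    fix i :: "complex^'n"
    have "continuous_on (S \<times> {a..b}) (\<lambda>(z, t). fd (\<lambda>z. K z t) z i)"
      by (rule continuous_on_fd_param[OF S K cont])
    then have "continuous_on (ball z \<rho> \<times> cbox a b) (\<lambda>(z, t). fd (\<lambda>z. K z t) z i)"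
      by (rule continuous_on_subset) (use \<rho> in auto)
    then show "continuous_on (ball z \<rho> \<times> cbox a b) (\<lambda>x. blinfun_apply (case x of (y, t) \<Rightarrow> fx y t) i)"
      by (rule continuous_on_eq) (use \<rho> fx in \<open>auto simp: subset_eq\<close>)
  qed
  have cz: "continuous_on {a..b} (K y)" if "y \<in> S" for y
  proof -
    have "continuous_on {a..b} (\<lambda>t. case (y, t) of (z, t) \<Rightarrow> K z t)"
      by (rule continuous_on_compose2[OF cont]) (use that in \<open>auto intro!: continuous_intros\<close>)
    then show ?thesis by simp
  qed
  have "((\<lambda>z. integral (cbox a b) (K z)) has_derivative
      blinfun_apply (integral (cbox a b) (fx z))) (at z within ball z \<rho>)"
  proof (rule leibniz_rule[OF _ _ c])
    fix y t assume y: "y \<in> ball z \<rho>" "t \<in> cbox a b"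
    then show "((\<lambda>z. K z t) has_derivative blinfun_apply (fx y t)) (at y within ball z \<rho>)"
      using fx[of y t] cholo_on_has_derivative[OF K[of t], of y] \<rho>
      by (simp add: has_derivative_at_withinI subset_eq)
  next
    fix y assume "y \<in> ball z \<rho>"
    then have "y \<in> S" using \<rho> by auto
    then show "K y integrable_on cbox a b"
      using cz by (auto intro!: integrable_continuous_real)
  qed (use \<rho> in auto)
  then have "((\<lambda>z. integral {a..b} (K z)) has_derivative
      blinfun_apply (integral {a..b} (fx z))) (at z)"
    using \<rho> at_within_open[of z "ball z \<rho>"] by (simp add: cbox_interval)
  moreover have "blinfun_apply (integral {a..b} (fx z)) = (\<lambda>v. integral {a..b} (\<lambda>t. fd (\<lambda>z. K z t) z v))"
  proof
    fix v
    have "continuous_on (cbox a b) (fx z)"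
    proof -
      have "continuous_on (cbox a b) (\<lambda>t. case (z, t) of (y, t) \<Rightarrow> fx y t)"
        by (rule continuous_on_compose2[OF c]) (use \<rho> in \<open>auto intro!: continuous_intros\<close>)
      then show ?thesis by simp
    qed
    then have i: "fx z integrable_on cbox a b" by (rule integrable_continuous)
    then have "blinfun_apply (integral {a..b} (fx z)) v = integral {a..b} (\<lambda>t. fx z t v)"
      using blinfun_apply_integral[OF i, of v] by simp
    also have "\<dots> = integral {a..b} (\<lambda>t. fd (\<lambda>z. K z t) z v)"
      by (rule integral_cong) (use fx z in auto)
    finally show "blinfun_apply (integral {a..b} (fx z)) v = \<dots>" .
  qed
  ultimately show ?thesis by simp
qed

lemma fd_integral:
  fixes K :: "complex^'n \<Rightarrow> real \<Rightarrow> complex"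
  assumes "open S" "\<And>t. t \<in> {a..b} \<Longrightarrow> cholo_on (\<lambda>z. K z t) S"
    "continuous_on (S \<times> {a..b}) (\<lambda>(z, t). K z t)" "z \<in> S"
  shows "fd (\<lambda>z. integral {a..b} (K z)) z v = integral {a..b} (\<lambda>t. fd (\<lambda>z. K z t) z v)"
  by (rule fdI[OF has_derivative_cholo_integral[OF assms]])

lemma cholo_on_integral:
  fixes K :: "complex^'n \<Rightarrow> real \<Rightarrow> complex"
  assumes "open S" "\<And>t. t \<in> {a..b} \<Longrightarrow> cholo_on (\<lambda>z. K z t) S"
    "continuous_on (S \<times> {a..b}) (\<lambda>(z, t). K z t)"
  shows "cholo_on (\<lambda>z. integral {a..b} (K z)) S"
proof (rule cholo_onI[OF assms(1) has_derivative_cholo_integral[OF assms]])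
  fix z c v assume "z \<in> S"
  then have "integral {a..b} (\<lambda>t. fd (\<lambda>z. K z t) z (c *s v)) = integral {a..b} (\<lambda>t. c * fd (\<lambda>z. K z t) z v)"
    by (intro integral_cong cholo_on_fd_scale[OF assms(2)])
  then show "integral {a..b} (\<lambda>t. fd (\<lambda>z. K z t) z (c *s v)) = c * integral {a..b} (\<lambda>t. fd (\<lambda>z. K z t) z v)"
    by simp
qed

section \<open>Holomorphy and symmetry of second derivatives\<close>

lemma cholo_on_translate:
  assumes "cholo_on g S"
  shows "cholo_on (\<lambda>z. g (z + a)) ((\<lambda>z. z + a) -` S)"
    and "z + a \<in> S \<Longrightarrow> fd (\<lambda>z. g (z + a)) z v = fd g (z + a) v"
proof -
  have d: "((\<lambda>z. g (z + a)) has_derivative (\<lambda>v. fd g (z + a) v)) (at z)" if "z + a \<in> S" for z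
    by (rule has_derivative_cholo_compose[where F = "\<lambda>z. z + a", OF assms that]) (auto intro!: derivative_eq_intros)
  show "cholo_on (\<lambda>z. g (z + a)) ((\<lambda>z. z + a) -` S)"
    by (rule cholo_onI[OF _ d])
      (use cholo_on_open[OF assms] cholo_on_fd_scale[OF assms] in \<open>auto intro!: open_vimage continuous_intros\<close>)
  show "z + a \<in> S \<Longrightarrow> fd (\<lambda>z. g (z + a)) z v = fd g (z + a) v"
    using fdI[OF d] .
qed

text \<open>One circle serves both claims: Cauchy's formula writes \<open>fd g z v\<close> as an
  integral whose integrand is holomorphic in the base point, and differentiation under the integral
  gives holomorphy together with the formula for the differential.\<close>

lemma cholo_fd_local:
  assumes g: "cholo_on g S" and z: "z \<in> S"
  shows "\<exists>U r. 0 < r \<and> z \<in> U \<and> U \<subseteq> S \<and> cholo_on (\<lambda>z. fd g z v) U \<and>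
    (\<forall>t. norm t \<le> r \<longrightarrow> z + t *s v \<in> S) \<and>
    (\<forall>u. fd (\<lambda>z. fd g z v) z u = (1 / of_real r) *
      integral {0..1} (\<lambda>t. fd g (z + (of_real r * cis (2 * pi * t)) *s v) u * cis (- (2 * pi * t))))"
proof -
  obtain \<rho> r where \<rho>: "0 < \<rho>" "0 < r" "ball z \<rho> \<subseteq> S"
    "\<And>y t. y \<in> ball z \<rho> \<Longrightarrow> norm t \<le> r \<Longrightarrow> y + t *s v \<in> S"
    using cauchy_radius[OF cholo_on_open[OF g] z] by blast
  define K where "K = (\<lambda>y t. g (y + (of_real r * cis (2 * pi * t)) *s v) * cis (- (2 * pi * t)))"
  have in_S: "y + (of_real r * cis (2 * pi * t)) *s v \<in> S" if "y \<in> ball z \<rho>" for y t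
    using \<rho> that by (auto simp: norm_mult)
  have K: "cholo_on (\<lambda>y. K y t) (ball z \<rho>)" for t
    unfolding K_def
    by (intro cholo_on_mult cholo_on_const open_ball cholo_on_subset[OF cholo_on_translate(1)[OF g]])
      (use in_S in auto)
  have Kd: "fd (\<lambda>y. K y t) z u = fd g (z + (of_real r * cis (2 * pi * t)) *s v) u * cis (- (2 * pi * t))" for t u
  proof -
    have "z \<in> ball z \<rho>" using \<rho> by simp
    note iz = in_S[OF this, of t]
    have "((\<lambda>y. K y t) has_derivative
       (\<lambda>u. fd g (z + (of_real r * cis (2 * pi * t)) *s v) u * cis (- (2 * pi * t)))) (at z)"
      unfolding K_def
      by (intro has_derivative_mult_left has_derivative_cholo_compose[where F = "\<lambda>y. y + (of_real r * cis (2 * pi * t)) *s v", OF g iz])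
        (auto intro!: derivative_eq_intros)
    then show ?thesis by (rule fdI)
  qed
  have cont: "continuous_on (ball z \<rho> \<times> {0..1}) (\<lambda>(y, t). K y t)"
    unfolding K_def case_prod_unfold
    by (intro continuous_intros continuous_on_compose2[OF cholo_on_continuous[OF g]]) (use in_S in auto)
  have eq: "fd g y v = (1 / of_real r) * integral {0..1} (K y)" if "y \<in> ball z \<rho>" for y
    unfolding K_def by (rule cauchy_directional_derivative[OF g \<rho>(2) \<rho>(4)[OF that]])
  have int: "cholo_on (\<lambda>y. integral {0..1} (K y)) (ball z \<rho>)"
    by (rule cholo_on_integral[OF open_ball K cont])
  have "cholo_on (\<lambda>y. fd g y v) (ball z \<rho>)"
    by (rule cholo_on_cong[OF eq[symmetric] cholo_on_cmult[OF int]])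
  moreover have "fd (\<lambda>y. fd g y v) z u = (1 / of_real r) * integral {0..1} (\<lambda>t. fd (\<lambda>y. K y t) z u)" for u
  proof -
    have "fd (\<lambda>y. fd g y v) z u = fd (\<lambda>y. (1 / of_real r) * integral {0..1} (K y)) z u"
      by (subst fd_cong[OF open_ball _ eq]) (use \<rho> in auto)
    also have "\<dots> = (1 / of_real r) * fd (\<lambda>y. integral {0..1} (K y)) z u"
      by (rule fd_cmult[OF int]) (use \<rho> in auto)
    also have "fd (\<lambda>y. integral {0..1} (K y)) z u = integral {0..1} (\<lambda>t. fd (\<lambda>y. K y t) z u)"
      by (rule fd_integral[OF open_ball K cont]) (use \<rho> in auto)
    finally show ?thesis .
  qed
  ultimately show ?thesis using \<rho> unfolding Kd by (intro exI[of _ "ball z \<rho>"] exI[of _ r]) auto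
qed

lemma cholo_on_fd: "cholo_on g S \<Longrightarrow> cholo_on (\<lambda>z. fd g z v) S"
proof (rule cholo_on_local)
  assume g: "cholo_on g S"
  then show "open S" by (rule cholo_on_open)
  show "\<exists>T. z \<in> T \<and> cholo_on (\<lambda>z. fd g z v) T" if "z \<in> S" for z
    using cholo_fd_local[OF g that, of v] by (elim exE conjE) (intro exI conjI)
qed

text \<open>Both sides are the same circle integral. On the left, \<open>fd g _ v\<close> is
  replaced by Cauchy's integral and differentiated in direction \<open>u\<close> under the integral
  sign; on the right, Cauchy's formula in direction \<open>v\<close> is applied to the function
  \<open>fd g _ u\<close>.\<close>

lemma fd_fd_symmetric:
  assumes "cholo_on g S" "z \<in> S"
  shows "fd (\<lambda>z. fd g z v) z u = fd (\<lambda>z. fd g z u) z v"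
proof -
  obtain r where r: "0 < r" "\<forall>t. norm t \<le> r \<longrightarrow> z + t *s v \<in> S"
    "\<forall>u. fd (\<lambda>z. fd g z v) z u = (1 / of_real r) *
      integral {0..1} (\<lambda>t. fd g (z + (of_real r * cis (2 * pi * t)) *s v) u * cis (- (2 * pi * t)))"
    using cholo_fd_local[OF assms, of v] by (elim exE conjE) (rule that)
  show ?thesis
    unfolding r(3)[rule_format]
    by (rule cauchy_directional_derivative[OF cholo_on_fd[OF assms(1)] r(1) r(2)[rule_format], symmetric])
qed


section \<open>Exterior calculus\<close>

subsection \<open>Lists with one entry removed\<close>

definition remove_nth :: "nat \<Rightarrow> 'b list \<Rightarrow> 'b list" where
  "remove_nth i xs = take i xs @ drop (Suc i) xs"

lemma length_remove_nth [simp]: "i < length xs \<Longrightarrow> length (remove_nth i xs) = length xs - 1"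
  by (simp add: remove_nth_def)

lemma remove_nth_0 [simp]: "remove_nth 0 (x # xs) = xs"
  by (simp add: remove_nth_def)

lemma remove_nth_Suc [simp]: "remove_nth (Suc i) (x # xs) = x # remove_nth i xs"
  by (simp add: remove_nth_def)

lemma map_remove_nth: "map g (remove_nth i xs) = remove_nth i (map g xs)"
  by (simp add: remove_nth_def take_map drop_map)

lemma remove_nth_nth:
  "i < length xs \<Longrightarrow> k < length xs - 1 \<Longrightarrow> remove_nth i xs ! k = (if k < i then xs ! k else xs ! Suc k)"
  by (auto simp: remove_nth_def nth_append min_def)

lemma remove_nth_commute:
  "i \<le> k \<Longrightarrow> Suc k < length xs \<Longrightarrow> remove_nth i (remove_nth (Suc k) xs) = remove_nth k (remove_nth i xs)"
  by (rule nth_equalityI) (auto simp: remove_nth_nth)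

lemma remove_nth_update_same: "k < length xs \<Longrightarrow> remove_nth k (xs[k := x]) = remove_nth k xs"
  by (rule nth_equalityI) (auto simp: remove_nth_nth)

lemma remove_nth_update:
  "i < length xs \<Longrightarrow> k < length xs \<Longrightarrow> i \<noteq> k \<Longrightarrow>
    remove_nth i (xs[k := x]) = (remove_nth i xs)[(if k < i then k else k - 1) := x]"
  by (rule nth_equalityI) (auto simp: remove_nth_nth nth_list_update)

text \<open>Pairs \<open>k < i\<close> and \<open>i \<le> k\<close> of removed positions cancel, as in \<open>d \<circ> d = 0\<close>.\<close>

lemma sum_remove_two_symmetric:
  fixes C :: "'b \<Rightarrow> 'b \<Rightarrow> 'b list \<Rightarrow> complex"
  assumes C: "\<And>x y zs. C x y zs = C y x zs" and len: "length vs = Suc j"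
  shows "(\<Sum>i<Suc j. \<Sum>k<j. (-1) ^ (i + k) *
    C (vs ! i) (remove_nth i vs ! k) (remove_nth k (remove_nth i vs))) = 0"
proof -
  define T where "T = (\<lambda>(i, k). (-1) ^ (i + k) *
    C (vs ! i) (remove_nth i vs ! k) (remove_nth k (remove_nth i vs)))"
  define P1 P2 where "P1 = {(i, k). i < Suc j \<and> k < j \<and> k < i}" and
    "P2 = {(i, k). i < Suc j \<and> k < j \<and> i \<le> k}"
  have un: "{..<Suc j} \<times> {..<j} = P1 \<union> P2" "P1 \<inter> P2 = {}" by (auto simp: P1_def P2_def)
  have fin: "finite P1" "finite P2"
    by (rule finite_subset[of _ "{..<Suc j} \<times> {..<j}"]; auto simp: P1_def P2_def)+
  have "sum T P1 = (\<Sum>(i, k)\<in>P2. T (Suc k, i))"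
    by (rule sum.reindex_bij_witness[of _ "\<lambda>(i, k). (Suc k, i)" "\<lambda>(i, k). (k, i - 1)"])
      (auto simp: P1_def P2_def)
  also have "\<dots> = (\<Sum>x\<in>P2. - T x)"
  proof (rule sum.cong)
    fix x assume x: "x \<in> P2"
    obtain i k where ik: "x = (i, k)" by (cases x)
    have le: "i \<le> k" "Suc k < length vs" using x ik len by (auto simp: P2_def)
    then have "remove_nth (Suc k) vs ! i = vs ! i" "remove_nth i vs ! k = vs ! Suc k"
      by (auto simp: remove_nth_nth)
    with le show "(case x of (i, k) \<Rightarrow> T (Suc k, i)) = - T x"
      using C[of "vs ! i" "vs ! Suc k"] by (simp add: ik T_def remove_nth_commute add.commute)
  qed simp
  finally have "sum T P1 + sum T P2 = 0" by (simp add: sum_negf)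
  then have "sum T ({..<Suc j} \<times> {..<j}) = 0"
    using un fin by (simp add: sum.union_disjoint)
  then show ?thesis by (simp add: T_def sum.cartesian_product)
qed


subsection \<open>Alternating maps\<close>

lemma alternating_linear:
  "alternating j m \<Longrightarrow> length vs = j \<Longrightarrow> i < j \<Longrightarrow>
    m (vs[i := a *s x + b *s y]) = a * m (vs[i := x]) + b * m (vs[i := y])"
  unfolding alternating_def by blast

lemma alternating_eq_0:
  "alternating j m \<Longrightarrow> length vs = j \<Longrightarrow> i < j \<Longrightarrow> k < i \<Longrightarrow> vs ! i = vs ! k \<Longrightarrow> m vs = 0"
  unfolding alternating_def by blast

lemma alternating_linear_append:
  assumes "alternating j m" "length us + length ws + 1 = j"
  shows "m (us @ (a *s x + b *s y) # ws) = a * m (us @ x # ws) + b * m (us @ y # ws)"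
  using alternating_linear[OF assms(1), of "us @ 0 # ws" "length us" a x b y] assms(2) by simp

lemma alternating_add_append:
  assumes "alternating j m" "length us + length ws + 1 = j"
  shows "m (us @ (x + y) # ws) = m (us @ x # ws) + m (us @ y # ws)"
  using alternating_linear_append[OF assms, of 1 x 1 y] by simp

lemma alternating_0_append:
  assumes "alternating j m" "length us + length ws + 1 = j"
  shows "m (us @ 0 # ws) = 0"
  using alternating_linear_append[OF assms, of 0 0 0 0] by simp

lemma linear_functional_expand:
  fixes l :: "complex^'n \<Rightarrow> complex"
  assumes "\<And>a b x y. l (a *s x + b *s y) = a * l x + b * l y"
  shows "l v = (\<Sum>a\<in>UNIV. v $ a * l (axis a 1))"
proof -
  have 0: "l 0 = 0" using assms[of 0 0 0 0] by simp
  have add: "l (x + y) = l x + l y" for x y using assms[of 1 x 1 y] by simp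
  have scale: "l (a *s x) = a * l x" for a x using assms[of a x 0 0] by simp
  have "l (\<Sum>a\<in>I. (v $ a) *s axis a 1) = (\<Sum>a\<in>I. v $ a * l (axis a 1))" for I :: "'n set"
    by (induction I rule: infinite_finite_induct) (simp_all add: 0 add scale)
  from this[of UNIV] show ?thesis by (simp add: sum_axis_scalar)
qed

text \<open>\<open>holo_form\<close> speaks only of constant arguments. Expanding an argument in the
  standard basis reduces values on varying vectors to coefficient functions times values on constant
  ones.\<close>

lemma alternating_expand:
  assumes "alternating j m" "length us + length ws + 1 = j"
  shows "m (us @ v # ws) = (\<Sum>a\<in>UNIV. v $ a * m (us @ axis a 1 # ws))"
  by (rule linear_functional_expand[of "\<lambda>v. m (us @ v # ws)"])
    (rule alternating_linear_append[OF assms])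

lemma alternating_swap:
  assumes m: "alternating j m" and len: "length us + length ws + 2 = j"
  shows "m (us @ x # y # ws) = - m (us @ y # x # ws)"
proof -
  have eq0: "m (us @ u # u # ws) = 0" for u
    by (rule alternating_eq_0[OF m, of _ "Suc (length us)" "length us"])
      (use len in \<open>simp_all add: nth_append\<close>)
  have 1: "m (us @ (x + y) # w # ws) = m (us @ x # w # ws) + m (us @ y # w # ws)" for w
    by (rule alternating_add_append[OF m]) (use len in simp)
  have 2: "m (us @ w # (x + y) # ws) = m (us @ w # x # ws) + m (us @ w # y # ws)" for w
    using alternating_add_append[OF m, of "us @ [w]" ws x y] len by simp
  have "0 = m (us @ (x + y) # (x + y) # ws)" by (simp add: eq0)
  also have "\<dots> = m (us @ x # y # ws) + m (us @ y # x # ws)"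
    unfolding 1 2 by (simp add: eq0)
  finally show ?thesis by (simp add: eq_neg_iff_add_eq_0)
qed

lemma alternating_move_front:
  assumes m: "alternating j m" and "length us + length ws + 1 = j"
  shows "m (us @ x # ws) = (-1) ^ length us * m (x # us @ ws)"
  using assms(2)
proof (induction us arbitrary: ws rule: rev_induct)
  case (snoc u us)
  have "m ((us @ [u]) @ x # ws) = - m (us @ x # u # ws)"
    using alternating_swap[OF m, of us ws u x] snoc.prems by simp
  also have "\<dots> = - ((-1) ^ length us * m (x # us @ u # ws))"
    by (subst snoc.IH) (use snoc.prems in auto)
  finally show ?case by simp
qed simp

text \<open>Converts a replaced entry, the shape in which product rules produce it, into a front
  entry followed by the list without that position, the shape in which \<open>ext_d\<close> and
  contraction use it.\<close>

lemma alternating_update_front: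
  assumes m: "alternating j m" and "length vs = j" "i < j"
  shows "m (vs[i := x]) = (-1) ^ i * m (x # remove_nth i vs)"
  using alternating_move_front[OF m, of "take i vs" "drop (Suc i) vs" x] assms(2,3)
  by (simp add: upd_conv_take_nth_drop remove_nth_def min_def)

lemma alternating_scale: "alternating j m \<Longrightarrow> alternating j (\<lambda>vs. c * m vs)"
  unfolding alternating_def by (simp add: algebra_simps)

lemma alternating_add:
  "alternating j m \<Longrightarrow> alternating j m' \<Longrightarrow> alternating j (\<lambda>vs. m vs + m' vs)"
  unfolding alternating_def by (simp add: algebra_simps)

lemma alternating_map:
  assumes "alternating j m" "\<And>a b x y. F (a *s x + b *s y) = a *s F x + b *s F y"
  shows "alternating j (\<lambda>vs. m (map F vs))"
  using assms unfolding alternating_def by (simp add: map_update)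

lemma alternating_Cons:
  fixes m :: "(complex^'n) list \<Rightarrow> complex"
  assumes m: "alternating (Suc j) m"
  shows "alternating j (\<lambda>us. m (x # us))"
  unfolding alternating_def
proof (intro allI impI conjI)
  fix vs :: "(complex^'n) list" and i a b x' y assume len: "length vs = j" "i < j"
  show "m (x # vs[i := a *s x' + b *s y]) = a * m (x # vs[i := x']) + b * m (x # vs[i := y])"
    using alternating_linear[OF m, of "x # vs" "Suc i" a x' b y] len by simp
next
  fix vs :: "(complex^'n) list" and i k assume len: "length vs = j" "i < j" "k < i" "vs ! i = vs ! k"
  show "m (x # vs) = 0"
    by (rule alternating_eq_0[OF m, of _ "Suc i" "Suc k"]) (use len in auto)
qed

text \<open>The exterior product of a covector with a form, expanded over the slot handed to the
  covector. Signs and removed positions are those of \<open>ext_d\<close>, so that d and \<theta>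
  can be compared term by term.\<close>

definition wedge1 :: "(complex^'n \<Rightarrow> complex) \<Rightarrow> ((complex^'n) list \<Rightarrow> complex) \<Rightarrow> (complex^'n) list \<Rightarrow> complex" where
  "wedge1 l m vs = (\<Sum>i<length vs. (-1) ^ i * l (vs ! i) * m (remove_nth i vs))"

text \<open>For a repeated vector only the two summands that remove one of its copies survive.
  Moving the remaining copy to the front shows that they have opposite signs.\<close>

lemma alternating_wedge1:
  fixes m :: "(complex^'n) list \<Rightarrow> complex"
  assumes m: "alternating j m" and l: "\<And>a b x y. l (a *s x + b *s y) = a * l x + b * l y"
  shows "alternating (Suc j) (wedge1 l m)"
  unfolding alternating_def
proof (intro allI impI conjI)
  fix vs :: "(complex^'n) list" and k a b x y assume len: "length vs = Suc j" "k < Suc j"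
  have "(-1) ^ i * l (vs[k := a *s x + b *s y] ! i) * m (remove_nth i (vs[k := a *s x + b *s y])) =
      a * ((-1) ^ i * l (vs[k := x] ! i) * m (remove_nth i (vs[k := x]))) +
      b * ((-1) ^ i * l (vs[k := y] ! i) * m (remove_nth i (vs[k := y])))" if i: "i < Suc j" for i
  proof (cases "i = k")
    case True
    then show ?thesis using len by (simp add: remove_nth_update_same l algebra_simps)
  next
    case False
    define k' where "k' = (if k < i then k else k - 1)"
    have k': "k' < j" using False i len by (auto simp: k'_def)
    have "remove_nth i (vs[k := u]) = (remove_nth i vs)[k' := u]" for u
      using False i len by (simp add: remove_nth_update k'_def)
    then show ?thesis
      using False i len alternating_linear[OF m _ k', of "remove_nth i vs" a x b y]
      by (simp add: algebra_simps)
  qed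
  then show "wedge1 l m (vs[k := a *s x + b *s y]) = a * wedge1 l m (vs[k := x]) + b * wedge1 l m (vs[k := y])"
    unfolding wedge1_def length_list_update len sum_distrib_left sum.distrib[symmetric]
    by (intro sum.cong) auto
next
  fix vs :: "(complex^'n) list" and i k assume len: "length vs = Suc j" "i < Suc j" "k < i" and eq: "vs ! i = vs ! k"
  define t where "t = (\<lambda>s. (-1) ^ s * l (vs ! s) * m (remove_nth s vs))"
  have "t s = 0" if s: "s < Suc j" "s \<noteq> i" "s \<noteq> k" for s
  proof -
    \<comment> \<open>Positions of the two equal entries once entry \<open>s\<close> has been
      removed.\<close>
    define i' k' where "i' = (if i < s then i else i - 1)" and "k' = (if k < s then k else k - 1)"
    have "m (remove_nth s vs) = 0"
      by (rule alternating_eq_0[OF m, of _ i' k'])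
        (use s len eq in \<open>auto simp: i'_def k'_def remove_nth_nth\<close>)
    then show ?thesis by (simp add: t_def)
  qed
  then have "(\<Sum>s<Suc j. t s) = (\<Sum>s\<in>{i, k}. t s)"
    by (intro sum.mono_neutral_right) (use len in auto)
  also have "\<dots> = t i + t k" using len by simp
  also have "\<dots> = 0"
  proof -
    \<comment> \<open>Without the earlier position \<open>k\<close>, the entry at \<open>i\<close>
      sits at \<open>i - 1\<close>; this shift supplies the extra sign.\<close>
    obtain i' where i': "i = Suc i'" using len by (cases i) auto
    have "m (remove_nth i vs) = m ((remove_nth i vs)[k := vs ! k])"
      using len by (metis list_update_id remove_nth_nth diff_Suc_1 less_Suc_eq_le order_less_le_trans)
    also have "\<dots> = (-1) ^ k * m (vs ! k # remove_nth k (remove_nth i vs))"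
      by (rule alternating_update_front[OF m]) (use len in auto)
    also have "remove_nth k (remove_nth i vs) = remove_nth i' (remove_nth k vs)"
      unfolding i' by (rule remove_nth_commute) (use len i' in auto)
    finally have 1: "m (remove_nth i vs) = (-1) ^ k * m (vs ! k # remove_nth i' (remove_nth k vs))" .
    have "remove_nth k vs ! i' = vs ! k" using len i' eq by (subst remove_nth_nth) auto
    then have "m (remove_nth k vs) = m ((remove_nth k vs)[i' := vs ! k])"
      by (metis list_update_id)
    also have "\<dots> = (-1) ^ i' * m (vs ! k # remove_nth i' (remove_nth k vs))"
      by (rule alternating_update_front[OF m]) (use len i' in auto)
    finally have 2: "m (remove_nth k vs) = \<dots>" .
    show ?thesis unfolding t_def 1 2 eq by (simp add: i')
  qed
  finally show "wedge1 l m vs = 0" unfolding wedge1_def t_def using len by simp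
qed


subsection \<open>Holomorphic forms\<close>

lemma ext_d_remove_nth:
  "ext_d \<omega> z vs = (\<Sum>i<length vs. (-1) ^ i * fd (\<lambda>z'. \<omega> z' (remove_nth i vs)) z (vs ! i))"
  by (simp add: ext_d_def remove_nth_def)

lemma holo_form_open: "holo_form j S \<omega> \<Longrightarrow> open S"
  and holo_form_alternating: "holo_form j S \<omega> \<Longrightarrow> z \<in> S \<Longrightarrow> alternating j (\<omega> z)"
  and holo_form_cholo: "holo_form j S \<omega> \<Longrightarrow> length vs = j \<Longrightarrow> cholo_on (\<lambda>z. \<omega> z vs) S"
  unfolding holo_form_def by blast+

lemma holo_form_subset: "holo_form j S \<omega> \<Longrightarrow> open T \<Longrightarrow> T \<subseteq> S \<Longrightarrow> holo_form j T \<omega>"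
  unfolding holo_form_def using cholo_on_subset by blast

lemma alternating_cong:
  assumes "\<And>vs. length vs = j \<Longrightarrow> m vs = m' vs"
  shows "alternating j m = alternating j m'"
  unfolding alternating_def by (rule all_cong) (simp add: assms cong: conj_cong)

lemma holo_form_cong:
  assumes "\<And>z vs. z \<in> S \<Longrightarrow> length vs = j \<Longrightarrow> \<omega> z vs = \<omega>' z vs" "holo_form j S \<omega>"
  shows "holo_form j S \<omega>'"
  unfolding holo_form_def
proof (intro conjI ballI allI impI)
  show "open S" using assms(2) by (rule holo_form_open)
  show "alternating j (\<omega>' z)" if "z \<in> S" for z
    using holo_form_alternating[OF assms(2) that] alternating_cong[of j "\<omega> z" "\<omega>' z"] assms(1)[OF that]
    by blast
  show "cholo_on (\<lambda>z. \<omega>' z vs) S" if "length vs = j" for vs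
    by (rule cholo_on_cong[OF assms(1)[OF _ that] holo_form_cholo[OF assms(2) that]])
qed

lemma holo_form_mult:
  "cholo_on g S \<Longrightarrow> holo_form j S \<omega> \<Longrightarrow> holo_form j S (\<lambda>z vs. g z * \<omega> z vs)"
  unfolding holo_form_def by (auto intro: alternating_scale)

lemma holo_form_scale: "holo_form j S \<omega> \<Longrightarrow> holo_form j S (\<lambda>z vs. c * \<omega> z vs)"
  using holo_form_mult[OF cholo_on_const] holo_form_open by blast

lemma holo_form_add:
  "holo_form j S \<omega> \<Longrightarrow> holo_form j S \<omega>' \<Longrightarrow> holo_form j S (\<lambda>z vs. \<omega> z vs + \<omega>' z vs)"
  unfolding holo_form_def by (auto intro: alternating_add)

lemma holo_form_zero: "open S \<Longrightarrow> holo_form j S (\<lambda>z vs. 0)"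
  unfolding holo_form_def by (auto simp: alternating_def)

lemma ext_d_cong:
  assumes "open S" "z \<in> S" "\<And>y us. y \<in> S \<Longrightarrow> Suc (length us) = length vs \<Longrightarrow> \<omega> y us = \<omega>' y us"
  shows "ext_d \<omega> z vs = ext_d \<omega>' z vs"
  unfolding ext_d_remove_nth
proof (rule sum.cong)
  fix i assume "i \<in> {..<length vs}"
  then have "Suc (length (remove_nth i vs)) = length vs" by auto
  from fd_cong[OF assms(1,2) assms(3)[OF _ this]]
  show "(-1) ^ i * fd (\<lambda>z'. \<omega> z' (remove_nth i vs)) z (vs ! i) =
    (-1) ^ i * fd (\<lambda>z'. \<omega>' z' (remove_nth i vs)) z (vs ! i)" by simp
qed simp

lemma ext_d_mult:
  assumes g: "cholo_on g S" and \<omega>: "holo_form j S \<omega>" and z: "z \<in> S" and len: "length vs = Suc j"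
  shows "ext_d (\<lambda>z vs. g z * \<omega> z vs) z vs = g z * ext_d \<omega> z vs + wedge1 (fd g z) (\<omega> z) vs"
proof -
  have "fd (\<lambda>z. g z * \<omega> z (remove_nth i vs)) z v =
      g z * fd (\<lambda>z. \<omega> z (remove_nth i vs)) z v + fd g z v * \<omega> z (remove_nth i vs)" if "i < Suc j" for i v
    by (rule fd_mult[OF g holo_form_cholo[OF \<omega>] z]) (use that len in simp)
  then show ?thesis
    unfolding ext_d_remove_nth wedge1_def sum_distrib_left sum.distrib[symmetric]
    by (intro sum.cong) (simp_all add: len algebra_simps)
qed

lemma holo_form_wedge1:
  assumes g: "cholo_on g S" and \<omega>: "holo_form j S \<omega>"
  shows "holo_form (Suc j) S (\<lambda>z. wedge1 (fd g z) (\<omega> z))"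
  unfolding holo_form_def
proof (intro conjI ballI allI impI)
  show S: "open S" using g by (rule cholo_on_open)
  show "alternating (Suc j) (wedge1 (fd g z) (\<omega> z))" if z: "z \<in> S" for z
    by (rule alternating_wedge1[OF holo_form_alternating[OF \<omega> z]])
      (simp add: cholo_on_fd_add[OF g z] cholo_on_fd_scale[OF g z])
  show "cholo_on (\<lambda>z. wedge1 (fd g z) (\<omega> z) vs) S" if len: "length vs = Suc j" for vs
    unfolding wedge1_def
    by (intro cholo_on_sum S cholo_on_mult cholo_on_const cholo_on_fd g holo_form_cholo[OF \<omega>])
      (use len in auto)
qed

text \<open>The first entries \<open>us\<close> are kept constant for the sake of the induction.\<close>

lemma cholo_form_apply:
  fixes \<omega> :: "'n::finite form"
  assumes \<omega>: "holo_form j T \<omega>" and G: "cholo_map_on G S" "\<And>z. z \<in> S \<Longrightarrow> G z \<in> T" and S: "open S"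
    and "\<And>Y. Y \<in> set Ys \<Longrightarrow> cholo_map_on Y S" "length us + length Ys = j"
  shows "cholo_on (\<lambda>z. \<omega> (G z) (us @ map (\<lambda>Y. Y z) Ys)) S"
    and "z \<in> S \<Longrightarrow> fd (\<lambda>z. \<omega> (G z) (us @ map (\<lambda>Y. Y z) Ys)) z v =
      fd (\<lambda>w. \<omega> w (us @ map (\<lambda>Y. Y z) Ys)) (G z) (frechet_derivative G (at z) v) +
      (\<Sum>k<length Ys. \<omega> (G z) (us @ (map (\<lambda>Y. Y z) Ys)[k := frechet_derivative (Ys ! k) (at z) v]))"
proof -
  have "cholo_on (\<lambda>z. \<omega> (G z) (us @ map (\<lambda>Y. Y z) Ys)) S \<and>
    (\<forall>z\<in>S. \<forall>v. fd (\<lambda>z. \<omega> (G z) (us @ map (\<lambda>Y. Y z) Ys)) z v =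
      fd (\<lambda>w. \<omega> w (us @ map (\<lambda>Y. Y z) Ys)) (G z) (frechet_derivative G (at z) v) +
      (\<Sum>k<length Ys. \<omega> (G z) (us @ (map (\<lambda>Y. Y z) Ys)[k := frechet_derivative (Ys ! k) (at z) v])))"
    using assms(5,6)
  proof (induction Ys arbitrary: us)
    case Nil
    then have h: "cholo_on (\<lambda>w. \<omega> w us) T" using holo_form_cholo[OF \<omega>] by simp
    then show ?case
      using cholo_on_compose[OF h G] fd_compose[OF h G(2) G(1)] by auto
  next
    case (Cons Y Ys)
    have Y: "cholo_map_on Y S" using Cons.prems by simp
    have Ya: "cholo_on (\<lambda>z. Y z $ a) S" for a using Y unfolding cholo_map_on_def by blast
    \<comment> \<open>The vector field at the head of the list is expanded in the standard basis.
      Each basis vector is constant and joins the prefix, so the induction hypothesis applies with a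
      longer prefix.\<close>
    define p where "p = (\<lambda>a. us @ [axis a 1 :: complex^'n])"
    have len: "length (p a) + length Ys = j" for a using Cons.prems by (simp add: p_def)
    have IH: "cholo_on (\<lambda>z. \<omega> (G z) (p a @ map (\<lambda>Y. Y z) Ys)) S"
      "\<And>z v. z \<in> S \<Longrightarrow> fd (\<lambda>z. \<omega> (G z) (p a @ map (\<lambda>Y. Y z) Ys)) z v =
      fd (\<lambda>w. \<omega> w (p a @ map (\<lambda>Y. Y z) Ys)) (G z) (frechet_derivative G (at z) v) +
      (\<Sum>k<length Ys. \<omega> (G z) (p a @ (map (\<lambda>Y. Y z) Ys)[k := frechet_derivative (Ys ! k) (at z) v]))" for a
      using Cons.IH[OF _ len] Cons.prems by auto
    have ex: "\<omega> w (us @ y # ys) = (\<Sum>a\<in>UNIV. y $ a * \<omega> w (p a @ ys))"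
      if "w \<in> T" "length ys = length Ys" for w y ys
      using alternating_expand[OF holo_form_alternating[OF \<omega> that(1)], of us ys y] that(2) Cons.prems
      by (simp add: p_def)
    have eq: "\<omega> (G z) (us @ map (\<lambda>Y. Y z) (Y # Ys)) = (\<Sum>a\<in>UNIV. Y z $ a * \<omega> (G z) (p a @ map (\<lambda>Y. Y z) Ys))"
      if "z \<in> S" for z using ex[OF G(2)[OF that]] by simp
    have c: "cholo_on (\<lambda>z. Y z $ a * \<omega> (G z) (p a @ map (\<lambda>Y. Y z) Ys)) S" for a
      by (intro cholo_on_mult Ya IH(1))
    have c1: "cholo_on (\<lambda>z. \<omega> (G z) (us @ map (\<lambda>Y. Y z) (Y # Ys))) S"
      by (rule cholo_on_cong[OF eq[symmetric] cholo_on_sum[OF S c]])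
    have "fd (\<lambda>z. \<omega> (G z) (us @ map (\<lambda>Y. Y z) (Y # Ys))) z v =
      fd (\<lambda>w. \<omega> w (us @ map (\<lambda>Y. Y z) (Y # Ys))) (G z) (frechet_derivative G (at z) v) +
      (\<Sum>k<length (Y # Ys). \<omega> (G z) (us @ (map (\<lambda>Y. Y z) (Y # Ys))[k := frechet_derivative ((Y # Ys) ! k) (at z) v]))"
      if z: "z \<in> S" for z v
    proof -
      define ys where "ys = map (\<lambda>Y. Y z) Ys"
      define u where "u = frechet_derivative G (at z) v"
      define R where "R = (\<lambda>k. ys[k := frechet_derivative (Ys ! k) (at z) v])"
      have lys: "length ys = length Ys" "length (R k) = length Ys" for k by (simp_all add: ys_def R_def)
      have pc: "cholo_on (\<lambda>w. \<omega> w (p a @ ys)) T" for a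
        by (rule holo_form_cholo[OF \<omega>]) (use len in \<open>simp add: lys\<close>)
      have 1: "fd (\<lambda>w. \<omega> w (us @ Y z # ys)) (G z) u = (\<Sum>a\<in>UNIV. Y z $ a * fd (\<lambda>w. \<omega> w (p a @ ys)) (G z) u)"
      proof -
        have "fd (\<lambda>w. \<omega> w (us @ Y z # ys)) (G z) u = fd (\<lambda>w. \<Sum>a\<in>UNIV. Y z $ a * \<omega> w (p a @ ys)) (G z) u"
          by (subst fd_cong[OF holo_form_open[OF \<omega>] G(2)[OF z] ex[OF _ lys(1)]]) auto
        also have "\<dots> = (\<Sum>a\<in>UNIV. fd (\<lambda>w. Y z $ a * \<omega> w (p a @ ys)) (G z) u)"
          by (rule fd_sum[OF G(2)[OF z] cholo_on_cmult[OF pc]])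
        also have "\<dots> = (\<Sum>a\<in>UNIV. Y z $ a * fd (\<lambda>w. \<omega> w (p a @ ys)) (G z) u)"
          by (intro sum.cong refl fd_cmult[OF pc G(2)[OF z]])
        finally show ?thesis .
      qed
      have 2: "\<omega> (G z) (us @ frechet_derivative Y (at z) v # ys) =
          (\<Sum>a\<in>UNIV. fd (\<lambda>z. Y z $ a) z v * \<omega> (G z) (p a @ ys))"
        unfolding ex[OF G(2)[OF z] lys(1)] cholo_map_fd[OF Y z] by simp
      have 3: "\<omega> (G z) (us @ Y z # R k) = (\<Sum>a\<in>UNIV. Y z $ a * \<omega> (G z) (p a @ R k))" for k
        by (rule ex[OF G(2)[OF z] lys(2)])
      have "fd (\<lambda>z. \<omega> (G z) (us @ map (\<lambda>Y. Y z) (Y # Ys))) z v =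
          fd (\<lambda>z. \<Sum>a\<in>UNIV. Y z $ a * \<omega> (G z) (p a @ map (\<lambda>Y. Y z) Ys)) z v"
        by (subst fd_cong[OF S z eq]) auto
      also have "\<dots> = (\<Sum>a\<in>UNIV. fd (\<lambda>z. Y z $ a * \<omega> (G z) (p a @ map (\<lambda>Y. Y z) Ys)) z v)"
        by (rule fd_sum[OF z c])
      also have "\<dots> = (\<Sum>a\<in>UNIV. Y z $ a * (fd (\<lambda>w. \<omega> w (p a @ ys)) (G z) u + (\<Sum>k<length Ys. \<omega> (G z) (p a @ R k))) +
          fd (\<lambda>z. Y z $ a) z v * \<omega> (G z) (p a @ ys))"
        by (intro sum.cong refl) (simp add: fd_mult[OF Ya IH(1) z] IH(2)[OF z] ys_def u_def R_def)
      also have "\<dots> = fd (\<lambda>w. \<omega> w (us @ Y z # ys)) (G z) u +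
          (\<omega> (G z) (us @ frechet_derivative Y (at z) v # ys) + (\<Sum>k<length Ys. \<omega> (G z) (us @ Y z # R k)))"
        unfolding 1 2 3 by (subst sum.swap[of _ UNIV]) (simp add: sum.distrib algebra_simps sum_distrib_left)
      finally show ?thesis
        by (simp add: sum.lessThan_Suc_shift ys_def u_def R_def del: sum.lessThan_Suc)
    qed
    with c1 show ?case by blast
  qed
  then show "cholo_on (\<lambda>z. \<omega> (G z) (us @ map (\<lambda>Y. Y z) Ys)) S"
    "z \<in> S \<Longrightarrow> fd (\<lambda>z. \<omega> (G z) (us @ map (\<lambda>Y. Y z) Ys)) z v =
      fd (\<lambda>w. \<omega> w (us @ map (\<lambda>Y. Y z) Ys)) (G z) (frechet_derivative G (at z) v) +
      (\<Sum>k<length Ys. \<omega> (G z) (us @ (map (\<lambda>Y. Y z) Ys)[k := frechet_derivative (Ys ! k) (at z) v]))"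
    by blast+
qed

text \<open>The parameter may be any topological space here. The case needed is a pair of a point
  and a real time, for the integrand of the average.\<close>

lemma continuous_on_form_apply:
  fixes \<omega> :: "'n::finite form" and G :: "'q::topological_space \<Rightarrow> complex^'n"
  assumes \<omega>: "holo_form j T \<omega>" and G: "continuous_on Q G" "\<And>q. q \<in> Q \<Longrightarrow> G q \<in> T"
    and "\<And>Y. Y \<in> set Ys \<Longrightarrow> continuous_on Q Y" "length us + length Ys = j"
  shows "continuous_on Q (\<lambda>q. \<omega> (G q) (us @ map (\<lambda>Y. Y q) Ys))"
  using assms(4,5)
proof (induction Ys arbitrary: us)
  case Nil
  then have "continuous_on T (\<lambda>w. \<omega> w us)" by (intro cholo_on_continuous holo_form_cholo[OF \<omega>]) simp
  from continuous_on_compose2[OF this G(1)] show ?case using G(2) by auto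
next
  case (Cons Y Ys)
  have eq: "\<omega> (G q) (us @ map (\<lambda>Y. Y q) (Y # Ys)) =
      (\<Sum>a\<in>UNIV. Y q $ a * \<omega> (G q) ((us @ [axis a 1]) @ map (\<lambda>Y. Y q) Ys))" if "q \<in> Q" for q
    using alternating_expand[OF holo_form_alternating[OF \<omega> G(2)[OF that]], of us "map (\<lambda>Y. Y q) Ys" "Y q"] Cons.prems
    by simp
  have "continuous_on Q (\<lambda>q. \<Sum>a\<in>UNIV. Y q $ a * \<omega> (G q) ((us @ [axis a 1]) @ map (\<lambda>Y. Y q) Ys))"
    by (intro continuous_intros Cons.IH) (use Cons.prems in auto)
  then show ?case by (rule continuous_on_eq) (rule eq[symmetric])
qed


subsection \<open>Pullback\<close>

definition pullback :: "(complex^'n \<Rightarrow> complex^'n) \<Rightarrow> 'n form \<Rightarrow> 'n form" where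
  "pullback G \<omega> z vs = \<omega> (G z) (map (frechet_derivative G (at z)) vs)"

lemma cholo_map_fd_cholo:
  assumes "cholo_map_on G S" "open S"
  shows "cholo_map_on (\<lambda>z. frechet_derivative G (at z) v) S"
proof -
  have "cholo_on (\<lambda>z. frechet_derivative G (at z) v $ i) S" for i
  proof (rule cholo_on_cong)
    show "cholo_on (\<lambda>z. fd (\<lambda>z. G z $ i) z v) S"
      using assms(1) unfolding cholo_map_on_def by (intro cholo_on_fd) blast
  qed (simp add: cholo_map_fd[OF assms(1)])
  then show ?thesis unfolding cholo_map_on_def by blast
qed

lemma holo_form_pullback:
  assumes \<omega>: "holo_form j T \<omega>" and G: "cholo_map_on G S" "\<And>z. z \<in> S \<Longrightarrow> G z \<in> T" and S: "open S"
  shows "holo_form j S (pullback G \<omega>)"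
  unfolding holo_form_def
proof (intro conjI ballI allI impI S)
  show "alternating j (pullback G \<omega> z)" if "z \<in> S" for z
    unfolding pullback_def
    by (rule alternating_map[OF holo_form_alternating[OF \<omega> G(2)[OF that]]])
      (simp add: cholo_map_fd_add[OF G(1) that] cholo_map_fd_scale[OF G(1) that])
  show "cholo_on (\<lambda>z. pullback G \<omega> z vs) S" if "length vs = j" for vs
    using cholo_form_apply(1)[OF \<omega> G S, where us = "[]" and Ys = "map (\<lambda>v z. frechet_derivative G (at z) v) vs"] that
      cholo_map_fd_cholo[OF G(1) S]
    by (auto simp: pullback_def o_def)
qed

text \<open>Besides the desired terms the chain rule produces the second derivative of
  \<open>G\<close>, inserted in one slot. It is symmetric in the removed vector and the vector of
  that slot, so these terms cancel in pairs by \<open>sum_remove_two_symmetric\<close>.\<close>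

lemma ext_d_pullback:
  assumes \<omega>: "holo_form j T \<omega>" and G: "cholo_map_on G S" "\<And>z. z \<in> S \<Longrightarrow> G z \<in> T" and S: "open S"
    and z: "z \<in> S" and len: "length vs = Suc j"
  shows "ext_d (pullback G \<omega>) z vs = pullback G (ext_d \<omega>) z vs"
proof -
  define D where "D = frechet_derivative G (at z)"
  define B where "B = (\<lambda>x y. frechet_derivative (\<lambda>z. frechet_derivative G (at z) y) (at z) x)"
  have Ga: "cholo_on (\<lambda>z. G z $ a) S" for a using G(1) unfolding cholo_map_on_def by blast
  have "B x y $ a = fd (\<lambda>z. fd (\<lambda>z. G z $ a) z y) z x" for x y a
    unfolding B_def cholo_map_fd[OF cholo_map_fd_cholo[OF G(1) S] z] vec_lambda_beta
    by (subst fd_cong[OF S z]) (auto simp: cholo_map_fd[OF G(1)])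
  then have Bsym: "B x y = B y x" for x y
    using fd_fd_symmetric[OF Ga z] by (simp add: vec_eq_iff)
  have 1: "fd (\<lambda>z. pullback G \<omega> z us) z v = fd (\<lambda>w. \<omega> w (map D us)) (G z) (D v) +
      (\<Sum>k<j. (-1) ^ k * \<omega> (G z) (B v (us ! k) # map D (remove_nth k us)))" if us: "length us = j" for us v
  proof -
    have "fd (\<lambda>z. pullback G \<omega> z us) z v = fd (\<lambda>w. \<omega> w (map D us)) (G z) (D v) +
      (\<Sum>k<j. \<omega> (G z) ((map D us)[k := B v (us ! k)]))"
      using cholo_form_apply(2)[OF \<omega> G S, where us = "[]" and Ys = "map (\<lambda>v z. frechet_derivative G (at z) v) us" and z = z and v = v]
        cholo_map_fd_cholo[OF G(1) S] us z
      by (auto simp: pullback_def o_def D_def B_def)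
    moreover have "\<omega> (G z) ((map D us)[k := B v (us ! k)]) =
        (-1) ^ k * \<omega> (G z) (B v (us ! k) # map D (remove_nth k us))" if "k < j" for k
      using alternating_update_front[OF holo_form_alternating[OF \<omega> G(2)[OF z]], of "map D us" k] us that
      by (simp add: map_remove_nth)
    ultimately show ?thesis by simp
  qed
  have "ext_d (pullback G \<omega>) z vs =
    (\<Sum>i<Suc j. (-1) ^ i * fd (\<lambda>w. \<omega> w (map D (remove_nth i vs))) (G z) (D (vs ! i))) +
    (\<Sum>i<Suc j. \<Sum>k<j. (-1) ^ (i + k) *
      \<omega> (G z) (B (vs ! i) (remove_nth i vs ! k) # map D (remove_nth k (remove_nth i vs))))"
    unfolding ext_d_remove_nth len sum.distrib[symmetric]
  proof (rule sum.cong[OF refl])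
    fix i assume "i \<in> {..<Suc j}"
    then have l: "length (remove_nth i vs) = j" using len by simp
    show "(-1) ^ i * fd (\<lambda>z'. pullback G \<omega> z' (remove_nth i vs)) z (vs ! i) =
      (-1) ^ i * fd (\<lambda>w. \<omega> w (map D (remove_nth i vs))) (G z) (D (vs ! i)) +
      (\<Sum>k<j. (-1) ^ (i + k) * \<omega> (G z) (B (vs ! i) (remove_nth i vs ! k) # map D (remove_nth k (remove_nth i vs))))"
      unfolding 1[OF l] by (simp add: algebra_simps sum_distrib_left power_add)
  qed
  also have "(\<Sum>i<Suc j. \<Sum>k<j. (-1) ^ (i + k) *
      \<omega> (G z) (B (vs ! i) (remove_nth i vs ! k) # map D (remove_nth k (remove_nth i vs)))) = 0"
    by (rule sum_remove_two_symmetric[OF _ len, of "\<lambda>x y zs. \<omega> (G z) (B x y # map D zs)"])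
      (simp add: Bsym)
  finally show ?thesis
    by (simp add: ext_d_remove_nth pullback_def len D_def map_remove_nth)
qed


subsection \<open>Contraction and Lie derivative\<close>

definition contr :: "(complex^'n \<Rightarrow> complex^'n) \<Rightarrow> 'n form \<Rightarrow> 'n form" where
  "contr X \<omega> z us = \<omega> z (X z # us)"

text \<open>The Lie derivative evaluated on constant vector fields: the bracket of \<open>X\<close>
  with a constant field is minus the derivative of \<open>X\<close> in that direction, hence the
  plus sign of the slot terms.\<close>

definition lie :: "(complex^'n \<Rightarrow> complex^'n) \<Rightarrow> 'n form \<Rightarrow> 'n form" where
  "lie X \<omega> z vs = fd (\<lambda>w. \<omega> w vs) z (X z) +
    (\<Sum>i<length vs. \<omega> z (vs[i := frechet_derivative X (at z) (vs ! i)]))"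

lemma cholo_map_id: "open S \<Longrightarrow> cholo_map_on (\<lambda>z. z) S"
  unfolding cholo_map_on_def by auto

lemma cholo_map_const: "open S \<Longrightarrow> cholo_map_on (\<lambda>z. u) S"
  unfolding cholo_map_on_def by auto

lemma holo_form_contr:
  assumes \<omega>: "holo_form (Suc j) S \<omega>" and X: "cholo_map_on X S"
  shows "holo_form j S (contr X \<omega>)"
    and "z \<in> S \<Longrightarrow> length us = j \<Longrightarrow>
      fd (\<lambda>z. contr X \<omega> z us) z v = fd (\<lambda>w. \<omega> w (X z # us)) z v + \<omega> z (frechet_derivative X (at z) v # us)"
proof -
  note S = holo_form_open[OF \<omega>]
  have Ys: "\<And>Y. Y \<in> set (X # map (\<lambda>u z. u) us) \<Longrightarrow> cholo_map_on Y S" for us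
    using X cholo_map_const[OF S] by auto
  note ap = cholo_form_apply[OF \<omega> cholo_map_id[OF S] _ S, where us = "[]"]
  show "holo_form j S (contr X \<omega>)"
    unfolding holo_form_def
  proof (intro conjI ballI allI impI S)
    show "alternating j (contr X \<omega> z)" if "z \<in> S" for z
      unfolding contr_def by (rule alternating_Cons[OF holo_form_alternating[OF \<omega> that]])
    show "cholo_on (\<lambda>z. contr X \<omega> z vs) S" if "length vs = j" for vs
      using ap(1)[where Ys = "X # map (\<lambda>u z. u) vs"] Ys that by (simp add: contr_def o_def)
  qed
  assume z: "z \<in> S" and us: "length us = j"
  \<comment> \<open>Only the front entry varies with the point; the derivatives of the constant
    entries are zero vectors and drop out of the product rule.\<close>
  have "\<omega> z (X z # us[k := 0]) = 0" if "k < j" for k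
    using alternating_0_append[OF holo_form_alternating[OF \<omega> z], of "X z # take k us" "drop (Suc k) us"] that us
    by (simp add: upd_conv_take_nth_drop min_def)
  then show "fd (\<lambda>z. contr X \<omega> z us) z v = fd (\<lambda>w. \<omega> w (X z # us)) z v + \<omega> z (frechet_derivative X (at z) v # us)"
    using ap(2)[where Ys = "X # map (\<lambda>u z. u) us" and z = z and v = v] Ys z us
    by (simp add: contr_def o_def sum.lessThan_Suc_shift frechet_derivative_ident del: sum.lessThan_Suc)
qed

lemma contr_ext_d:
  "contr X (ext_d \<omega>) z vs = fd (\<lambda>w. \<omega> w vs) z (X z) -
    (\<Sum>i<length vs. (-1) ^ i * fd (\<lambda>w. \<omega> w (X z # remove_nth i vs)) z (vs ! i))"
  by (simp add: contr_def ext_d_remove_nth sum.lessThan_Suc_shift sum_negf del: sum.lessThan_Suc)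

text \<open>Differentiating the contracted form through its argument \<open>X\<close> gives exactly
  the slot terms of \<open>lie\<close>. What remains cancels against the sum in
  \<open>contr_ext_d\<close>, except for the derivative of the form along \<open>X\<close>.\<close>

lemma cartan_formula:
  assumes \<omega>: "holo_form (Suc j) S \<omega>" and X: "cholo_map_on X S" and z: "z \<in> S" and len: "length vs = Suc j"
  shows "ext_d (contr X \<omega>) z vs + contr X (ext_d \<omega>) z vs = lie X \<omega> z vs"
proof -
  have "ext_d (contr X \<omega>) z vs = (\<Sum>i<Suc j. (-1) ^ i * fd (\<lambda>w. \<omega> w (X z # remove_nth i vs)) z (vs ! i) +
      \<omega> z (vs[i := frechet_derivative X (at z) (vs ! i)]))"
    unfolding ext_d_remove_nth len
  proof (rule sum.cong[OF refl])
    fix i assume "i \<in> {..<Suc j}"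
    then have i: "i < Suc j" "length (remove_nth i vs) = j" using len by auto
    show "(-1) ^ i * fd (\<lambda>z'. contr X \<omega> z' (remove_nth i vs)) z (vs ! i) =
      (-1) ^ i * fd (\<lambda>w. \<omega> w (X z # remove_nth i vs)) z (vs ! i) +
      \<omega> z (vs[i := frechet_derivative X (at z) (vs ! i)])"
      unfolding holo_form_contr(2)[OF \<omega> X z i(2)]
        alternating_update_front[OF holo_form_alternating[OF \<omega> z] len i(1)]
      by (simp add: algebra_simps)
  qed
  then show ?thesis unfolding contr_ext_d lie_def len by (simp add: sum.distrib)
qed

text \<open>Contraction is an antiderivation: the slot of \<open>x\<close> itself contributes
  \<open>l x * m vs\<close>, and every other slot occurs in both sums with opposite signs.\<close>

lemma contr_wedge1:
  assumes "length vs = Suc j"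
  shows "wedge1 l (\<lambda>us. m (x # us)) vs + wedge1 l m (x # vs) = l x * m vs"
  unfolding wedge1_def by (simp add: sum.lessThan_Suc_shift sum_negf del: sum.lessThan_Suc)


section \<open>Averaging over a weighted circle action\<close>

text \<open>The Euler flow at time \<open>\<i> * t\<close>. Complex \<open>t\<close> is allowed so
  that a form along an orbit is holomorphic in the time; for real \<open>t\<close> the map is an
  isometry.\<close>

definition rot :: "('n::finite \<Rightarrow> real) \<Rightarrow> complex \<Rightarrow> complex^'n \<Rightarrow> complex^'n" where
  "rot w t z = (\<chi> i. exp (\<i> * of_real (w i) * t) * z $ i)"

definition euler :: "('n::finite \<Rightarrow> real) \<Rightarrow> complex^'n \<Rightarrow> complex^'n" where
  "euler w z = (\<chi> i. of_real (w i) * z $ i)"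

lemma rot_nth [simp]: "rot w t z $ i = exp (\<i> * of_real (w i) * t) * z $ i"
  by (simp add: rot_def)

lemma euler_nth [simp]: "euler w z $ i = of_real (w i) * z $ i"
  by (simp add: euler_def)

lemma euler_rot: "euler w (rot w t z) = rot w t (euler w z)"
  by (simp add: vec_eq_iff algebra_simps)

lemma rot_0 [simp]: "rot w 0 z = z"
  by (simp add: vec_eq_iff)

lemma norm_rot [simp]: "norm (rot w (of_real t) z) = norm z"
  by (simp add: norm_vec_def norm_mult)

lemma cholo_map_rot: "open S \<Longrightarrow> cholo_map_on (rot w t) S"
  and cholo_map_euler: "open S \<Longrightarrow> cholo_map_on (euler w) S"
  unfolding cholo_map_on_def by auto

lemma frechet_derivative_rot [simp]: "frechet_derivative (rot w t) (at z) = rot w t"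
proof (rule frechet_derivative_at[symmetric], rule has_derivative_vec_lambda_iff)
  show "((\<lambda>z. rot w t z $ i) has_derivative (\<lambda>v. rot w t v $ i)) (at z)" for i
    unfolding rot_nth by (intro has_derivative_mult_right has_derivative_nth)
qed

lemma frechet_derivative_euler [simp]: "frechet_derivative (euler w) (at z) = euler w"
proof (rule frechet_derivative_at[symmetric], rule has_derivative_vec_lambda_iff)
  show "((\<lambda>z. euler w z $ i) has_derivative (\<lambda>v. euler w v $ i)) (at z)" for i
    unfolding euler_nth by (intro has_derivative_mult_right has_derivative_nth)
qed

lemma continuous_on_rot [continuous_intros]:
  "continuous_on Q t \<Longrightarrow> continuous_on Q g \<Longrightarrow> continuous_on Q (\<lambda>q. rot w (t q) (g q))"
  unfolding rot_def by (intro continuous_intros)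

definition rot_invariant :: "('n::finite \<Rightarrow> real) \<Rightarrow> (complex^'n) set \<Rightarrow> bool" where
  "rot_invariant w S \<longleftrightarrow> (\<forall>z\<in>S. \<forall>t::real. rot w (of_real t) z \<in> S)"

lemma rot_invariantD: "rot_invariant w S \<Longrightarrow> z \<in> S \<Longrightarrow> rot w (of_real t) z \<in> S"
  by (simp add: rot_invariant_def)

text \<open>The time parameter of the flow is embedded as a coordinate of \<open>\<complex>\<^sup>n\<close>, so that
  the chain rule for forms evaluated on vector fields applies to it.\<close>

lemma has_field_derivative_rot_form:
  fixes \<omega> :: "'n::finite form"
  assumes \<omega>: "holo_form j S \<omega>" and len: "length vs = j" and inS: "rot w t z \<in> S"
  shows "((\<lambda>t. \<omega> (rot w t z) (map (rot w t) vs)) has_field_derivative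
    \<i> * lie (euler w) \<omega> (rot w t z) (map (rot w t) vs)) (at t)"
proof -
  \<comment> \<open>Index types are nonempty, so some coordinate is available to carry the
    time.\<close>
  obtain i0 :: 'n where True by blast
  define G where "G = (\<lambda>u (y :: complex^'n). rot w (y $ i0) u)"
  define V where "V = (G z) -` S"
  define y0 where "y0 = t *s (axis i0 1 :: complex^'n)"
  have G: "cholo_map_on (G u) UNIV" for u
    unfolding cholo_map_on_def G_def rot_nth by (intro allI cholo_on_mult cholo_on_const cholo_on_exp cholo_on_nth) auto
  have y0: "y0 $ i0 = t" by (simp add: y0_def)
  have DG: "frechet_derivative (G u) (at y0) (axis i0 1) = \<i> *s euler w (rot w t u)" for u
  proof -
    have "fd (\<lambda>y. exp (\<i> * of_real (w i) * y $ i0) * u $ i) y0 (axis i0 1) =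
        \<i> * (of_real (w i) * (exp (\<i> * of_real (w i) * t) * u $ i))" for i
    proof -
      have "((\<lambda>s. exp (\<i> * of_real (w i) * s) * u $ i) has_field_derivative
          \<i> * (of_real (w i) * (exp (\<i> * of_real (w i) * t) * u $ i))) (at (y0 $ i0))"
        by (auto intro!: derivative_eq_intros simp: y0 algebra_simps)
      from fd_outer[OF cholo_on_nth[OF open_UNIV] UNIV_I this, of "axis i0 1"]
      show ?thesis by (simp add: fd_nth)
    qed
    then show ?thesis
      by (simp add: vec_eq_iff cholo_map_fd[OF G]) (simp add: G_def)
  qed
  have V: "open V"
    unfolding V_def by (rule open_vimage[OF holo_form_open[OF \<omega>]]) (use cholo_map_continuous[OF G] in simp)
  have GV: "cholo_map_on (G u) V" for u by (rule cholo_map_subset[OF G V]) simp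
  have GS: "y \<in> V \<Longrightarrow> G z y \<in> S" for y by (simp add: V_def)
  have y0V: "y0 \<in> V" using inS y0 by (simp add: V_def G_def)
  note ap = cholo_form_apply[OF \<omega> GV GS V, where us = "[]" and Ys = "map G vs"]
  have Ys: "\<And>Y. Y \<in> set (map G vs) \<Longrightarrow> cholo_map_on Y V" using GV by auto
  have c: "cholo_on (\<lambda>y. \<omega> (G z y) (map (\<lambda>u. G u y) vs)) V"
    using ap(1) Ys len by (simp add: o_def)
  have d: "fd (\<lambda>y. \<omega> (G z y) (map (\<lambda>u. G u y) vs)) y0 (axis i0 1) =
    fd (\<lambda>x. \<omega> x (map (\<lambda>u. G u y0) vs)) (G z y0) (\<i> *s euler w (rot w t z)) +
    (\<Sum>k<j. \<omega> (G z y0) ((map (\<lambda>u. G u y0) vs)[k := \<i> *s euler w (rot w t (vs ! k))]))"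
    using ap(2)[where z = y0 and v = "axis i0 1"] Ys len y0V by (simp add: o_def DG)
  have Gy0: "G u y0 = rot w t u" for u by (simp add: G_def y0)
  have s: "\<omega> (rot w t z) (us[k := \<i> *s x]) = \<i> * \<omega> (rot w t z) (us[k := x])" if "length us = j" "k < j" for us k x
    using alternating_linear[OF holo_form_alternating[OF \<omega> inS] that, of \<i> x 0 0] by simp
  have "fd (\<lambda>y. \<omega> (G z y) (map (\<lambda>u. G u y) vs)) y0 (axis i0 1) = \<i> * lie (euler w) \<omega> (rot w t z) (map (rot w t) vs)"
  proof -
    have "fd (\<lambda>x. \<omega> x (map (rot w t) vs)) (rot w t z) (\<i> *s euler w (rot w t z)) =
        \<i> * fd (\<lambda>x. \<omega> x (map (rot w t) vs)) (rot w t z) (euler w (rot w t z))"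
      by (rule cholo_on_fd_scale[OF holo_form_cholo[OF \<omega>] inS]) (simp add: len)
    then show ?thesis
      unfolding d Gy0 lie_def by (simp add: len s algebra_simps sum_distrib_left)
  qed
  moreover have "((\<lambda>t. \<omega> (G z (0 + t *s axis i0 1)) (map (\<lambda>u. G u (0 + t *s axis i0 1)) vs)) has_field_derivative
      fd (\<lambda>y. \<omega> (G z y) (map (\<lambda>u. G u y) vs)) (0 + t *s axis i0 1) (axis i0 1)) (at t)"
    by (rule has_field_derivative_along_line[OF c]) (use y0V in \<open>simp add: y0_def\<close>)
  ultimately show ?thesis by (simp add: y0_def[symmetric]) (simp add: G_def)
qed

text \<open>Origin of the weight: let s = h e be a generator, with e horizontal, whose connection
  form takes the value \<open>a\<close> on the Euler field. Then h (\<open>rot w t z\<close>) = exp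
  (i a t) h (z), so the exponential is what the generator leaves behind when a twisted form is
  pulled back along the flow.\<close>

definition avg :: "('n::finite \<Rightarrow> real) \<Rightarrow> real \<Rightarrow> complex \<Rightarrow> 'n form \<Rightarrow> 'n form" where
  "avg w T a \<omega> z vs = integral {0..T} (\<lambda>t. exp (\<i> * a * of_real t) * pullback (rot w (of_real t)) \<omega> z vs)"

lemma avg_cong:
  assumes "rot_invariant w S" "z \<in> S" "\<And>z us. z \<in> S \<Longrightarrow> length us = length vs \<Longrightarrow> \<omega> z us = \<omega>' z us"
  shows "avg w T a \<omega> z vs = avg w T a \<omega>' z vs"
  unfolding avg_def pullback_def
  by (intro integral_cong) (use assms rot_invariantD[OF assms(1,2)] in simp)

context
  fixes w :: "'n::finite \<Rightarrow> real" and T :: real and S :: "(complex^'n) set" and j :: nat and \<omega> :: "'n form"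
  assumes inv: "rot_invariant w S" and \<omega>: "holo_form j S \<omega>"
begin

lemma holo_form_pullback_rot: "holo_form j S (pullback (rot w (of_real t)) \<omega>)"
  by (rule holo_form_pullback[OF \<omega> cholo_map_rot rot_invariantD[OF inv]])
    (use holo_form_open[OF \<omega>] in auto)

lemma continuous_on_avg_integrand:
  assumes "length vs = j"
  shows "continuous_on (S \<times> {0..T}) (\<lambda>(z, t). exp (\<i> * a * of_real t) * pullback (rot w (of_real t)) \<omega> z vs)"
proof -
  have "continuous_on (S \<times> {0..T}) (\<lambda>q. \<omega> (rot w (of_real (snd q)) (fst q))
      ([] @ map (\<lambda>Y. Y q) (map (\<lambda>u q. rot w (of_real (snd q)) u) vs)))"
    by (rule continuous_on_form_apply[OF \<omega>])
      (use rot_invariantD[OF inv] assms in \<open>auto intro!: continuous_intros\<close>)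
  then show ?thesis
    unfolding case_prod_unfold pullback_def
    by (intro continuous_intros) (simp add: o_def)
qed

lemma cholo_on_avg_integrand:
  "length vs = j \<Longrightarrow> cholo_on (\<lambda>z. exp (\<i> * a * of_real t) * pullback (rot w (of_real t)) \<omega> z vs) S"
  by (intro cholo_on_cmult holo_form_cholo[OF holo_form_pullback_rot])

lemma integrable_avg:
  assumes "length vs = j" "z \<in> S"
  shows "(\<lambda>t. exp (\<i> * a * of_real t) * pullback (rot w (of_real t)) \<omega> z vs) integrable_on {0..T}"
proof -
  have "continuous_on {0..T} (\<lambda>t. case (z, t) of (z, t) \<Rightarrow>
      exp (\<i> * a * of_real t) * pullback (rot w (of_real t)) \<omega> z vs)"
    by (rule continuous_on_compose2[OF continuous_on_avg_integrand[OF assms(1)]])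
      (use assms in \<open>auto intro!: continuous_intros\<close>)
  then show ?thesis by (intro integrable_continuous_real) simp
qed

lemma integrable_avg_fd:
  assumes "length vs = j" "z \<in> S"
  shows "(\<lambda>t. fd (\<lambda>z. exp (\<i> * a * of_real t) * pullback (rot w (of_real t)) \<omega> z vs) z v) integrable_on {0..T}"
proof -
  have "continuous_on {0..T} (\<lambda>t. case (z, t) of (z, t) \<Rightarrow>
      fd (\<lambda>z. exp (\<i> * a * of_real t) * pullback (rot w (of_real t)) \<omega> z vs) z v)"
    by (rule continuous_on_compose2[OF continuous_on_fd_param[OF holo_form_open[OF \<omega>]
      cholo_on_avg_integrand[OF assms(1)] continuous_on_avg_integrand[OF assms(1)]]])
      (use assms in \<open>auto intro!: continuous_intros\<close>)
  then show ?thesis by (intro integrable_continuous_real) simp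
qed

lemma fd_avg:
  assumes "length vs = j" "z \<in> S"
  shows "fd (\<lambda>z. avg w T a \<omega> z vs) z v =
    integral {0..T} (\<lambda>t. fd (\<lambda>z. exp (\<i> * a * of_real t) * pullback (rot w (of_real t)) \<omega> z vs) z v)"
  unfolding avg_def
  by (rule fd_integral[OF holo_form_open[OF \<omega>] cholo_on_avg_integrand continuous_on_avg_integrand]) (use assms in auto)

lemma holo_form_avg: "holo_form j S (avg w T a \<omega>)"
  unfolding holo_form_def
proof (intro conjI ballI allI impI holo_form_open[OF \<omega>])
  fix z assume z: "z \<in> S"
  note alt = holo_form_alternating[OF holo_form_pullback_rot z]
  show "alternating j (avg w T a \<omega> z)"
    unfolding alternating_def
  proof (intro allI impI conjI)
    fix vs :: "(complex^'n) list" and i c b x y assume len: "length vs = j" "i < j"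
    have "avg w T a \<omega> z (vs[i := c *s x + b *s y]) = integral {0..T} (\<lambda>t.
        c * (exp (\<i> * a * of_real t) * pullback (rot w (of_real t)) \<omega> z (vs[i := x])) +
        b * (exp (\<i> * a * of_real t) * pullback (rot w (of_real t)) \<omega> z (vs[i := y])))"
      unfolding avg_def alternating_linear[OF alt len] by (simp add: algebra_simps)
    also have "\<dots> = c * avg w T a \<omega> z (vs[i := x]) + b * avg w T a \<omega> z (vs[i := y])"
      unfolding avg_def
      by (subst integral_add) (use len z integrable_avg in \<open>auto intro!: integrable_on_mult_right\<close>)
    finally show "avg w T a \<omega> z (vs[i := c *s x + b *s y]) =
      c * avg w T a \<omega> z (vs[i := x]) + b * avg w T a \<omega> z (vs[i := y])" .
  next
    fix vs :: "(complex^'n) list" and i k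
    assume len: "length vs = j" "i < j" "k < i" "vs ! i = vs ! k"
    show "avg w T a \<omega> z vs = 0"
      unfolding avg_def alternating_eq_0[OF alt len] by simp
  qed
next
  show "cholo_on (\<lambda>z. avg w T a \<omega> z vs) S" if "length vs = j" for vs
    unfolding avg_def
    by (rule cholo_on_integral[OF holo_form_open[OF \<omega>] cholo_on_avg_integrand continuous_on_avg_integrand])
      (use that in auto)
qed

text \<open>Derivatives pass under the integral, and there d commutes with every single
  pullback.\<close>

lemma ext_d_avg:
  assumes z: "z \<in> S" and len: "length vs = Suc j"
  shows "ext_d (avg w T a \<omega>) z vs = avg w T a (ext_d \<omega>) z vs"
proof -
  have l: "length (remove_nth i vs) = j" if "i < Suc j" for i using that len by simp
  have eq: "(\<Sum>i<Suc j. (-1) ^ i *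
      fd (\<lambda>z. exp (\<i> * a * of_real t) * pullback (rot w (of_real t)) \<omega> z (remove_nth i vs)) z (vs ! i)) =
      exp (\<i> * a * of_real t) * pullback (rot w (of_real t)) (ext_d \<omega>) z vs" for t
  proof -
    have "(\<Sum>i<Suc j. (-1) ^ i *
        fd (\<lambda>z. exp (\<i> * a * of_real t) * pullback (rot w (of_real t)) \<omega> z (remove_nth i vs)) z (vs ! i)) =
        exp (\<i> * a * of_real t) * ext_d (pullback (rot w (of_real t)) \<omega>) z vs"
      unfolding ext_d_remove_nth len sum_distrib_left
      by (intro sum.cong refl)
        (simp add: fd_cmult[OF holo_form_cholo[OF holo_form_pullback_rot] z] l algebra_simps)
    also have "ext_d (pullback (rot w (of_real t)) \<omega>) z vs = pullback (rot w (of_real t)) (ext_d \<omega>) z vs"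
      by (rule ext_d_pullback[OF \<omega> cholo_map_rot rot_invariantD[OF inv] _ z len])
        (use holo_form_open[OF \<omega>] in auto)
    finally show ?thesis .
  qed
  have "ext_d (avg w T a \<omega>) z vs = (\<Sum>i<Suc j. (-1) ^ i * integral {0..T} (\<lambda>t.
      fd (\<lambda>z. exp (\<i> * a * of_real t) * pullback (rot w (of_real t)) \<omega> z (remove_nth i vs)) z (vs ! i)))"
    unfolding ext_d_remove_nth len by (intro sum.cong refl) (simp add: fd_avg[OF l z])
  also have "\<dots> = integral {0..T} (\<lambda>t. \<Sum>i<Suc j. (-1) ^ i *
      fd (\<lambda>z. exp (\<i> * a * of_real t) * pullback (rot w (of_real t)) \<omega> z (remove_nth i vs)) z (vs ! i))"
    by (subst integral_sum)
      (auto intro!: integrable_on_mult_right integrable_avg_fd z simp: l)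
  finally show ?thesis unfolding eq avg_def .
qed

text \<open>By invariance \<theta> may be evaluated at the moved point on the moved vectors, so the
  product can be formed inside the integral.\<close>

lemma wedge1_avg:
  assumes z: "z \<in> S" and len: "length vs = Suc j"
    and \<theta>: "\<And>t v. \<theta> (rot w (of_real t) z) (rot w (of_real t) v) = \<theta> z v"
  shows "wedge1 (\<theta> z) (avg w T a \<omega> z) vs = avg w T a (\<lambda>z. wedge1 (\<theta> z) (\<omega> z)) z vs"
proof -
  have l: "length (remove_nth i vs) = j" if "i < Suc j" for i using that len by simp
  have "wedge1 (\<theta> z) (avg w T a \<omega> z) vs = (\<Sum>i<Suc j. integral {0..T} (\<lambda>t. (-1) ^ i * \<theta> z (vs ! i) *
      (exp (\<i> * a * of_real t) * pullback (rot w (of_real t)) \<omega> z (remove_nth i vs))))"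
    unfolding wedge1_def avg_def len integral_mult_right ..
  also have "\<dots> = integral {0..T} (\<lambda>t. \<Sum>i<Suc j. (-1) ^ i * \<theta> z (vs ! i) *
      (exp (\<i> * a * of_real t) * pullback (rot w (of_real t)) \<omega> z (remove_nth i vs)))"
    by (subst integral_sum) (auto intro!: integrable_on_mult_right integrable_avg z simp: l)
  also have "\<dots> = avg w T a (\<lambda>z. wedge1 (\<theta> z) (\<omega> z)) z vs"
    unfolding avg_def
  proof (rule integral_cong)
    fix t
    have "(\<Sum>i<Suc j. (-1) ^ i * \<theta> z (vs ! i) *
      (exp (\<i> * a * of_real t) * pullback (rot w (of_real t)) \<omega> z (remove_nth i vs))) =
      exp (\<i> * a * of_real t) * (\<Sum>i<Suc j. (-1) ^ i * \<theta> (rot w (of_real t) z) (map (rot w (of_real t)) vs ! i) *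
       \<omega> (rot w (of_real t) z) (remove_nth i (map (rot w (of_real t)) vs)))"
      unfolding sum_distrib_left
      by (intro sum.cong refl) (simp add: len \<theta> pullback_def map_remove_nth algebra_simps del: rot_nth)
    then show "(\<Sum>i<Suc j. (-1) ^ i * \<theta> z (vs ! i) *
      (exp (\<i> * a * of_real t) * pullback (rot w (of_real t)) \<omega> z (remove_nth i vs))) =
      exp (\<i> * a * of_real t) * pullback (rot w (of_real t)) (\<lambda>z. wedge1 (\<theta> z) (\<omega> z)) z vs"
      by (simp add: pullback_def wedge1_def len)
  qed
  finally show ?thesis .
qed

text \<open>The Lie derivative of the average is the integral of a total derivative along the closed
  orbit, so only the monodromy factor of \<open>exp (\<i> a t)\<close> survives.\<close>

lemma lie_avg:
  assumes z: "z \<in> S" and len: "length vs = j" and T: "0 \<le> T" "\<And>z. rot w (of_real T) z = z"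
  shows "\<i> * (lie (euler w) (avg w T a \<omega>) z vs + a * avg w T a \<omega> z vs) = (exp (\<i> * a * of_real T) - 1) * \<omega> z vs"
proof -
  define e where "e = (\<lambda>t::real. exp (\<i> * a * of_real t))"
  define R where "R = (\<lambda>t::real. rot w (of_real t))"
  have RS: "R t z \<in> S" for t unfolding R_def by (rule rot_invariantD[OF inv z])
  \<comment> \<open>The flow is linear and commutes with its own generator, so the derivative along
    the Euler field may be taken before or after the pullback.\<close>
  have fdR: "fd (\<lambda>z. pullback (R t) \<omega> z vs) z (euler w z) =
      fd (\<lambda>y. \<omega> y (map (R t) vs)) (R t z) (euler w (R t z))" for t
  proof -
    have "cholo_on (\<lambda>y. \<omega> y (map (R t) vs)) S" by (rule holo_form_cholo[OF \<omega>]) (simp add: len)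
    moreover have "cholo_map_on (R t) S"
      unfolding R_def by (rule cholo_map_rot[OF holo_form_open[OF \<omega>]])
    ultimately have "fd (\<lambda>z. \<omega> (R t z) (map (R t) vs)) z (euler w z) =
        fd (\<lambda>y. \<omega> y (map (R t) vs)) (R t z) (frechet_derivative (R t) (at z) (euler w z))"
      by (intro fd_compose[where F = "R t" and S = S and T = S] RS z)
    then
    show ?thesis by (simp add: pullback_def R_def euler_rot)
  qed
  \<comment> \<open>The Lie derivative commutes with pullback along the flow of its own field,
    written in the shape of the integrand.\<close>
  have lieR: "fd (\<lambda>z. e t * pullback (R t) \<omega> z vs) z (euler w z) +
      (\<Sum>i<j. e t * pullback (R t) \<omega> z (vs[i := euler w (vs ! i)])) = e t * lie (euler w) \<omega> (R t z) (map (R t) vs)" for t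
  proof -
    have "fd (\<lambda>z. e t * pullback (R t) \<omega> z vs) z (euler w z) = e t * fd (\<lambda>z. pullback (R t) \<omega> z vs) z (euler w z)"
      unfolding R_def by (rule fd_cmult[OF holo_form_cholo[OF holo_form_pullback_rot len] z])
    then show ?thesis
      unfolding lie_def fdR
      by (simp add: len pullback_def map_update euler_rot R_def algebra_simps sum_distrib_left)
  qed
  have il: "(\<lambda>t. e t * pullback (R t) \<omega> z us) integrable_on {0..T}" if "length us = j" for us
    unfolding e_def R_def by (rule integrable_avg[OF that z])
  have ifd: "(\<lambda>t. fd (\<lambda>z. e t * pullback (R t) \<omega> z vs) z (euler w z)) integrable_on {0..T}"
    unfolding e_def R_def by (rule integrable_avg_fd[OF len z])
  have "lie (euler w) (avg w T a \<omega>) z vs =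
      integral {0..T} (\<lambda>t. fd (\<lambda>z. e t * pullback (R t) \<omega> z vs) z (euler w z)) +
      (\<Sum>i<j. integral {0..T} (\<lambda>t. e t * pullback (R t) \<omega> z (vs[i := euler w (vs ! i)])))"
    unfolding lie_def fd_avg[OF len z] len by (simp add: avg_def e_def R_def)
  also have "\<dots> = integral {0..T} (\<lambda>t. fd (\<lambda>z. e t * pullback (R t) \<omega> z vs) z (euler w z)) +
      integral {0..T} (\<lambda>t. \<Sum>i<j. e t * pullback (R t) \<omega> z (vs[i := euler w (vs ! i)]))"
    by (subst integral_sum) (auto intro!: il simp: len)
  also have "\<dots> = integral {0..T} (\<lambda>t. e t * lie (euler w) \<omega> (R t z) (map (R t) vs))"
    unfolding lieR[symmetric]
    by (subst integral_add)
      (use ifd il in \<open>auto intro!: integrable_sum simp: len\<close>)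
  finally have 1: "lie (euler w) (avg w T a \<omega>) z vs = \<dots>" .
  have int: "(\<lambda>t. e t * lie (euler w) \<omega> (R t z) (map (R t) vs)) integrable_on {0..T}"
    unfolding lieR[symmetric]
    by (intro integrable_add integrable_sum)
      (use ifd il in \<open>auto simp: len\<close>)
  have 2: "\<i> * (lie (euler w) (avg w T a \<omega>) z vs + a * avg w T a \<omega> z vs) =
      integral {0..T} (\<lambda>t. \<i> * (e t * lie (euler w) \<omega> (R t z) (map (R t) vs) + a * (e t * pullback (R t) \<omega> z vs)))"
    unfolding 1 integral_mult_right
    by (subst integral_add[OF int]) (use il[OF len] in \<open>auto intro!: integrable_on_mult_right simp: avg_def e_def R_def\<close>)
  \<comment> \<open>Imaginary time is the origin of the factor \<open>\<i>\<close>: the integrand is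
    the derivative in \<open>t\<close> of the weighted pullback.\<close>
  have der: "((\<lambda>t. e t * pullback (R t) \<omega> z vs) has_vector_derivative
      \<i> * (e t * lie (euler w) \<omega> (R t z) (map (R t) vs) + a * (e t * pullback (R t) \<omega> z vs))) (at t within {0..T})" for t
  proof -
    have "((\<lambda>s. exp (\<i> * a * s) * \<omega> (rot w s z) (map (rot w s) vs)) has_field_derivative
      \<i> * (e t * lie (euler w) \<omega> (R t z) (map (R t) vs) + a * (e t * pullback (R t) \<omega> z vs))) (at (of_real t))"
      by (rule DERIV_cong[OF DERIV_mult[OF _ has_field_derivative_rot_form[OF \<omega> len]]])
        (auto intro!: derivative_eq_intros rot_invariantD[OF inv z] simp: e_def R_def pullback_def algebra_simps)
    then show ?thesis
      unfolding e_def R_def pullback_def frechet_derivative_rot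
      by (rule has_vector_derivative_real_field)
  qed
  have "((\<lambda>t. \<i> * (e t * lie (euler w) \<omega> (R t z) (map (R t) vs) + a * (e t * pullback (R t) \<omega> z vs))) has_integral
      e T * pullback (R T) \<omega> z vs - e 0 * pullback (R 0) \<omega> z vs) {0..T}"
    by (rule fundamental_theorem_of_calculus[OF T(1) der])
  then have "\<i> * (lie (euler w) (avg w T a \<omega>) z vs + a * avg w T a \<omega> z vs) =
      e T * pullback (R T) \<omega> z vs - e 0 * pullback (R 0) \<omega> z vs"
    unfolding 2 by (rule integral_unique)
  also have "\<dots> = (exp (\<i> * a * of_real T) - 1) * \<omega> z vs"
  proof -
    have "R T = (\<lambda>z. z)" "R 0 = (\<lambda>z. z)" using T(2) by (auto simp: R_def)
    then show ?thesis by (simp add: pullback_def e_def algebra_simps frechet_derivative_ident)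
  qed
  finally show ?thesis .
qed

end

text \<open>At time \<open>t\<close> the number \<open>P z ^ k\<close> equals
  \<open>P (rot w t z) ^ k\<close> times exp (- i k t), so it moves under the integral and lowers
  \<open>a\<close> by \<open>k\<close>. The integrand then contains the product of
  \<open>P ^ k\<close> and \<omega>, which can be holomorphic where \<omega> has a pole.\<close>

lemma avg_mult_power:
  assumes inv: "rot_invariant w S" and z: "z \<in> S"
    and P: "\<And>z t. z \<in> S \<Longrightarrow> P (rot w (of_real t) z) = exp (\<i> * of_real t) * P z"
  shows "P z ^ k * avg w T a \<omega> z vs = avg w T (a - of_nat k) (\<lambda>z vs. P z ^ k * \<omega> z vs) z vs"
  unfolding avg_def integral_mult_right[symmetric]
proof (rule integral_cong)
  fix t
  have e: "exp (\<i> * a * of_real t) = exp (\<i> * (a - of_nat k) * of_real t) * exp (\<i> * of_real t) ^ k"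
    by (simp add: exp_of_nat_mult[symmetric] exp_add[symmetric] algebra_simps)
  show "P z ^ k * (exp (\<i> * a * of_real t) * pullback (rot w (of_real t)) \<omega> z vs) =
    exp (\<i> * (a - of_nat k) * of_real t) * pullback (rot w (of_real t)) (\<lambda>z vs. P z ^ k * \<omega> z vs) z vs"
    unfolding pullback_def P[OF z] power_mult_distrib e by (simp only: mult_ac)
qed

section \<open>The contracting homotopy for d + \<theta>\<close>

lemma wedge1_scale: "wedge1 l (\<lambda>us. c * m us) vs = c * wedge1 l m vs"
  by (simp add: wedge1_def sum_distrib_left algebra_simps)

lemma ext_d_scale:
  assumes "holo_form j S \<omega>" "z \<in> S" "length vs = Suc j"
  shows "ext_d (\<lambda>z vs. c * \<omega> z vs) z vs = c * ext_d \<omega> z vs"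
  unfolding ext_d_remove_nth sum_distrib_left
  by (intro sum.cong refl) (use assms in \<open>simp add: fd_cmult[OF holo_form_cholo[OF assms(1)]]\<close>)

context
  fixes w :: "'n::finite \<Rightarrow> real" and T :: real and S :: "(complex^'n) set" and a :: complex
    and \<theta> :: "complex^'n \<Rightarrow> complex^'n \<Rightarrow> complex"
  assumes inv: "rot_invariant w S" and T: "0 \<le> T" "\<And>z. rot w (of_real T) z = z"
    and mono: "exp (\<i> * a * of_real T) \<noteq> 1"
    and \<theta>_inv: "\<And>z t v. z \<in> S \<Longrightarrow> \<theta> (rot w (of_real t) z) (rot w (of_real t) v) = \<theta> z v"
    and \<theta>_euler: "\<And>z. z \<in> S \<Longrightarrow> \<theta> z (euler w z) = a"
begin

text \<open>The factor is 1 / c for c = - i (exp (i a T) - 1), the constant left over in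
  \<open>lie_avg\<close>.\<close>

definition lie_inverse :: "'n form \<Rightarrow> 'n form" where
  "lie_inverse \<eta> = avg w T a (\<lambda>z vs. \<i> / (exp (\<i> * a * of_real T) - 1) * \<eta> z vs)"

context
  fixes \<eta> :: "'n form" and j :: nat
  assumes \<eta>: "holo_form j S \<eta>"
    and closed: "\<And>z vs. z \<in> S \<Longrightarrow> length vs = Suc j \<Longrightarrow> ext_d \<eta> z vs + wedge1 (\<theta> z) (\<eta> z) vs = 0"
begin

lemma holo_form_lie_inverse: "holo_form j S (lie_inverse \<eta>)"
  unfolding lie_inverse_def by (rule holo_form_avg[OF inv holo_form_scale[OF \<eta>]])

lemma lie_lie_inverse:
  "z \<in> S \<Longrightarrow> length vs = j \<Longrightarrow> lie (euler w) (lie_inverse \<eta>) z vs + a * lie_inverse \<eta> z vs = \<eta> z vs"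
  using lie_avg[OF inv holo_form_scale[OF \<eta>], of z vs T a "\<i> / (exp (\<i> * a * of_real T) - 1)"] T mono
  unfolding lie_inverse_def by simp

text \<open>Averaging commutes with d and with the product by the invariant \<theta>, so it keeps
  closed forms closed.\<close>

lemma closed_lie_inverse:
  assumes z: "z \<in> S" and len: "length vs = Suc j"
  shows "ext_d (lie_inverse \<eta>) z vs + wedge1 (\<theta> z) (lie_inverse \<eta> z) vs = 0"
proof -
  let ?c = "\<i> / (exp (\<i> * a * of_real T) - 1)"
  let ?\<eta> = "\<lambda>z vs. ?c * \<eta> z vs"
  have e: "ext_d ?\<eta> z us = - wedge1 (\<theta> z) (?\<eta> z) us" if "z \<in> S" "length us = Suc j" for z us
  proof -
    have "ext_d \<eta> z us = - wedge1 (\<theta> z) (\<eta> z) us"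
      using closed[OF that] by (simp add: eq_neg_iff_add_eq_0)
    then show ?thesis by (simp only: ext_d_scale[OF \<eta> that] wedge1_scale mult_minus_right)
  qed
  have "ext_d (lie_inverse \<eta>) z vs = avg w T a (ext_d ?\<eta>) z vs"
    unfolding lie_inverse_def by (rule ext_d_avg[OF inv holo_form_scale[OF \<eta>] z len])
  also have "\<dots> = avg w T a (\<lambda>z us. - wedge1 (\<theta> z) (?\<eta> z) us) z vs"
    by (rule avg_cong[OF inv z]) (rule e; simp add: len)
  also have "\<dots> = - avg w T a (\<lambda>z. wedge1 (\<theta> z) (?\<eta> z)) z vs"
    by (simp add: avg_def pullback_def)
  also have "avg w T a (\<lambda>z. wedge1 (\<theta> z) (?\<eta> z)) z vs = wedge1 (\<theta> z) (lie_inverse \<eta> z) vs"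
    unfolding lie_inverse_def
    by (rule wedge1_avg[where \<theta> = \<theta>, OF inv holo_form_scale[OF \<eta>] z len \<theta>_inv[OF z], symmetric])
  finally show ?thesis by simp
qed

text \<open>There is nothing to contract in degree 0. Closedness of the averaged function, evaluated
  on the Euler vector, already says that L + a kills it, and the image of the averaged function
  under L + a is \<eta>.\<close>

lemma homotopy_degree_0:
  assumes "j = 0" "z \<in> S"
  shows "\<eta> z [] = 0"
proof -
  have "lie (euler w) (lie_inverse \<eta>) z [] = ext_d (lie_inverse \<eta>) z [euler w z]"
    by (simp add: lie_def ext_d_remove_nth)
  moreover have "wedge1 (\<theta> z) (lie_inverse \<eta> z) [euler w z] = a * lie_inverse \<eta> z []"
    by (simp add: wedge1_def \<theta>_euler[OF assms(2)])
  ultimately show ?thesis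
    using lie_lie_inverse[of z "[]"] closed_lie_inverse[of z "[euler w z]"] assms by simp
qed

text \<open>Write B for \<open>lie_inverse \<eta>\<close> and \<iota> for contraction with the Euler
  field. Cartan's formula and \<open>contr_wedge1\<close> add up to (d + \<theta>) \<iota> B +
  \<iota> (d + \<theta>) B = (L + a) B = \<eta>, and B is closed. The second equation expresses d
  \<iota> B without \<theta>, which has poles in the application; the logarithmic condition is read
  off from it.\<close>

lemma homotopy_formula:
  assumes j: "j = Suc i" and z: "z \<in> S" and len: "length vs = j"
  shows "\<eta> z vs = ext_d (contr (euler w) (lie_inverse \<eta>)) z vs + wedge1 (\<theta> z) (contr (euler w) (lie_inverse \<eta>) z) vs"
    and "ext_d (contr (euler w) (lie_inverse \<eta>)) z vs =
      \<eta> z vs - a * lie_inverse \<eta> z vs - contr (euler w) (ext_d (lie_inverse \<eta>)) z vs"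
proof -
  let ?B = "lie_inverse \<eta>"
  have S: "open S" using holo_form_open[OF \<eta>] .
  have c: "ext_d (contr (euler w) ?B) z vs + contr (euler w) (ext_d ?B) z vs = lie (euler w) ?B z vs"
    by (rule cartan_formula[OF _ cholo_map_euler[OF S] z]) (use holo_form_lie_inverse j len in auto)
  have wd: "wedge1 (\<theta> z) (contr (euler w) ?B z) vs + wedge1 (\<theta> z) (?B z) (euler w z # vs) = a * ?B z vs"
    using contr_wedge1[of vs i "\<theta> z" "?B z" "euler w z"] len j
    by (simp add: contr_def[abs_def] \<theta>_euler[OF z])
  have 0: "contr (euler w) (ext_d ?B) z vs + wedge1 (\<theta> z) (?B z) (euler w z # vs) = 0"
    using closed_lie_inverse[OF z, of "euler w z # vs"] len by (simp add: contr_def)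
  have e: "\<eta> z vs = ext_d (contr (euler w) ?B) z vs + contr (euler w) (ext_d ?B) z vs + a * ?B z vs"
    unfolding c by (rule lie_lie_inverse[OF z len, symmetric])
  have sum: "x + y + m = x + u" if "u + v = m" "y + v = 0" for x y u v m :: complex
  proof -
    have "y = - v" using that(2) by (simp add: eq_neg_iff_add_eq_0)
    then show ?thesis using that(1) by auto
  qed
  show "\<eta> z vs = ext_d (contr (euler w) ?B) z vs + wedge1 (\<theta> z) (contr (euler w) ?B z) vs"
    unfolding e by (rule sum[OF wd 0])
  show "ext_d (contr (euler w) ?B) z vs = \<eta> z vs - a * ?B z vs - contr (euler w) (ext_d ?B) z vs"
    unfolding e by simp
qed

end

text \<open>\<eta> lives off the divisor, on \<open>S\<close>, whereas \<open>N\<close> is the full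
  invariant set. The extension of P ^ k times the average is the average of the given extension of P
  ^ k times \<eta>, with \<open>a\<close> lowered by \<open>k\<close>; hence the pole order does not
  grow.\<close>

lemma lie_inverse_extends:
  assumes \<eta>: "holo_form j S \<eta>" and N: "rot_invariant w N" "S \<subseteq> N" and \<omega>: "holo_form j N \<omega>"
    and P: "\<And>z t. z \<in> S \<Longrightarrow> P (rot w (of_real t) z) = exp (\<i> * of_real t) * P z"
    and ext: "\<And>z vs. z \<in> S \<Longrightarrow> length vs = j \<Longrightarrow> P z ^ k * \<eta> z vs = \<omega> z vs"
  shows "\<exists>\<omega>'. holo_form j N \<omega>' \<and>
    (\<forall>z\<in>S. \<forall>vs. length vs = j \<longrightarrow> P z ^ k * lie_inverse \<eta> z vs = \<omega>' z vs)"
proof (intro exI conjI ballI allI impI)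
  let ?c = "\<i> / (exp (\<i> * a * of_real T) - 1)"
  show "holo_form j N (avg w T (a - of_nat k) (\<lambda>z vs. ?c * \<omega> z vs))"
    by (rule holo_form_avg[OF N(1) holo_form_scale[OF \<omega>]])
  fix z vs assume z: "z \<in> S" and len: "length (vs :: (complex^'n) list) = j"
  have "P z ^ k * lie_inverse \<eta> z vs = avg w T (a - of_nat k) (\<lambda>z vs. P z ^ k * (?c * \<eta> z vs)) z vs"
    unfolding lie_inverse_def by (rule avg_mult_power[OF inv z P])
  also have "\<dots> = avg w T (a - of_nat k) (\<lambda>z vs. ?c * \<omega> z vs) z vs"
    by (rule avg_cong[OF inv z]) (simp add: len ext[symmetric])
  finally show "P z ^ k * lie_inverse \<eta> z vs = avg w T (a - of_nat k) (\<lambda>z vs. ?c * \<omega> z vs) z vs" .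
qed

text \<open>The same mechanism with exponent 1, applied to the derivative, since averaging commutes
  with d.\<close>

lemma lie_inverse_ext_d_extends:
  assumes \<eta>: "holo_form j S \<eta>" and N: "rot_invariant w N" "S \<subseteq> N" and \<omega>: "holo_form (Suc j) N \<omega>"
    and P: "\<And>z t. z \<in> S \<Longrightarrow> P (rot w (of_real t) z) = exp (\<i> * of_real t) * P z"
    and ext: "\<And>z vs. z \<in> S \<Longrightarrow> length vs = Suc j \<Longrightarrow> P z * ext_d \<eta> z vs = \<omega> z vs"
  shows "\<exists>\<omega>'. holo_form (Suc j) N \<omega>' \<and>
    (\<forall>z\<in>S. \<forall>vs. length vs = Suc j \<longrightarrow> P z * ext_d (lie_inverse \<eta>) z vs = \<omega>' z vs)"
proof (intro exI conjI ballI allI impI)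
  let ?c = "\<i> / (exp (\<i> * a * of_real T) - 1)"
  show "holo_form (Suc j) N (avg w T (a - 1) (\<lambda>z vs. ?c * \<omega> z vs))"
    by (rule holo_form_avg[OF N(1) holo_form_scale[OF \<omega>]])
  fix z vs assume z: "z \<in> S" and len: "length (vs :: (complex^'n) list) = Suc j"
  have "P z * ext_d (lie_inverse \<eta>) z vs = P z ^ 1 * avg w T a (ext_d (\<lambda>z vs. ?c * \<eta> z vs)) z vs"
    unfolding lie_inverse_def power_one_right
    by (subst ext_d_avg[OF inv holo_form_scale[OF \<eta>] z len]) (rule refl)
  also have "\<dots> = avg w T (a - of_nat 1) (\<lambda>z vs. P z ^ 1 * ext_d (\<lambda>z vs. ?c * \<eta> z vs) z vs) z vs"
    by (rule avg_mult_power[OF inv z P])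
  also have "\<dots> = avg w T (a - 1) (\<lambda>z vs. ?c * \<omega> z vs) z vs"
    unfolding of_nat_1 power_one_right
    by (rule avg_cong[OF inv z]) (simp add: len ext[symmetric] ext_d_scale[OF \<eta>] del: times_divide_eq_left)
  finally show "P z * ext_d (lie_inverse \<eta>) z vs = avg w T (a - 1) (\<lambda>z vs. ?c * \<omega> z vs) z vs" .
qed

end


section \<open>Charts\<close>

lemma topological_chartD:
  assumes "topological_chart (U, \<phi>)"
  shows chart_open_domain: "open U" and chart_open_range: "open (\<phi> ` U)"
    and chart_inv: "y \<in> U \<Longrightarrow> inv_into U \<phi> (\<phi> y) = y"
    and chart_inv': "z \<in> \<phi> ` U \<Longrightarrow> \<phi> (inv_into U \<phi> z) = z"
    and chart_inv_in: "z \<in> \<phi> ` U \<Longrightarrow> inv_into U \<phi> z \<in> U"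
    and chart_continuous: "continuous_on U \<phi>"
    and chart_inv_continuous: "continuous_on (\<phi> ` U) (inv_into U \<phi>)"
  using assms unfolding topological_chart_def homeomorphism_def
  by (auto simp: f_inv_into_f inv_into_into)

lemma chart_image_open:
  assumes "topological_chart (U, \<phi>)" "open V" "V \<subseteq> U"
  shows "open (\<phi> ` V)"
proof -
  have "homeomorphism U (\<phi> ` U) \<phi> (inv_into U \<phi>)" "open (\<phi> ` U)"
    using assms(1) by (auto simp: topological_chart_def)
  then have "openin (top_of_set (\<phi> ` U)) (\<phi> ` V)"
    using assms by (intro homeomorphism_imp_open_map) (auto intro: open_subset)
  then show ?thesis using \<open>open (\<phi> ` U)\<close> openin_open_trans by blast
qed

lemma chart_inv_image_open:
  assumes "topological_chart (U, \<phi>)" "open S" "S \<subseteq> \<phi> ` U"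
  shows "open (inv_into U \<phi> ` S)"
proof -
  have "inv_into U \<phi> ` S = U \<inter> \<phi> -` S"
    using chart_inv[OF assms(1)] chart_inv'[OF assms(1)] chart_inv_in[OF assms(1)] assms(3) by force
  then show ?thesis
    using continuous_open_preimage[OF chart_continuous[OF assms(1)] chart_open_domain[OF assms(1)] assms(2)]
    by simp
qed

lemma holo_chart_topological: "holo_chart A c \<Longrightarrow> topological_chart c"
  by (simp add: holo_chart_def)

lemma atlas_holo_chart: "complex_manifold A \<Longrightarrow> c \<in> A \<Longrightarrow> holo_chart A c"
  unfolding complex_manifold_def holo_chart_def by blast

lemma atlas_covers:
  assumes "complex_manifold A"
  obtains U \<phi> where "(U, \<phi>) \<in> A" "q \<in> U"
  using assms unfolding complex_manifold_def by (metis UN_E UNIV_I prod.collapse)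

lemma cholo_map_local:
  assumes "open S" "\<And>z. z \<in> S \<Longrightarrow> \<exists>T. z \<in> T \<and> cholo_map_on F T"
  shows "cholo_map_on F S"
  unfolding cholo_map_on_def
proof (intro allI cholo_on_local[OF assms(1)])
  fix i z assume "z \<in> S"
  then show "\<exists>T. z \<in> T \<and> cholo_on (\<lambda>z. F z $ i) T"
    using assms(2) unfolding cholo_map_on_def by blast
qed

text \<open>Runs from the coordinates of \<open>c'\<close> to those of \<open>c\<close>, so that
  pullback along \<open>transition c c'\<close> carries forms written in \<open>c\<close> to forms
  written in \<open>c'\<close>.\<close>

definition transition :: "('a, 'n::finite) chart \<Rightarrow> ('a, 'n) chart \<Rightarrow> complex^'n \<Rightarrow> complex^'n" where
  "transition c c' z = snd c (inv_into (fst c') (snd c') z)"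

text \<open>Charts of the maximal atlas are compared directly only with charts of \<open>A\<close>.
  Near each point the transition factors through one of these, and holomorphy is a local
  property.\<close>

lemma cholo_map_transition:
  assumes A: "complex_manifold A" and c: "holo_chart A (U, \<phi>)" and c': "holo_chart A (V, \<psi>)"
  shows "cholo_map_on (transition (V, \<psi>) (U, \<phi>)) (\<phi> ` (U \<inter> V))"
proof (rule cholo_map_local)
  note tc = holo_chart_topological[OF c] and tc' = holo_chart_topological[OF c']
  show "open (\<phi> ` (U \<inter> V))"
    by (rule chart_image_open[OF tc]) (use chart_open_domain[OF tc] chart_open_domain[OF tc'] in auto)
  fix z assume "z \<in> \<phi> ` (U \<inter> V)"
  then obtain y where y: "y \<in> U" "y \<in> V" "z = \<phi> y" by auto
  obtain W \<kappa> where W: "(W, \<kappa>) \<in> A" "y \<in> W" using atlas_covers[OF A] by blast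
  note tw = holo_chart_topological[OF atlas_holo_chart[OF A W(1)]]
  have 1: "cholo_map_on (\<lambda>z. \<kappa> (inv_into U \<phi> z)) (\<phi> ` (U \<inter> W))"
    using c W(1) unfolding holo_chart_def transition_holo_def o_def by fast
  have 2: "cholo_map_on (\<lambda>z. \<psi> (inv_into W \<kappa> z)) (\<kappa> ` (W \<inter> V))"
    using c' W(1) unfolding holo_chart_def transition_holo_def o_def by fast
  define T where "T = \<phi> ` (U \<inter> V \<inter> W)"
  have "open T" unfolding T_def
    by (rule chart_image_open[OF tc])
      (use chart_open_domain[OF tc] chart_open_domain[OF tc'] chart_open_domain[OF tw] in auto)
  then have "cholo_map_on (\<lambda>z. \<kappa> (inv_into U \<phi> z)) T"
    by (rule cholo_map_subset[OF 1]) (auto simp: T_def)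
  then have "cholo_map_on (\<lambda>z. \<psi> (inv_into W \<kappa> (\<kappa> (inv_into U \<phi> z)))) T"
    by (rule cholo_map_compose[OF 2]) (auto simp: T_def chart_inv[OF tc])
  then have "cholo_map_on (transition (V, \<psi>) (U, \<phi>)) T"
    by (rule cholo_map_cong[rotated]) (auto simp: T_def transition_def chart_inv[OF tc] chart_inv[OF tw])
  moreover have "z \<in> T" using y W by (auto simp: T_def)
  ultimately show "\<exists>T. z \<in> T \<and> cholo_map_on (transition (V, \<psi>) (U, \<phi>)) T" by blast
qed

section \<open>Holomorphic functions on the manifold\<close>

lemma mholo_on_open: "mholo_on A g W \<Longrightarrow> open W"
  by (simp add: mholo_on_def)

lemma mholo_on_atlas:
  "mholo_on A g W \<Longrightarrow> (U, \<phi>) \<in> A \<Longrightarrow> cholo_on (\<lambda>z. g (inv_into U \<phi> z)) (\<phi> ` (U \<inter> W))"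
  unfolding mholo_on_def o_def by blast

lemma mholo_onI:
  "open W \<Longrightarrow> (\<And>U \<phi>. (U, \<phi>) \<in> A \<Longrightarrow> cholo_on (\<lambda>z. g (inv_into U \<phi> z)) (\<phi> ` (U \<inter> W))) \<Longrightarrow> mholo_on A g W"
  unfolding mholo_on_def o_def by blast

lemma mholo_on_chart:
  assumes A: "complex_manifold A" and c: "holo_chart A (U, \<phi>)" and g: "mholo_on A g W"
  shows "cholo_on (\<lambda>z. g (inv_into U \<phi> z)) (\<phi> ` (U \<inter> W))"
proof (rule cholo_on_local)
  note tc = holo_chart_topological[OF c]
  show "open (\<phi> ` (U \<inter> W))"
    by (rule chart_image_open[OF tc]) (use chart_open_domain[OF tc] mholo_on_open[OF g] in auto)
  fix z assume "z \<in> \<phi> ` (U \<inter> W)"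
  then obtain y where y: "y \<in> U" "y \<in> W" "z = \<phi> y" by auto
  obtain V \<psi> where V: "(V, \<psi>) \<in> A" "y \<in> V" using atlas_covers[OF A] by blast
  note tv = holo_chart_topological[OF atlas_holo_chart[OF A V(1)]]
  define T where "T = \<phi> ` (U \<inter> V \<inter> W)"
  have "open T" unfolding T_def
    by (rule chart_image_open[OF tc])
      (use chart_open_domain[OF tc] mholo_on_open[OF g] chart_open_domain[OF tv] in auto)
  then have "cholo_map_on (transition (V, \<psi>) (U, \<phi>)) T"
    by (rule cholo_map_subset[OF cholo_map_transition[OF A c atlas_holo_chart[OF A V(1)]]]) (auto simp: T_def)
  then have "cholo_on (\<lambda>z. g (inv_into V \<psi> (transition (V, \<psi>) (U, \<phi>) z))) T"
    by (rule cholo_on_compose[OF mholo_on_atlas[OF g V(1)]])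
      (auto simp: T_def transition_def chart_inv[OF tc])
  then have "cholo_on (\<lambda>z. g (inv_into U \<phi> z)) T"
    by (rule cholo_on_cong[rotated]) (auto simp: T_def transition_def chart_inv[OF tc] chart_inv[OF tv])
  moreover have "z \<in> T" using y V by (auto simp: T_def)
  ultimately show "\<exists>T. z \<in> T \<and> cholo_on (\<lambda>z. g (inv_into U \<phi> z)) T" by blast
qed

lemma mholo_on_from_chart:
  assumes A: "complex_manifold A" and c: "holo_chart A (U, \<phi>)" and V: "open V" "V \<subseteq> U"
    and h: "cholo_on h (\<phi> ` V)"
  shows "mholo_on A (\<lambda>y. h (\<phi> y)) V"
proof (rule mholo_onI[OF V(1)])
  fix W \<psi> assume W: "(W, \<psi>) \<in> A"
  note tw = holo_chart_topological[OF atlas_holo_chart[OF A W]]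
  have "cholo_map_on (transition (U, \<phi>) (W, \<psi>)) (\<psi> ` (W \<inter> V))"
    by (rule cholo_map_subset[OF cholo_map_transition[OF A atlas_holo_chart[OF A W] c]])
      (use chart_image_open[OF tw] chart_open_domain[OF tw] V in auto)
  then have "cholo_on (\<lambda>z. h (transition (U, \<phi>) (W, \<psi>) z)) (\<psi> ` (W \<inter> V))"
    by (rule cholo_on_compose[OF h]) (auto simp: transition_def chart_inv[OF tw])
  then show "cholo_on (\<lambda>z. h (\<phi> (inv_into W \<psi> z))) (\<psi> ` (W \<inter> V))"
    by (simp add: transition_def)
qed

lemma mholo_on_subset:
  assumes A: "complex_manifold A" and g: "mholo_on A g W" and V: "open V" "V \<subseteq> W"
  shows "mholo_on A g V"
proof (rule mholo_onI[OF V(1)])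
  fix U \<phi> assume U: "(U, \<phi>) \<in> A"
  note tu = holo_chart_topological[OF atlas_holo_chart[OF A U]]
  show "cholo_on (\<lambda>z. g (inv_into U \<phi> z)) (\<phi> ` (U \<inter> V))"
    by (rule cholo_on_subset[OF mholo_on_atlas[OF g U]])
      (use chart_image_open[OF tu] chart_open_domain[OF tu] V in auto)
qed

lemma mholo_on_cong:
  assumes A: "complex_manifold A" and g: "mholo_on A g W" and eq: "\<And>y. y \<in> W \<Longrightarrow> g y = h y"
  shows "mholo_on A h W"
proof (rule mholo_onI[OF mholo_on_open[OF g]])
  fix U \<phi> assume U: "(U, \<phi>) \<in> A"
  note tu = holo_chart_topological[OF atlas_holo_chart[OF A U]]
  show "cholo_on (\<lambda>z. h (inv_into U \<phi> z)) (\<phi> ` (U \<inter> W))"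
    by (rule cholo_on_cong[OF _ mholo_on_atlas[OF g U]]) (auto simp: chart_inv[OF tu] eq)
qed

lemma mholo_on_mult: "mholo_on A g W \<Longrightarrow> mholo_on A h W \<Longrightarrow> mholo_on A (\<lambda>y. g y * h y) W"
  by (rule mholo_onI) (auto intro: mholo_on_open mholo_on_atlas)

lemma mholo_on_const:
  assumes A: "complex_manifold A" and W: "open W"
  shows "mholo_on A (\<lambda>y. a) W"
proof (rule mholo_onI[OF W])
  fix U \<phi> assume U: "(U, \<phi>) \<in> A"
  note tu = holo_chart_topological[OF atlas_holo_chart[OF A U]]
  show "cholo_on (\<lambda>z. a) (\<phi> ` (U \<inter> W))"
    by (rule cholo_on_const) (use chart_image_open[OF tu] chart_open_domain[OF tu] W in auto)
qed

lemma mholo_on_prod: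
  assumes A: "complex_manifold A" and W: "open W" and g: "\<And>i. i \<in> I \<Longrightarrow> mholo_on A (g i) W"
  shows "mholo_on A (\<lambda>y. \<Prod>i\<in>I. g i y) W"
  using g by (induction I rule: infinite_finite_induct) (auto intro: mholo_on_mult mholo_on_const[OF A W])

lemma mholo_on_continuous:
  assumes A: "complex_manifold A" and g: "mholo_on A g W"
  shows "continuous_on W g"
proof -
  have "continuous (at y within W) g" if y: "y \<in> W" for y
  proof -
    obtain U \<phi> where U: "(U, \<phi>) \<in> A" "y \<in> U" using atlas_covers[OF A] by blast
    note tu = holo_chart_topological[OF atlas_holo_chart[OF A U(1)]]
    have "continuous_on (U \<inter> W) (\<lambda>y. g (inv_into U \<phi> (\<phi> y)))"
      by (rule continuous_on_compose2[OF cholo_on_continuous[OF mholo_on_atlas[OF g U(1)]]])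
        (use chart_continuous[OF tu] in \<open>auto intro: continuous_on_subset\<close>)
    then have "continuous_on (U \<inter> W) g" by (rule continuous_on_eq) (auto simp: chart_inv[OF tu])
    moreover have "open (U \<inter> W)" using chart_open_domain[OF tu] mholo_on_open[OF g] by auto
    ultimately have "isCont g y" using y U by (auto simp: continuous_on_eq_continuous_at)
    then show ?thesis by (rule continuous_at_imp_continuous_at_within)
  qed
  then show ?thesis by (simp add: continuous_on_eq_continuous_within)
qed

section \<open>Reduced local equations and divisibility\<close>

lemma reduced_eq_subset:
  assumes A: "complex_manifold A" and f: "reduced_eq A D W f" and V: "open V" "V \<subseteq> W"
  shows "reduced_eq A D V f"
  unfolding reduced_eq_def
proof (intro conjI ballI allI impI)
  show "mholo_on A f V" using f V by (auto simp: reduced_eq_def intro: mholo_on_subset[OF A])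
  show "D \<inter> V = {y \<in> V. f y = 0}" using f V by (auto simp: reduced_eq_def)
  fix q g V0 assume q: "q \<in> V" and g: "q \<in> V0 \<and> mholo_on A g V0 \<and> (\<forall>y\<in>V0 \<inter> D. g y = 0)"
  obtain h V' where h: "q \<in> V'" "V' \<subseteq> V0 \<inter> W" "mholo_on A h V'" "\<forall>y\<in>V'. g y = h y * f y"
    using f g q V unfolding reduced_eq_def by blast
  have "open (V' \<inter> V)" using mholo_on_open[OF h(3)] V by auto
  then show "\<exists>h V'. q \<in> V' \<and> V' \<subseteq> V0 \<inter> V \<and> mholo_on A h V' \<and> (\<forall>y\<in>V'. g y = h y * f y)"
    using h q by (intro exI[of _ h] exI[of _ "V' \<inter> V"]) (auto intro: mholo_on_subset[OF A h(3)])
qed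

lemma reduced_eqD:
  assumes "reduced_eq A D W f"
  shows "mholo_on A f W" "open W" "\<And>y. y \<in> W \<Longrightarrow> f y = 0 \<longleftrightarrow> y \<in> D"
proof -
  show m: "mholo_on A f W" using assms by (simp add: reduced_eq_def)
  show "open W" by (rule mholo_on_open[OF m])
  have "D \<inter> W = {y \<in> W. f y = 0}" using assms by (simp add: reduced_eq_def)
  then show "\<And>y. y \<in> W \<Longrightarrow> f y = 0 \<longleftrightarrow> y \<in> D" by blast
qed

lemma reduced_eq_divides:
  assumes "reduced_eq A D W f" "q \<in> W" "q \<in> V" "mholo_on A g V" "\<And>y. y \<in> V \<Longrightarrow> y \<in> D \<Longrightarrow> g y = 0"
  obtains h V' where "q \<in> V'" "V' \<subseteq> V" "V' \<subseteq> W" "mholo_on A h V'" "\<And>y. y \<in> V' \<Longrightarrow> g y = h y * f y"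
proof -
  have "\<exists>h V'. q \<in> V' \<and> V' \<subseteq> V \<inter> W \<and> mholo_on A h V' \<and> (\<forall>y\<in>V'. g y = h y * f y)"
    using assms(1)[unfolded reduced_eq_def, THEN conjunct2, THEN conjunct2, rule_format, OF assms(2), of V g]
      assms(3-5) by blast
  then show ?thesis using that by blast
qed


section \<open>The connection in a chart\<close>

lemma function_sheaf_restrict:
  "function_sheaf T U F \<Longrightarrow> open V \<Longrightarrow> V \<subseteq> T \<Longrightarrow> s \<in> F V \<Longrightarrow> open W \<Longrightarrow> W \<subseteq> V \<Longrightarrow> s \<in> F W"
  unfolding function_sheaf_def by blast

lemma rank1_local_system_open: "rank1_local_system U L \<Longrightarrow> open U"
  and rank1_local_system_sheaf: "rank1_local_system U L \<Longrightarrow> function_sheaf U U L"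
  unfolding rank1_local_system_def by blast+

text \<open>The choice made inside \<open>nabla\<close>. It depends on the point alone and not on
  the chart, which is what makes the connection compatible with coordinate changes.\<close>

definition frame :: "'a::topological_space set \<Rightarrow> ('a set \<Rightarrow> ('a \<Rightarrow> complex) set) \<Rightarrow> 'a \<Rightarrow> 'a \<Rightarrow> complex" where
  "frame D L q = (SOME e. horizontal_frame_at (- D) L q e)"

lemma frame_neighbourhood:
  assumes L: "rank1_local_system (- D) L" and q: "q \<notin> D" and W: "open W" "q \<in> W"
  obtains B where "open B" "q \<in> B" "B \<subseteq> W - D" "frame D L q \<in> L B" "\<And>y. y \<in> B \<Longrightarrow> frame D L q y \<noteq> 0"
proof -
  have "\<exists>e. horizontal_frame_at (- D) L q e"
  proof -
    have "\<exists>W e. open W \<and> q \<in> W \<and> W \<subseteq> - D \<and> (\<forall>y\<in>W. e y \<noteq> 0) \<and> (\<forall>V'. open V' \<and> V' \<subseteq> W \<longrightarrow>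
        L V' = {s. \<exists>c. (\<forall>y\<in>V'. s y = c y * e y) \<and> (\<forall>y\<in>V'. \<forall>\<^sub>F y' in nhds y. c y' = c y)})"
      using L q by (simp add: rank1_local_system_def)
    then obtain V e where V: "open V" "q \<in> V" "V \<subseteq> - D" "\<forall>y\<in>V. e y \<noteq> 0"
      and LV: "\<forall>V'. open V' \<and> V' \<subseteq> V \<longrightarrow>
        L V' = {s. \<exists>c. (\<forall>y\<in>V'. s y = c y * e y) \<and> (\<forall>y\<in>V'. \<forall>\<^sub>F y' in nhds y. c y' = c y)}"
      by (elim exE conjE) (rule that)
    have "L V = {s. \<exists>c. (\<forall>y\<in>V. s y = c y * e y) \<and> (\<forall>y\<in>V. \<forall>\<^sub>F y' in nhds y. c y' = c y)}"
      using LV[rule_format, of V] V(1) by simp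
    then have "e \<in> L V" by (auto intro!: exI[of _ "\<lambda>y. 1"])
    then show ?thesis using V unfolding horizontal_frame_at_def by blast
  qed
  then have "horizontal_frame_at (- D) L q (frame D L q)" unfolding frame_def by (rule someI_ex)
  then obtain V where V: "open V" "V \<subseteq> - D" "q \<in> V" "frame D L q \<in> L V" "\<forall>y\<in>V. frame D L q y \<noteq> 0"
    unfolding horizontal_frame_at_def by blast
  show ?thesis
  proof
    show "frame D L q \<in> L (V \<inter> W)"
      using function_sheaf_restrict[OF rank1_local_system_sheaf[OF L] V(1,2,4)] V W by auto
  qed (use V W in auto)
qed

lemma nabla_frame:
  "nabla D L (U, \<phi>) \<omega> z vs = frame D L (inv_into U \<phi> z) (inv_into U \<phi> z) *
    ext_d (\<lambda>z' us. \<omega> z' us / frame D L (inv_into U \<phi> z) (inv_into U \<phi> z')) z vs"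
  by (simp add: nabla_def frame_def Let_def)

lemma nabla_cong:
  assumes tc: "topological_chart (U, \<phi>)" and V: "open V" "V \<subseteq> U" "y \<in> V"
    and eq: "\<And>y us. y \<in> V \<Longrightarrow> Suc (length us) = length vs \<Longrightarrow> \<omega> (\<phi> y) us = \<omega>' (\<phi> y) us"
  shows "nabla D L (U, \<phi>) \<omega> (\<phi> y) vs = nabla D L (U, \<phi>) \<omega>' (\<phi> y) vs"
proof -
  have "ext_d (\<lambda>z' us. \<omega> z' us / g z') (\<phi> y) vs = ext_d (\<lambda>z' us. \<omega>' z' us / g z') (\<phi> y) vs" for g
    by (rule ext_d_cong[OF chart_image_open[OF tc V(1,2)]]) (use V eq in auto)
  then show ?thesis by (simp add: nabla_frame)
qed

lemma twisted_holo_on_frame: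
  assumes A: "complex_manifold A" and L: "rank1_local_system (- D) L" and c: "holo_chart A (U, \<phi>)"
    and W: "open W" "W \<subseteq> U" and s: "twisted_holo_on A L s (W - D)" and y: "y \<in> W - D"
  obtains B where "open B" "y \<in> B" "B \<subseteq> W - D" "\<And>y'. y' \<in> B \<Longrightarrow> frame D L y y' \<noteq> 0"
    "cholo_on (\<lambda>z. s (inv_into U \<phi> z) / frame D L y (inv_into U \<phi> z)) (\<phi> ` B)"
proof -
  obtain B where B: "open B" "y \<in> B" "B \<subseteq> W - D" "frame D L y \<in> L B" "\<And>y'. y' \<in> B \<Longrightarrow> frame D L y y' \<noteq> 0"
    using frame_neighbourhood[OF L _ W(1)] y by blast
  have "mholo_on A (\<lambda>y'. s y' / frame D L y y') B"
    using s B unfolding twisted_holo_on_def by blast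
  from mholo_on_chart[OF A c this]
  have "cholo_on (\<lambda>z. s (inv_into U \<phi> z) / frame D L y (inv_into U \<phi> z)) (\<phi> ` (U \<inter> B))" .
  moreover have "U \<inter> B = B" using B W by auto
  ultimately show ?thesis using that[of B] B by simp
qed

definition conn :: "'a::t2_space set \<Rightarrow> ('a set \<Rightarrow> ('a \<Rightarrow> complex) set) \<Rightarrow> ('a, 'n::finite) chart \<Rightarrow>
    ('a \<Rightarrow> complex) \<Rightarrow> 'a \<Rightarrow> complex^'n \<Rightarrow> complex" where
  "conn D L c s y v = nabla D L c (\<lambda>z us. s (inv_into (fst c) (snd c) z)) (snd c y) [v]"

text \<open>Neither \<open>s\<close> nor \<omega> need be continuous, because the values of sections
  refer to arbitrary bases of the stalks. Only the quotient of \<open>s\<close> by a horizontal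
  frame is holomorphic, and the Leibniz rule for this quotient times \<eta> becomes the Leibniz rule
  of the connection.\<close>

lemma nabla_tensor:
  assumes A: "complex_manifold A" and L: "rank1_local_system (- D) L" and c: "holo_chart A (U, \<phi>)"
    and W: "open W" "W \<subseteq> U" and s: "twisted_holo_on A L s (W - D)"
    and \<eta>: "holo_form j (\<phi> ` (W - D)) \<eta>"
    and \<omega>: "\<And>y us. y \<in> W - D \<Longrightarrow> length us = j \<Longrightarrow> \<omega> (\<phi> y) us = s y * \<eta> (\<phi> y) us"
    and y: "y \<in> W - D" and len: "length vs = Suc j"
  shows "nabla D L (U, \<phi>) \<omega> (\<phi> y) vs =
    s y * ext_d \<eta> (\<phi> y) vs + wedge1 (conn D L (U, \<phi>) s y) (\<eta> (\<phi> y)) vs"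
proof -
  note tc = holo_chart_topological[OF c]
  let ?e = "frame D L y"
  obtain B where B: "open B" "y \<in> B" "B \<subseteq> W - D" "\<And>y'. y' \<in> B \<Longrightarrow> ?e y' \<noteq> 0"
    "cholo_on (\<lambda>z. s (inv_into U \<phi> z) / ?e (inv_into U \<phi> z)) (\<phi> ` B)"
    using twisted_holo_on_frame[OF A L c W s y] by metis
  define k where "k = (\<lambda>z. s (inv_into U \<phi> z) / ?e (inv_into U \<phi> z))"
  have BU: "B \<subseteq> U" using B W by auto
  have oB: "open (\<phi> ` B)" by (rule chart_image_open[OF tc B(1) BU])
  have inv: "inv_into U \<phi> (\<phi> y') = y'" if "y' \<in> B" for y' using chart_inv[OF tc] BU that by blast
  have k: "cholo_on k (\<phi> ` B)" using B(5) by (simp add: k_def)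
  have \<eta>B: "holo_form j (\<phi> ` B) \<eta>" by (rule holo_form_subset[OF \<eta> oB]) (use B in auto)
  have yB: "\<phi> y \<in> \<phi> ` B" using B by auto
  have ky: "?e y * k (\<phi> y) = s y" using B by (simp add: k_def inv)
  have "nabla D L (U, \<phi>) \<omega> (\<phi> y) vs = ?e y * ext_d (\<lambda>z us. \<omega> z us / ?e (inv_into U \<phi> z)) (\<phi> y) vs"
    unfolding nabla_frame inv[OF B(2)] ..
  also have "ext_d (\<lambda>z us. \<omega> z us / ?e (inv_into U \<phi> z)) (\<phi> y) vs = ext_d (\<lambda>z us. k z * \<eta> z us) (\<phi> y) vs"
    by (rule ext_d_cong[OF oB yB]) (use B \<omega> len in \<open>auto simp: k_def inv\<close>)
  also have "\<dots> = k (\<phi> y) * ext_d \<eta> (\<phi> y) vs + wedge1 (fd k (\<phi> y)) (\<eta> (\<phi> y)) vs"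
    by (rule ext_d_mult[OF k \<eta>B yB len])
  finally have "nabla D L (U, \<phi>) \<omega> (\<phi> y) vs =
      s y * ext_d \<eta> (\<phi> y) vs + ?e y * wedge1 (fd k (\<phi> y)) (\<eta> (\<phi> y)) vs"
    by (simp add: distrib_left mult.assoc[symmetric] ky)
  also have "?e y * wedge1 (fd k (\<phi> y)) (\<eta> (\<phi> y)) vs = wedge1 (conn D L (U, \<phi>) s y) (\<eta> (\<phi> y)) vs"
    unfolding wedge1_def sum_distrib_left conn_def nabla_frame fst_conv snd_conv inv[OF B(2)]
    by (intro sum.cong refl) (simp add: ext_d_remove_nth k_def mult_ac)
  finally show ?thesis .
qed

lemma conn_mult:
  assumes A: "complex_manifold A" and L: "rank1_local_system (- D) L" and c: "holo_chart A (U, \<phi>)"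
    and W: "open W" "W \<subseteq> U" and s: "twisted_holo_on A L s (W - D)"
    and h: "cholo_on h (\<phi> ` W)" and y: "y \<in> W - D"
  shows "conn D L (U, \<phi>) (\<lambda>y. h (\<phi> y) * s y) y v = h (\<phi> y) * conn D L (U, \<phi>) s y v + fd h (\<phi> y) v * s y"
proof -
  note tc = holo_chart_topological[OF c]
  let ?e = "frame D L y"
  obtain B where B: "open B" "y \<in> B" "B \<subseteq> W - D" "\<And>y'. y' \<in> B \<Longrightarrow> ?e y' \<noteq> 0"
    "cholo_on (\<lambda>z. s (inv_into U \<phi> z) / ?e (inv_into U \<phi> z)) (\<phi> ` B)"
    using twisted_holo_on_frame[OF A L c W s y] by metis
  define k where "k = (\<lambda>z. s (inv_into U \<phi> z) / ?e (inv_into U \<phi> z))"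
  have BU: "B \<subseteq> U" using B W by auto
  have oB: "open (\<phi> ` B)" by (rule chart_image_open[OF tc B(1) BU])
  have inv: "inv_into U \<phi> (\<phi> y') = y'" if "y' \<in> B" for y' using chart_inv[OF tc] BU that by blast
  have k: "cholo_on k (\<phi> ` B)" using B(5) by (simp add: k_def)
  have hB: "cholo_on h (\<phi> ` B)" by (rule cholo_on_subset[OF h oB]) (use B in auto)
  have yB: "\<phi> y \<in> \<phi> ` B" using B by auto
  have c: "conn D L (U, \<phi>) s' y v = ?e y * fd (\<lambda>z. s' (inv_into U \<phi> z) / ?e (inv_into U \<phi> z)) (\<phi> y) v" for s'
    unfolding conn_def nabla_frame fst_conv snd_conv inv[OF B(2)] by (simp add: ext_d_remove_nth)
  have "fd (\<lambda>z. (h (\<phi> (inv_into U \<phi> z)) * s (inv_into U \<phi> z)) / ?e (inv_into U \<phi> z)) (\<phi> y) v = fd (\<lambda>z. h z * k z) (\<phi> y) v"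
    by (subst fd_cong[OF oB yB, where h = "\<lambda>z. h z * k z"]) (auto simp: k_def inv)
  also have "\<dots> = h (\<phi> y) * fd k (\<phi> y) v + fd h (\<phi> y) v * k (\<phi> y)"
    by (rule fd_mult[OF hB k yB])
  finally show ?thesis
    unfolding c using B(4)[OF B(2)] by (simp add: k_def inv[OF B(2)] algebra_simps)
qed


section \<open>Change of charts\<close>

text \<open>Both charts use the same frame at \<open>y\<close>, so the claim is that d commutes with
  the pullback of the scalar form obtained from \<omega> on division by the frame.\<close>

lemma nabla_pullback:
  assumes A: "complex_manifold A" and L: "rank1_local_system (- D) L"
    and c: "holo_chart A (U, \<phi>)" and c': "holo_chart A (V, \<psi>)"
    and W: "open W" "W \<subseteq> U \<inter> V" and s: "twisted_holo_on A L s (W - D)"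
    and \<eta>: "holo_form j (\<phi> ` (W - D)) \<eta>"
    and \<omega>: "\<And>y us. y \<in> W - D \<Longrightarrow> length us = j \<Longrightarrow> \<omega> (\<phi> y) us = s y * \<eta> (\<phi> y) us"
    and y: "y \<in> W - D" and len: "length vs = Suc j"
  shows "nabla D L (V, \<psi>) (pullback (transition (U, \<phi>) (V, \<psi>)) \<omega>) (\<psi> y) vs =
    pullback (transition (U, \<phi>) (V, \<psi>)) (nabla D L (U, \<phi>) \<omega>) (\<psi> y) vs"
proof -
  note tc = holo_chart_topological[OF c] and tc' = holo_chart_topological[OF c']
  let ?e = "frame D L y" and ?G = "transition (U, \<phi>) (V, \<psi>)"
  have WU: "W \<subseteq> U" using W by auto
  obtain B where B: "open B" "y \<in> B" "B \<subseteq> W - D" "\<And>y'. y' \<in> B \<Longrightarrow> ?e y' \<noteq> 0"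
    "cholo_on (\<lambda>z. s (inv_into U \<phi> z) / ?e (inv_into U \<phi> z)) (\<phi> ` B)"
    using twisted_holo_on_frame[OF A L c W(1) WU s y] by metis
  have BU: "B \<subseteq> U" "B \<subseteq> V" using B W by auto
  have oB: "open (\<phi> ` B)" "open (\<psi> ` B)"
    using chart_image_open[OF tc B(1) BU(1)] chart_image_open[OF tc' B(1) BU(2)] .
  have inv: "inv_into U \<phi> (\<phi> y') = y'" "inv_into V \<psi> (\<psi> y') = y'" if "y' \<in> B" for y'
    using chart_inv[OF tc] chart_inv[OF tc'] BU that by blast+
  define \<omega>' where "\<omega>' = (\<lambda>z us. \<omega> z us / ?e (inv_into U \<phi> z))"
  have \<omega>': "holo_form j (\<phi> ` B) \<omega>'"
  proof (rule holo_form_cong)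
    have "holo_form j (\<phi> ` B) \<eta>" by (rule holo_form_subset[OF \<eta> oB(1)]) (use B in auto)
    then show "holo_form j (\<phi> ` B) (\<lambda>z us. s (inv_into U \<phi> z) / ?e (inv_into U \<phi> z) * \<eta> z us)"
      by (rule holo_form_mult[OF B(5)])
  qed (use B \<omega> in \<open>auto simp: \<omega>'_def inv\<close>)
  have G: "cholo_map_on ?G (\<psi> ` B)"
    by (rule cholo_map_subset[OF cholo_map_transition[OF A c' c] oB(2)]) (use BU in auto)
  have GB: "?G (\<psi> y') = \<phi> y'" if "y' \<in> B" for y' using that by (simp add: transition_def inv)
  have yB: "\<psi> y \<in> \<psi> ` B" using B by auto
  have "nabla D L (V, \<psi>) (pullback ?G \<omega>) (\<psi> y) vs =
      ?e y * ext_d (\<lambda>z us. pullback ?G \<omega> z us / ?e (inv_into V \<psi> z)) (\<psi> y) vs"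
    unfolding nabla_frame inv[OF B(2)] ..
  also have "ext_d (\<lambda>z us. pullback ?G \<omega> z us / ?e (inv_into V \<psi> z)) (\<psi> y) vs = ext_d (pullback ?G \<omega>') (\<psi> y) vs"
    by (rule ext_d_cong[OF oB(2) yB]) (auto simp: pullback_def \<omega>'_def GB inv)
  also have "\<dots> = pullback ?G (ext_d \<omega>') (\<psi> y) vs"
    by (rule ext_d_pullback[OF \<omega>' G _ oB(2) yB len]) (auto simp: GB)
  also have "?e y * \<dots> = pullback ?G (nabla D L (U, \<phi>) \<omega>) (\<psi> y) vs"
    unfolding pullback_def nabla_frame GB[OF B(2)] inv[OF B(2)] \<omega>'_def ..
  finally show ?thesis .
qed

lemma conn_transition:
  assumes A: "complex_manifold A" and L: "rank1_local_system (- D) L"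
    and c: "holo_chart A (U, \<phi>)" and c': "holo_chart A (V, \<psi>)"
    and W: "open W" "W \<subseteq> U \<inter> V" and s: "twisted_holo_on A L s (W - D)" and y: "y \<in> W - D" and D: "closed D"
  shows "conn D L (V, \<psi>) s y v = conn D L (U, \<phi>) s y (frechet_derivative (transition (U, \<phi>) (V, \<psi>)) (at (\<psi> y)) v)"
proof -
  note tc = holo_chart_topological[OF c] and tc' = holo_chart_topological[OF c']
  let ?G = "transition (U, \<phi>) (V, \<psi>)"
  have o: "open (W - D)" using W D by auto
  have inv: "inv_into U \<phi> (\<phi> y') = y'" "inv_into V \<psi> (\<psi> y') = y'" if "y' \<in> W" for y'
    using chart_inv[OF tc] chart_inv[OF tc'] W that by blast+
  \<comment> \<open>A section is a twisted form of degree 0 with coefficient 1, so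
    \<open>nabla_pullback\<close> covers it.\<close>
  have \<eta>: "holo_form 0 (\<phi> ` (W - D)) (\<lambda>z us. 1)"
    unfolding holo_form_def using chart_image_open[OF tc o] W by (auto simp: alternating_def)
  have "conn D L (V, \<psi>) s y v = nabla D L (V, \<psi>) (pullback ?G (\<lambda>z us. s (inv_into U \<phi> z))) (\<psi> y) [v]"
    unfolding conn_def fst_conv snd_conv
    by (rule nabla_cong[OF tc' o _ y]) (use W in \<open>auto simp: pullback_def transition_def inv\<close>)
  also have "\<dots> = pullback ?G (nabla D L (U, \<phi>) (\<lambda>z us. s (inv_into U \<phi> z))) (\<psi> y) [v]"
    by (rule nabla_pullback[OF A L c c' W s \<eta> _ y]) (auto simp: inv)
  also have "\<dots> = conn D L (U, \<phi>) s y (frechet_derivative ?G (at (\<psi> y)) v)"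
    using y by (simp add: pullback_def conn_def transition_def inv)
  finally show ?thesis .
qed

lemma transition_derivative_inverse:
  assumes A: "complex_manifold A" and c: "holo_chart A (U, \<phi>)" and c': "holo_chart A (V, \<psi>)"
    and y: "y \<in> U \<inter> V"
  shows "frechet_derivative (transition (U, \<phi>) (V, \<psi>)) (at (\<psi> y))
    (frechet_derivative (transition (V, \<psi>) (U, \<phi>)) (at (\<phi> y)) v) = v"
proof -
  note tc = holo_chart_topological[OF c] and tc' = holo_chart_topological[OF c']
  let ?G = "transition (U, \<phi>) (V, \<psi>)" and ?H = "transition (V, \<psi>) (U, \<phi>)"
  have H: "?H (\<phi> y) = \<psi> y" if "y \<in> U" for y using chart_inv[OF tc that] by (simp add: transition_def)
  have G: "?G (\<psi> y) = \<phi> y" if "y \<in> V" for y using chart_inv[OF tc' that] by (simp add: transition_def)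
  have o: "open (\<phi> ` (U \<inter> V))"
    by (rule chart_image_open[OF tc]) (use chart_open_domain[OF tc] chart_open_domain[OF tc'] in auto)
  have "(?H has_derivative frechet_derivative ?H (at (\<phi> y))) (at (\<phi> y))"
    by (rule cholo_map_has_derivative[OF cholo_map_transition[OF A c c']]) (use y in auto)
  moreover have "(?G has_derivative frechet_derivative ?G (at (\<psi> y))) (at (?H (\<phi> y)))"
    using cholo_map_has_derivative[OF cholo_map_transition[OF A c' c], of "\<psi> y"] y H by auto
  ultimately have "((\<lambda>z. ?G (?H z)) has_derivative
      (\<lambda>v. frechet_derivative ?G (at (\<psi> y)) (frechet_derivative ?H (at (\<phi> y)) v))) (at (\<phi> y))"
    by (rule has_derivative_compose)
  then have "((\<lambda>z. z) has_derivative
      (\<lambda>v. frechet_derivative ?G (at (\<psi> y)) (frechet_derivative ?H (at (\<phi> y)) v))) (at (\<phi> y))"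
    by (rule has_derivative_transform_within_open[OF _ o]) (use y in \<open>auto simp: H G\<close>)
  then have "(\<lambda>v. v) = (\<lambda>v. frechet_derivative ?G (at (\<psi> y)) (frechet_derivative ?H (at (\<phi> y)) v))"
    by (rule has_derivative_unique[OF has_derivative_ident])
  then show ?thesis by (rule fun_cong[symmetric])
qed

text \<open>Weighted coordinates come with one particular chart, while acyclicity is wanted in every
  chart at \<open>p\<close>. Pullbacks along the two transitions are inverse to each other on germs
  and commute with \<open>nabla\<close>, so cocycles and primitives can be carried across.
  \<open>\<Omega>\<close> is left abstract in order to serve both complexes.\<close>

lemma acyclic_complex_chart_change:
  fixes A :: "('a::t2_space, 'n::finite) chart set" and \<Omega> :: "('a, 'n) chart \<Rightarrow> nat \<Rightarrow> 'n form set"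
  assumes A: "complex_manifold A" and L: "rank1_local_system (- D) L"
    and LX_sheaf: "function_sheaf UNIV (- D) LX"
    and LX: "\<And>V s. open V \<Longrightarrow> p \<in> V \<Longrightarrow> s \<in> LX V \<Longrightarrow>
      \<exists>V'. open V' \<and> p \<in> V' \<and> V' \<subseteq> V \<and> twisted_holo_on A L s (V' - D)"
    and \<Omega>_pull: "\<And>c c' j \<eta>. holo_chart A c \<Longrightarrow> holo_chart A c' \<Longrightarrow> p \<in> fst c \<Longrightarrow> p \<in> fst c' \<Longrightarrow> \<eta> \<in> \<Omega> c j \<Longrightarrow>
      pullback (transition c c') \<eta> \<in> \<Omega> c' j"
    and \<Omega>_holo: "\<And>c j \<eta>. holo_chart A c \<Longrightarrow> p \<in> fst c \<Longrightarrow> \<eta> \<in> \<Omega> c j \<Longrightarrow>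
      \<exists>V. open V \<and> p \<in> V \<and> V \<subseteq> fst c \<and> holo_form j (snd c ` (V - D)) \<eta>"
    and c: "holo_chart A (U, \<phi>)" "p \<in> U" and c': "holo_chart A (V, \<psi>)" "p \<in> V"
    and acyc: "acyclic_complex (zero_germ D p (U, \<phi>)) (nabla D L (U, \<phi>)) (tensor_stalk D LX p (U, \<phi>) (\<Omega> (U, \<phi>)))"
  shows "acyclic_complex (zero_germ D p (V, \<psi>)) (nabla D L (V, \<psi>)) (tensor_stalk D LX p (V, \<psi>) (\<Omega> (V, \<psi>)))"
proof -
  have D: "closed D" using rank1_local_system_open[OF L] by (simp add: closed_def)
  note tc = holo_chart_topological[OF c(1)] and tc' = holo_chart_topological[OF c'(1)]
  \<comment> \<open>Stated for two arbitrary charts because cocycles travel in one direction and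
    primitives in the other.\<close>
  have stalk: "\<exists>W. open W \<and> p \<in> W \<and> W \<subseteq> U1 \<inter> U2 \<and>
      pullback (transition (U1, \<phi>1) (U2, \<phi>2)) \<omega> \<in> tensor_stalk D LX p (U2, \<phi>2) (\<Omega> (U2, \<phi>2)) j \<and>
      (\<forall>y\<in>W - D. \<forall>vs. length vs = Suc j \<longrightarrow>
        nabla D L (U2, \<phi>2) (pullback (transition (U1, \<phi>1) (U2, \<phi>2)) \<omega>) (\<phi>2 y) vs =
        pullback (transition (U1, \<phi>1) (U2, \<phi>2)) (nabla D L (U1, \<phi>1) \<omega>) (\<phi>2 y) vs)"
    if c1: "holo_chart A (U1, \<phi>1)" "p \<in> U1" and c2: "holo_chart A (U2, \<phi>2)" "p \<in> U2"
      and \<omega>: "\<omega> \<in> tensor_stalk D LX p (U1, \<phi>1) (\<Omega> (U1, \<phi>1)) j" for U1 \<phi>1 U2 \<phi>2 \<omega> j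
  proof -
    note t1 = holo_chart_topological[OF c1(1)] and t2 = holo_chart_topological[OF c2(1)]
    obtain \<eta> W s where W: "\<eta> \<in> \<Omega> (U1, \<phi>1) j" "open W" "p \<in> W" "W \<subseteq> U1" "s \<in> LX W"
      "\<And>y vs. y \<in> W - D \<Longrightarrow> length vs = j \<Longrightarrow> \<omega> (\<phi>1 y) vs = s y * \<eta> (\<phi>1 y) vs"
      using \<omega> unfolding tensor_stalk_def by auto
    obtain W1 where W1: "open W1" "p \<in> W1" "W1 \<subseteq> W" "twisted_holo_on A L s (W1 - D)"
      using LX[OF W(2,3,5)] by blast
    obtain W2 where W2: "open W2" "p \<in> W2" "W2 \<subseteq> U1" "holo_form j (\<phi>1 ` (W2 - D)) \<eta>"
      using \<Omega>_holo[OF c1(1) _ W(1)] c1 by auto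
    have oU: "open U1" "open U2" using chart_open_domain[OF t1] chart_open_domain[OF t2] .
    have tr: "transition (U1, \<phi>1) (U2, \<phi>2) (\<phi>2 y) = \<phi>1 y" if "y \<in> U2" for y
      using chart_inv[OF t2 that] by (simp add: transition_def)
    let ?W = "W1 \<inter> W2 \<inter> U2" and ?W' = "W \<inter> U2"
    have o: "open ?W" "?W \<subseteq> U1 \<inter> U2" using W1 W2 oU by auto
    have s: "twisted_holo_on A L s (?W - D)"
      using W1(4) unfolding twisted_holo_on_def by blast
    have "open (\<phi>1 ` (?W - D))" by (rule chart_image_open[OF t1]) (use o D in auto)
    from holo_form_subset[OF W2(4) this] have \<eta>: "holo_form j (\<phi>1 ` (?W - D)) \<eta>" by auto
    have \<omega>': "\<omega> (\<phi>1 y) vs = s y * \<eta> (\<phi>1 y) vs" if "y \<in> ?W - D" "length vs = j" for y vs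
      using W(6) that W1(3) by blast
    have "pullback (transition (U1, \<phi>1) (U2, \<phi>2)) \<omega> \<in> tensor_stalk D LX p (U2, \<phi>2) (\<Omega> (U2, \<phi>2)) j"
    proof -
      have "pullback (transition (U1, \<phi>1) (U2, \<phi>2)) \<eta> \<in> \<Omega> (U2, \<phi>2) j"
        by (rule \<Omega>_pull[OF c1(1) c2(1) _ _ W(1)]) (use c1 c2 in auto)
      moreover have "s \<in> LX ?W'"
        using function_sheaf_restrict[OF LX_sheaf W(2) _ W(5), of ?W'] W oU by auto
      moreover have "pullback (transition (U1, \<phi>1) (U2, \<phi>2)) \<omega> (\<phi>2 y) vs =
          s y * pullback (transition (U1, \<phi>1) (U2, \<phi>2)) \<eta> (\<phi>2 y) vs" if "y \<in> ?W' - D" "length vs = j" for y vs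
        using W(6)[of y] that by (simp add: pullback_def tr)
      ultimately show ?thesis unfolding tensor_stalk_def using W c2 oU
        by (auto intro!: bexI exI[of _ ?W'] exI[of _ s])
    qed
    then show ?thesis
      using nabla_pullback[OF A L c1(1) c2(1) o s \<eta> \<omega>'] o W1 W2 c2 by blast
  qed
  let ?G = "transition (U, \<phi>) (V, \<psi>)" and ?H = "transition (V, \<psi>) (U, \<phi>)"
  show ?thesis unfolding acyclic_complex_def
  proof (intro allI impI)
    fix j \<omega>
    assume "cocycle (zero_germ D p (V, \<psi>)) (nabla D L (V, \<psi>)) (tensor_stalk D LX p (V, \<psi>) (\<Omega> (V, \<psi>))) j \<omega>"
    then have \<omega>: "\<omega> \<in> tensor_stalk D LX p (V, \<psi>) (\<Omega> (V, \<psi>)) j"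
      and "zero_germ D p (V, \<psi>) (Suc j) (nabla D L (V, \<psi>) \<omega>)" by (auto simp: cocycle_def)
    then obtain V0 where V0: "open V0" "p \<in> V0" "V0 \<subseteq> V"
      "\<And>y vs. y \<in> V0 - D \<Longrightarrow> length vs = Suc j \<Longrightarrow> nabla D L (V, \<psi>) \<omega> (\<psi> y) vs = 0"
      unfolding zero_germ_def by auto
    obtain W where W: "open W" "p \<in> W" "W \<subseteq> V \<inter> U"
      "pullback ?H \<omega> \<in> tensor_stalk D LX p (U, \<phi>) (\<Omega> (U, \<phi>)) j"
      "\<And>y vs. y \<in> W - D \<Longrightarrow> length vs = Suc j \<Longrightarrow>
        nabla D L (U, \<phi>) (pullback ?H \<omega>) (\<phi> y) vs = pullback ?H (nabla D L (V, \<psi>) \<omega>) (\<phi> y) vs"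
      using stalk[OF c' c \<omega>] by blast
    have H: "?H (\<phi> y) = \<psi> y" if "y \<in> U" for y using chart_inv[OF tc that] by (simp add: transition_def)
    have G: "?G (\<psi> y) = \<phi> y" if "y \<in> V" for y using chart_inv[OF tc' that] by (simp add: transition_def)
    have "zero_germ D p (U, \<phi>) (Suc j) (nabla D L (U, \<phi>) (pullback ?H \<omega>))"
    proof -
      have "nabla D L (U, \<phi>) (pullback ?H \<omega>) (\<phi> y) vs = 0"
        if "y \<in> W \<inter> V0 - D" "length vs = Suc j" for y vs
        using W(5)[of y vs] V0(4)[of y] that W(3) by (auto simp: pullback_def H)
      then show ?thesis unfolding zero_germ_def using W V0
        by (auto intro!: exI[of _ "W \<inter> V0"])
    qed
    then have "coboundary (zero_germ D p (U, \<phi>)) (nabla D L (U, \<phi>)) (tensor_stalk D LX p (U, \<phi>) (\<Omega> (U, \<phi>))) j (pullback ?H \<omega>)"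
      using acyc W(4) unfolding acyclic_complex_def cocycle_def by blast
    then show "coboundary (zero_germ D p (V, \<psi>)) (nabla D L (V, \<psi>)) (tensor_stalk D LX p (V, \<psi>) (\<Omega> (V, \<psi>))) j \<omega>"
    proof (cases j)
      case 0
      then have "zero_germ D p (U, \<phi>) 0 (pullback ?H \<omega>)"
        using \<open>coboundary (zero_germ D p (U, \<phi>)) _ _ j _\<close> by (simp add: coboundary_def)
      then obtain W' where W': "open W'" "p \<in> W'" "W' \<subseteq> U" "\<And>y. y \<in> W' - D \<Longrightarrow> pullback ?H \<omega> (\<phi> y) [] = 0"
        unfolding zero_germ_def by auto
      have "\<omega> (\<psi> y) [] = 0" if "y \<in> W \<inter> W' - D" for y
        using W'(4)[of y] that W'(3) by (auto simp: pullback_def H)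
      then have "zero_germ D p (V, \<psi>) 0 \<omega>"
        unfolding zero_germ_def using W W' by (auto intro!: exI[of _ "W \<inter> W'"])
      then show ?thesis using 0 by (simp add: coboundary_def)
    next
      case (Suc i)
      then obtain \<xi> where \<xi>: "\<xi> \<in> tensor_stalk D LX p (U, \<phi>) (\<Omega> (U, \<phi>)) i"
        "zero_germ D p (U, \<phi>) j (\<lambda>z vs. pullback ?H \<omega> z vs - nabla D L (U, \<phi>) \<xi> z vs)"
        using \<open>coboundary (zero_germ D p (U, \<phi>)) _ _ j _\<close> by (auto simp: coboundary_def)
      obtain W' where W': "open W'" "p \<in> W'" "W' \<subseteq> U"
        "\<And>y vs. y \<in> W' - D \<Longrightarrow> length vs = j \<Longrightarrow> pullback ?H \<omega> (\<phi> y) vs = nabla D L (U, \<phi>) \<xi> (\<phi> y) vs"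
        using \<xi>(2) unfolding zero_germ_def by auto
      obtain W2 where W2: "open W2" "p \<in> W2" "W2 \<subseteq> U \<inter> V"
        "pullback ?G \<xi> \<in> tensor_stalk D LX p (V, \<psi>) (\<Omega> (V, \<psi>)) i"
        "\<And>y vs. y \<in> W2 - D \<Longrightarrow> length vs = Suc i \<Longrightarrow>
          nabla D L (V, \<psi>) (pullback ?G \<xi>) (\<psi> y) vs = pullback ?G (nabla D L (U, \<phi>) \<xi>) (\<psi> y) vs"
        using stalk[OF c c' \<xi>(1)] by blast
      have "\<omega> (\<psi> y) vs - nabla D L (V, \<psi>) (pullback ?G \<xi>) (\<psi> y) vs = 0"
        if y: "y \<in> W2 \<inter> W' - D" and len: "length vs = j" for y vs
      proof -
        have yUV: "y \<in> U \<inter> V" using y W2 by auto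
        let ?vs = "map (frechet_derivative ?G (at (\<psi> y))) vs"
        \<comment> \<open>Moving the vectors to the other chart and back changes nothing, so
          \<omega> on them equals its pullback on the moved vectors, where the primitive is
          available.\<close>
        have "map (frechet_derivative ?H (at (\<phi> y))) ?vs = vs"
          using transition_derivative_inverse[OF A c'(1) c(1), of y] yUV by (simp add: o_def)
        then have "\<omega> (\<psi> y) vs = pullback ?H \<omega> (\<phi> y) ?vs" using yUV by (simp add: pullback_def H)
        also have "\<dots> = nabla D L (U, \<phi>) \<xi> (\<phi> y) ?vs" using W'(4)[of y ?vs] y len by simp
        also have "\<dots> = pullback ?G (nabla D L (U, \<phi>) \<xi>) (\<psi> y) vs" using yUV by (simp add: pullback_def G)
        finally show ?thesis using W2(5)[of y vs] y len Suc by simp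
      qed
      then have "zero_germ D p (V, \<psi>) j (\<lambda>z vs. \<omega> z vs - nabla D L (V, \<psi>) (pullback ?G \<xi>) z vs)"
        unfolding zero_germ_def using W2 W' by (auto intro!: exI[of _ "W2 \<inter> W'"])
      then show ?thesis using Suc W2(4) by (auto simp: coboundary_def)
    qed
  qed
qed


section \<open>Coordinate changes of meromorphic and logarithmic germs\<close>

lemma holo_form_off_divisor:
  assumes A: "complex_manifold A" and c: "holo_chart A (U, \<phi>)" and D: "closed D"
    and V: "open V" "V \<subseteq> U" and g: "mholo_on A g V" "\<And>y. y \<in> V - D \<Longrightarrow> g y \<noteq> 0"
    and \<eta>: "extends_holo D (U, \<phi>) j V g \<eta>"
  shows "holo_form j (\<phi> ` (V - D)) \<eta>"
proof -
  note tc = holo_chart_topological[OF c]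
  obtain \<omega> where \<omega>: "holo_form j (\<phi> ` V) \<omega>"
    "\<And>y vs. y \<in> V - D \<Longrightarrow> length vs = j \<Longrightarrow> g y * \<eta> (\<phi> y) vs = \<omega> (\<phi> y) vs"
    using \<eta> unfolding extends_holo_def by auto
  have o: "open (\<phi> ` (V - D))" by (rule chart_image_open[OF tc]) (use V D in auto)
  have inv: "inv_into U \<phi> (\<phi> y) = y" if "y \<in> V" for y using chart_inv[OF tc] V that by blast
  have "cholo_on (\<lambda>z. g (inv_into U \<phi> z)) (\<phi> ` (V - D))"
    by (rule cholo_on_subset[OF mholo_on_chart[OF A c g(1)] o]) (use V in auto)
  then have gi: "cholo_on (\<lambda>z. inverse (g (inv_into U \<phi> z))) (\<phi> ` (V - D))"
    by (rule cholo_on_inverse) (use g(2) inv in auto)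
  show ?thesis
  proof (rule holo_form_cong)
    show "holo_form j (\<phi> ` (V - D)) (\<lambda>z vs. inverse (g (inv_into U \<phi> z)) * \<omega> z vs)"
      by (rule holo_form_mult[OF gi holo_form_subset[OF \<omega>(1) o]]) auto
    fix z and vs :: "(complex^'b) list" assume "z \<in> \<phi> ` (V - D)" "length vs = j"
    then obtain y where y: "z = \<phi> y" "y \<in> V - D" by blast
    have "inverse (g y) * \<omega> (\<phi> y) vs = inverse (g y) * (g y * \<eta> (\<phi> y) vs)"
      using \<omega>(2)[OF y(2) \<open>length vs = j\<close>] by simp
    also have "\<dots> = \<eta> (\<phi> y) vs" using g(2)[OF y(2)] by simp
    finally show "inverse (g (inv_into U \<phi> z)) * \<omega> z vs = \<eta> z vs" using y by (simp add: inv)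
  qed
qed

lemma extends_holo_pullback:
  assumes A: "complex_manifold A" and c: "holo_chart A (U, \<phi>)" and c': "holo_chart A (U', \<psi>)"
    and V: "open V" "V \<subseteq> U" and \<eta>: "extends_holo D (U, \<phi>) j V g \<eta>"
  shows "extends_holo D (U', \<psi>) j (V \<inter> U') g (pullback (transition (U, \<phi>) (U', \<psi>)) \<eta>)"
proof -
  note tc = holo_chart_topological[OF c] and tc' = holo_chart_topological[OF c']
  obtain \<omega> where \<omega>: "holo_form j (\<phi> ` V) \<omega>"
    "\<And>y vs. y \<in> V - D \<Longrightarrow> length vs = j \<Longrightarrow> g y * \<eta> (\<phi> y) vs = \<omega> (\<phi> y) vs"
    using \<eta> unfolding extends_holo_def by auto
  have G: "transition (U, \<phi>) (U', \<psi>) (\<psi> y) = \<phi> y" if "y \<in> U'" for y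
    using chart_inv[OF tc' that] by (simp add: transition_def)
  have o: "open (\<psi> ` (V \<inter> U'))"
    by (rule chart_image_open[OF tc']) (use V chart_open_domain[OF tc'] in auto)
  have "holo_form j (\<psi> ` (V \<inter> U')) (pullback (transition (U, \<phi>) (U', \<psi>)) \<omega>)"
    by (rule holo_form_pullback[OF \<omega>(1) cholo_map_subset[OF cholo_map_transition[OF A c' c] o] _ o])
      (use V in \<open>auto simp: G\<close>)
  then show ?thesis unfolding extends_holo_def
    by (auto intro!: exI[of _ "pullback (transition (U, \<phi>) (U', \<psi>)) \<omega>"] simp: pullback_def G \<omega>(2))
qed

lemma extends_holo_cong:
  "(\<And>y vs. y \<in> V - D \<Longrightarrow> length vs = j \<Longrightarrow> g y * \<eta> (\<phi> y) vs = g' y * \<eta>' (\<phi> y) vs) \<Longrightarrow>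
    extends_holo D (U, \<phi>) j V g \<eta> = extends_holo D (U, \<phi>) j V g' \<eta>'"
  unfolding extends_holo_def by auto

lemma mero_forms_pullback:
  assumes A: "complex_manifold A" and c: "holo_chart A c" and c': "holo_chart A c'"
    and p: "p \<in> fst c" "p \<in> fst c'" and \<eta>: "\<eta> \<in> mero_forms A D p c j"
  shows "pullback (transition c c') \<eta> \<in> mero_forms A D p c' j"
proof -
  obtain U \<phi> U' \<psi> where cc: "c = (U, \<phi>)" "c' = (U', \<psi>)" by (metis prod.collapse)
  obtain V f m where V: "p \<in> V" "V \<subseteq> U" "reduced_eq A D V f" "extends_holo D (U, \<phi>) j V (\<lambda>y. f y ^ m) \<eta>"
    using \<eta> unfolding mero_forms_def cc by auto
  have o: "open V" "open (V \<inter> U')"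
    using reduced_eqD(2)[OF V(3)] chart_open_domain[OF holo_chart_topological[OF c'[unfolded cc]]] by auto
  have "extends_holo D (U', \<psi>) j (V \<inter> U') (\<lambda>y. f y ^ m) (pullback (transition (U, \<phi>) (U', \<psi>)) \<eta>)"
    by (rule extends_holo_pullback[OF A c[unfolded cc] c'[unfolded cc] o(1) V(2,4)])
  moreover have "reduced_eq A D (V \<inter> U') f" by (rule reduced_eq_subset[OF A V(3) o(2)]) auto
  ultimately show ?thesis unfolding mero_forms_def cc using V p cc by auto
qed

text \<open>Commuting d with the pullback requires \<eta> to be holomorphic, which holds off
  \<open>D\<close> after division by the reduced equation. \<open>extends_holo\<close> compares
  values only there.\<close>

lemma log_forms_pullback:
  assumes A: "complex_manifold A" and D: "closed D" and c: "holo_chart A c" and c': "holo_chart A c'"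
    and p: "p \<in> fst c" "p \<in> fst c'" and \<eta>: "\<eta> \<in> log_forms A D p c j"
  shows "pullback (transition c c') \<eta> \<in> log_forms A D p c' j"
proof -
  obtain U \<phi> U' \<psi> where cc: "c = (U, \<phi>)" "c' = (U', \<psi>)" by (metis prod.collapse)
  note c = c[unfolded cc] and c' = c'[unfolded cc]
  note tc = holo_chart_topological[OF c] and tc' = holo_chart_topological[OF c']
  obtain V f where V: "p \<in> V" "V \<subseteq> U" "reduced_eq A D V f" "extends_holo D (U, \<phi>) j V f \<eta>"
    "extends_holo D (U, \<phi>) (Suc j) V f (ext_d \<eta>)"
    using \<eta> unfolding log_forms_def cc by auto
  let ?G = "transition (U, \<phi>) (U', \<psi>)"
  have o: "open V" "open (V \<inter> U')"
    using reduced_eqD(2)[OF V(3)] chart_open_domain[OF tc'] by auto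
  have "holo_form j (\<phi> ` (V - D)) \<eta>"
    by (rule holo_form_off_divisor[OF A c D o(1) V(2) reduced_eqD(1)[OF V(3)] _ V(4)])
      (use reduced_eqD(3)[OF V(3)] in auto)
  moreover have o': "open (\<psi> ` (V \<inter> U' - D))" by (rule chart_image_open[OF tc']) (use o D in auto)
  moreover have "cholo_map_on ?G (\<psi> ` (V \<inter> U' - D))"
    by (rule cholo_map_subset[OF cholo_map_transition[OF A c' c] o']) (use V in auto)
  moreover have "?G (\<psi> y) = \<phi> y" if "y \<in> U'" for y
    using chart_inv[OF tc' that] by (simp add: transition_def)
  ultimately have e: "ext_d (pullback ?G \<eta>) (\<psi> y) vs = pullback ?G (ext_d \<eta>) (\<psi> y) vs"
    if "y \<in> V \<inter> U' - D" "length vs = Suc j" for y vs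
    by (intro ext_d_pullback[where S = "\<psi> ` (V \<inter> U' - D)"]) (use that in auto)
  have "extends_holo D (U', \<psi>) (Suc j) (V \<inter> U') f (ext_d (pullback ?G \<eta>))"
    by (subst extends_holo_cong[where g' = f and \<eta>' = "pullback ?G (ext_d \<eta>)"])
      (use e extends_holo_pullback[OF A c c' o(1) V(2,5)] in auto)
  moreover have "extends_holo D (U', \<psi>) j (V \<inter> U') f (pullback ?G \<eta>)"
    by (rule extends_holo_pullback[OF A c c' o(1) V(2,4)])
  moreover have "reduced_eq A D (V \<inter> U') f" by (rule reduced_eq_subset[OF A V(3) o(2)]) auto
  ultimately show ?thesis unfolding log_forms_def cc using V p cc by auto
qed

lemma mero_forms_holo:
  assumes A: "complex_manifold A" and D: "closed D" and c: "holo_chart A c"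
    and \<eta>: "\<eta> \<in> mero_forms A D p c j"
  shows "\<exists>V. open V \<and> p \<in> V \<and> V \<subseteq> fst c \<and> holo_form j (snd c ` (V - D)) \<eta>"
proof -
  obtain U \<phi> where cc: "c = (U, \<phi>)" by (metis prod.collapse)
  obtain V f m where V: "p \<in> V" "V \<subseteq> U" "reduced_eq A D V f" "extends_holo D (U, \<phi>) j V (\<lambda>y. f y ^ m) \<eta>"
    using \<eta> unfolding mero_forms_def cc by auto
  have "mholo_on A (\<lambda>y. f y ^ m) V"
    using mholo_on_prod[OF A reduced_eqD(2)[OF V(3)], of "{..<m}" "\<lambda>i. f"] reduced_eqD(1)[OF V(3)] by simp
  from holo_form_off_divisor[OF A c[unfolded cc] D reduced_eqD(2)[OF V(3)] V(2) this _ V(4)]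
  have "holo_form j (\<phi> ` (V - D)) \<eta>" using reduced_eqD(3)[OF V(3)] by auto
  then show ?thesis using V reduced_eqD(2)[OF V(3)] cc by auto
qed

lemma log_forms_subset_mero_forms: "log_forms A D p c j \<subseteq> mero_forms A D p c j"
proof
  fix \<eta> assume "\<eta> \<in> log_forms A D p c j"
  then obtain V f where "p \<in> V" "V \<subseteq> fst c" "reduced_eq A D V f" "extends_holo D c j V (\<lambda>y. f y ^ 1) \<eta>"
    unfolding log_forms_def by auto
  then show "\<eta> \<in> mero_forms A D p c j" unfolding mero_forms_def by blast
qed


section \<open>Components and the factorization\<close>

text \<open>Smooth charts are centred at their point. Recentring one of them at a neighbouring point
  of \<open>D\<close> is what shows that this point is regular too.\<close>

lemma holo_chart_translate:
  assumes A: "complex_manifold A" and c: "holo_chart A (U, \<phi>)"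
  shows "holo_chart A (U, \<lambda>u. \<phi> u - a)"
proof -
  note tc = holo_chart_topological[OF c]
  let ?\<phi> = "\<lambda>u. \<phi> u - a"
  have img: "?\<phi> ` V = (\<lambda>z. z - a) ` (\<phi> ` V)" for V by auto
  have inj: "inj_on \<phi> U" using chart_inv[OF tc] by (rule inj_on_inverseI)
  then have inj': "inj_on ?\<phi> U" by (auto simp: inj_on_def)
  have inv: "inv_into U ?\<phi> z = inv_into U \<phi> (z + a)" if "z \<in> ?\<phi> ` U" for z
  proof -
    from that obtain y where y: "y \<in> U" "z = \<phi> y - a" by auto
    then show ?thesis using inv_into_f_f[OF inj' y(1)] inv_into_f_f[OF inj y(1)] by simp
  qed
  have o: "open (?\<phi> ` V)" if "open V" "V \<subseteq> U" for V
    unfolding img using open_translation_subtract[OF chart_image_open[OF tc that], of a] by simp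
  have "homeomorphism U (?\<phi> ` U) ?\<phi> (inv_into U ?\<phi>)"
  proof (rule homeomorphismI)
    show "continuous_on U ?\<phi>" by (intro continuous_intros chart_continuous[OF tc])
    have "continuous_on (?\<phi> ` U) (\<lambda>z. inv_into U \<phi> (z + a))"
      by (rule continuous_on_compose2[OF chart_inv_continuous[OF tc]]) (auto intro!: continuous_intros)
    then show "continuous_on (?\<phi> ` U) (inv_into U ?\<phi>)"
      by (rule continuous_on_eq) (simp add: inv)
  qed (use inv_into_f_f[OF inj'] in auto)
  then have "topological_chart (U, ?\<phi>)"
    using o chart_open_domain[OF tc] by (simp add: topological_chart_def)
  moreover have "transition_holo (U, ?\<phi>) c' \<and> transition_holo c' (U, ?\<phi>)" if c'A: "c' \<in> A" for c'
  proof -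
    obtain V \<psi> where c'': "c' = (V, \<psi>)" by (metis prod.collapse)
    note hc' = atlas_holo_chart[OF A c'A, unfolded c'']
    note tc' = holo_chart_topological[OF hc']
    have oUV: "open (U \<inter> V)" using chart_open_domain[OF tc] chart_open_domain[OF tc'] by auto
    have "cholo_map_on (\<lambda>z. transition (V, \<psi>) (U, \<phi>) (z + a)) (?\<phi> ` (U \<inter> V))"
      by (rule cholo_map_compose[OF cholo_map_transition[OF A c hc']])
        (use o[OF oUV] in \<open>auto simp: cholo_map_on_def\<close>)
    then have "cholo_map_on (\<psi> \<circ> inv_into U ?\<phi>) (?\<phi> ` (U \<inter> V))"
      by (rule cholo_map_cong[rotated]) (auto simp: transition_def inv)
    moreover have "cholo_map_on (?\<phi> \<circ> inv_into V \<psi>) (\<psi> ` (V \<inter> U))"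
    proof -
      have t: "cholo_map_on (transition (U, \<phi>) (V, \<psi>)) (\<psi> ` (V \<inter> U))" by (rule cholo_map_transition[OF A hc' c])
      have "cholo_on (\<lambda>z. transition (U, \<phi>) (V, \<psi>) z $ i + - (a $ i)) (\<psi> ` (V \<inter> U))" for i
        using t[unfolded cholo_map_on_def, THEN spec, of i] cholo_on_open
        by (intro cholo_on_add cholo_on_const) auto
      then show ?thesis unfolding cholo_map_on_def by (simp add: transition_def o_def)
    qed
    ultimately show ?thesis by (simp add: transition_holo_def c'')
  qed
  ultimately show ?thesis by (simp add: holo_chart_def)
qed

lemma smooth_chart_translate:
  assumes A: "complex_manifold A" and q: "smooth_chart A D q (U, \<phi>) i" and y: "y \<in> U" "\<phi> y $ i = 0"
  shows "y \<in> regular_locus A D"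
proof -
  have "holo_chart A (U, \<phi>)" "D \<inter> U = {y \<in> U. \<phi> y $ i = 0}"
    using q unfolding smooth_chart_def by auto
  then have "smooth_chart A D y (U, \<lambda>u. \<phi> u - \<phi> y) i"
    using holo_chart_translate[OF A] y by (simp add: smooth_chart_def)
  moreover have "y \<in> D" using \<open>D \<inter> U = _\<close> y by blast
  ultimately show ?thesis unfolding regular_locus_def by blast
qed

text \<open>The divisor is locally connected at a regular point.\<close>

lemma regular_point_component:
  assumes A: "complex_manifold A" and q: "q \<in> regular_locus A D"
    and K: "K \<in> components (regular_locus A D)" "q \<in> closure K"
  shows "q \<in> K"
proof -
  obtain U \<phi> i where s: "smooth_chart A D q (U, \<phi>) i" using q unfolding regular_locus_def by auto
  then have c: "holo_chart A (U, \<phi>)" "q \<in> U" "\<phi> q = 0" "D \<inter> U = {y \<in> U. \<phi> y $ i = 0}"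
    unfolding smooth_chart_def by auto
  note tc = holo_chart_topological[OF c(1)]
  have "0 \<in> \<phi> ` U" using c(2,3) by force
  then obtain r where r: "0 < r" "ball 0 r \<subseteq> \<phi> ` U"
    using chart_open_range[OF tc] openE by blast
  \<comment> \<open>A small coordinate slice of \<open>D\<close> through \<open>q\<close>. It is
    convex in the chart, hence connected, and consists of regular points, so it lies in
    \<open>K\<close> as soon as it meets \<open>K\<close>.\<close>
  define Q where "Q = inv_into U \<phi> ` {z \<in> ball 0 r. z $ i = 0}"
  have "open (inv_into U \<phi> ` ball 0 r)" by (rule chart_inv_image_open[OF tc open_ball r(2)])
  moreover have q_in: "q = inv_into U \<phi> 0" using chart_inv[OF tc c(2)] c(3) by simp
  then have "q \<in> inv_into U \<phi> ` ball 0 r" using r by auto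
  ultimately obtain y where y: "y \<in> K" "y \<in> inv_into U \<phi> ` ball 0 r"
    using K(2) by (meson closure_iff_nhds_not_empty disjoint_iff subset_refl)
  then obtain z where z: "z \<in> ball 0 r" "y = inv_into U \<phi> z" by blast
  have zU: "z \<in> \<phi> ` U" using z r by blast
  have yU: "y \<in> U" "\<phi> y = z" using chart_inv_in[OF tc zU] chart_inv'[OF tc zU] z by auto
  have "y \<in> D" using K(1) y(1) in_components_subset unfolding regular_locus_def by blast
  then have "z $ i = 0" using c(4) yU by blast
  then have yQ: "y \<in> Q" using z by (auto simp: Q_def)
  have "convex {z :: complex^'b. z \<in> ball 0 r \<and> z $ i = 0}"
  proof -
    have "{z :: complex^'b. z \<in> ball 0 r \<and> z $ i = 0} = ball 0 r \<inter> {z. z $ i = 0}" by auto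
    moreover have "convex {z :: complex^'b. z $ i = 0}" by (auto simp: convex_def)
    ultimately show ?thesis by (simp add: convex_Int)
  qed
  then have "connected Q" unfolding Q_def
    by (intro connected_continuous_image convex_connected continuous_on_subset[OF chart_inv_continuous[OF tc]])
      (use r in auto)
  moreover have "Q \<subseteq> regular_locus A D"
  proof
    fix y' assume "y' \<in> Q"
    then obtain z' where z': "z' \<in> ball 0 r" "z' $ i = 0" "y' = inv_into U \<phi> z'" by (auto simp: Q_def)
    then have "z' \<in> \<phi> ` U" using r by blast
    then show "y' \<in> regular_locus A D"
      using z' chart_inv_in[OF tc] chart_inv'[OF tc] by (intro smooth_chart_translate[OF A s]) auto
  qed
  ultimately have "Q \<subseteq> K" using components_maximal[OF K(1)] y yQ by blast
  moreover have "q \<in> Q" unfolding Q_def q_in using r by auto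
  ultimately show ?thesis by blast
qed

section \<open>Local factors grouped by global components\<close>

lemma reduced_divisor_nowhere_dense:
  assumes D: "reduced_divisor A D" and M: "open M" "p \<in> M"
  shows "\<not> M \<subseteq> D"
proof
  assume MD: "M \<subseteq> D"
  obtain W f where W: "p \<in> W" "mholo_on A f W" "D \<inter> W = {y \<in> W. f y = 0}"
    "\<forall>V. open V \<and> V \<subseteq> W \<and> V \<noteq> {} \<longrightarrow> (\<exists>y\<in>V. f y \<noteq> 0)"
    using D[unfolded reduced_divisor_def, THEN spec, of p] by (elim exE conjE) (rule that)
  have "open (M \<inter> W)" "M \<inter> W \<noteq> {}" using M W mholo_on_open[OF W(2)] by auto
  then obtain y where "y \<in> M \<inter> W" "f y \<noteq> 0" using W(4)[rule_format, of "M \<inter> W"] by blast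
  moreover from this have "y \<in> {y \<in> W. f y = 0}" unfolding W(3)[symmetric] using MD by blast
  ultimately show False by simp
qed

lemma mholo_on_inverse:
  assumes A: "complex_manifold A" and g: "mholo_on A g W" "\<And>y. y \<in> W \<Longrightarrow> g y \<noteq> 0"
  shows "mholo_on A (\<lambda>y. inverse (g y)) W"
proof (rule mholo_onI[OF mholo_on_open[OF g(1)]])
  fix U \<phi> assume U: "(U, \<phi>) \<in> A"
  note tu = holo_chart_topological[OF atlas_holo_chart[OF A U]]
  show "cholo_on (\<lambda>z. inverse (g (inv_into U \<phi> z))) (\<phi> ` (U \<inter> W))"
    by (rule cholo_on_inverse[OF mholo_on_atlas[OF g(1) U]]) (use g(2) chart_inv[OF tu] in auto)
qed

text \<open>\<open>comp k\<close> names a global component that contains the zeros of the local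
  factor \<open>fs k\<close> near \<open>p\<close>. Injectivity is not to be expected: one component
  can have several branches at \<open>p\<close>.\<close>

locale divisor_factorization =
  fixes A :: "('a::t2_space, 'n::finite) chart set" and D :: "'a set" and p :: 'a
    and f :: "'a \<Rightarrow> complex" and W :: "'a set" and m :: nat and fs :: "nat \<Rightarrow> 'a \<Rightarrow> complex"
    and comp :: "nat \<Rightarrow> 'a set"
  assumes A: "complex_manifold A" and D: "reduced_divisor A D" and closed_D: "closed D" and pD: "p \<in> D"
    and f: "reduced_eq A D W f" and pW: "p \<in> W"
    and fact: "irreducible_factorization A p f m fs"
    and comp: "\<And>k. k < m \<Longrightarrow> comp k \<in> irr_components A D"
    and fs_comp: "\<And>k. k < m \<Longrightarrow> \<forall>\<^sub>F y in nhds p. fs k y = 0 \<longrightarrow> y \<in> comp k"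
begin

text \<open>The product of the branches assigned to \<open>C\<close>, a candidate for a local
  equation of \<open>C\<close> at \<open>p\<close>. For a component without branches it is the empty
  product 1.\<close>

definition factor :: "'a set \<Rightarrow> 'a \<Rightarrow> complex" where
  "factor C y = (\<Prod>k | k < m \<and> comp k = C. fs k y)"

lemma fs_germ: "k < m \<Longrightarrow> fs k p = 0" "k < m \<Longrightarrow> \<exists>W. p \<in> W \<and> mholo_on A (fs k) W"
  using fact unfolding irreducible_factorization_def irreducible_germ_def by blast+

lemma factorization_neighbourhood:
  obtains N where "open N" "p \<in> N" "N \<subseteq> W" "\<And>k. k < m \<Longrightarrow> mholo_on A (fs k) N"
    "\<And>y. y \<in> N \<Longrightarrow> f y = (\<Prod>k<m. fs k y)" "\<And>k y. k < m \<Longrightarrow> y \<in> N \<Longrightarrow> fs k y = 0 \<Longrightarrow> y \<in> comp k"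
proof -
  obtain Wk where Wk: "\<And>k. k < m \<Longrightarrow> p \<in> Wk k \<and> mholo_on A (fs k) (Wk k)"
    using fs_germ(2) by metis
  have "\<forall>\<^sub>F y in nhds p. y \<in> Wk k" if "k < m" for k
    using Wk[OF that] mholo_on_open eventually_nhds_in_open by blast
  moreover have "\<forall>\<^sub>F y in nhds p. f y = (\<Prod>k<m. fs k y)"
    using fact by (simp add: irreducible_factorization_def)
  moreover have "\<forall>\<^sub>F y in nhds p. y \<in> W"
    using reduced_eqD(2)[OF f] pW eventually_nhds_in_open by blast
  ultimately have "\<forall>\<^sub>F y in nhds p. y \<in> W \<and> f y = (\<Prod>k<m. fs k y) \<and>
      (\<forall>k\<in>{..<m}. y \<in> Wk k \<and> (fs k y = 0 \<longrightarrow> y \<in> comp k))"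
    using fs_comp by (intro eventually_conj eventually_ball_finite ballI) auto
  then obtain N where N: "open N" "p \<in> N" "\<And>y. y \<in> N \<Longrightarrow> y \<in> W \<and> f y = (\<Prod>k<m. fs k y) \<and>
      (\<forall>k\<in>{..<m}. y \<in> Wk k \<and> (fs k y = 0 \<longrightarrow> y \<in> comp k))"
    unfolding eventually_nhds by blast
  show ?thesis
  proof (rule that[OF N(1,2)])
    show "mholo_on A (fs k) N" if "k < m" for k
      using mholo_on_subset[OF A conjunct2[OF Wk[OF that]] N(1)] N(3) that by auto
  qed (use N(3) in auto)
qed

lemma p_in_comp: "k < m \<Longrightarrow> p \<in> comp k"
  using eventually_nhds_x_imp_x[OF fs_comp] fs_germ(1) by auto

lemma factor_not_through_p:
  assumes "p \<notin> C"
  shows "factor C y = 1"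
proof -
  have "{k. k < m \<and> comp k = C} = {}" using p_in_comp assms by auto
  then show ?thesis unfolding factor_def by (simp only: prod.empty)
qed

context
  fixes N :: "'a set"
  assumes N: "open N" "p \<in> N" "N \<subseteq> W" and N_holo: "\<And>k. k < m \<Longrightarrow> mholo_on A (fs k) N"
    and N_f: "\<And>y. y \<in> N \<Longrightarrow> f y = (\<Prod>k<m. fs k y)"
    and N_comp: "\<And>k y. k < m \<Longrightarrow> y \<in> N \<Longrightarrow> fs k y = 0 \<Longrightarrow> y \<in> comp k"
begin

lemma factor_holo: "mholo_on A (factor C) N"
  using mholo_on_prod[OF A N(1), of "{k. k < m \<and> comp k = C}" fs] N_holo
  unfolding factor_def[abs_def] by auto

lemma prod_factor: "y \<in> N \<Longrightarrow> f y = (\<Prod>C\<in>comp ` {..<m}. factor C y)"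
  using N_f[of y] prod.group[of "{..<m}" "comp ` {..<m}" comp "\<lambda>k. fs k y"] by (simp add: factor_def)

lemma divisor_point_factor:
  assumes "y \<in> N" "y \<in> D"
  obtains k where "k < m" "fs k y = 0" "y \<in> comp k"
proof -
  have "(\<Prod>k<m. fs k y) = 0"
    using N_f[OF assms(1)] reduced_eqD(3)[OF f, of y] assms N(3) by auto
  then obtain k where "k < m" "fs k y = 0" by auto
  then show ?thesis using that N_comp assms by blast
qed

text \<open>At a regular point of \<open>C\<close> some branch vanishes, and the point lies in the
  closure that \<open>comp\<close> assigns to this branch. By \<open>regular_point_component\<close>
  it already lies in the connected piece being closed, and pieces sharing a point coincide, so the
  branch belongs to \<open>C\<close>. Continuity extends the vanishing to all of
  \<open>C\<close>.\<close>

lemma factor_vanishes: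
  assumes C: "C \<in> irr_components A D" and y: "y \<in> C" "y \<in> N"
  shows "factor C y = 0"
proof -
  obtain K where K: "K \<in> components (regular_locus A D)" "C = closure K"
    using C unfolding irr_components_def by auto
  have reg: "factor C q = 0" if q: "q \<in> K" "q \<in> N" for q
  proof -
    have qr: "q \<in> regular_locus A D" using K(1) q in_components_subset by blast
    then have "q \<in> D" by (simp add: regular_locus_def)
    then obtain k where k: "k < m" "fs k q = 0" "q \<in> comp k" using divisor_point_factor q by blast
    obtain K' where K': "K' \<in> components (regular_locus A D)" "comp k = closure K'"
      using comp[OF k(1)] unfolding irr_components_def by auto
    have "q \<in> K'" by (rule regular_point_component[OF A qr K'(1)]) (use k K' in auto)
    then have "K' = K" using K(1) K'(1) q components_nonoverlap by blast
    then have "comp k = C" using K K' by simp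
    then show ?thesis unfolding factor_def using k by (auto intro!: prod_zero)
  qed
  show ?thesis
  proof (rule ccontr)
    assume "factor C y \<noteq> 0"
    have "open (N \<inter> factor C -` (- {0}))"
      by (rule continuous_open_preimage[OF mholo_on_continuous[OF A factor_holo] N(1)]) auto
    moreover have "y \<in> N \<inter> factor C -` (- {0})" using y \<open>factor C y \<noteq> 0\<close> by auto
    moreover have "y \<in> closure K" using y K by simp
    ultimately obtain q where "q \<in> K" "q \<in> N \<inter> factor C -` (- {0})"
      by (meson closure_iff_nhds_not_empty disjoint_iff subset_refl)
    then show False using reg by auto
  qed
qed

end

text \<open>\<open>factor C\<close> vanishes at \<open>p\<close> and so cannot be the empty
  product.\<close>

lemma component_through_p:
  assumes "C \<in> irr_components A D" "p \<in> C"
  shows "C \<in> comp ` {..<m}"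
proof -
  obtain N where N: "open N" "p \<in> N" "N \<subseteq> W" "\<And>k. k < m \<Longrightarrow> mholo_on A (fs k) N"
    "\<And>y. y \<in> N \<Longrightarrow> f y = (\<Prod>k<m. fs k y)" "\<And>k y. k < m \<Longrightarrow> y \<in> N \<Longrightarrow> fs k y = 0 \<Longrightarrow> y \<in> comp k"
    using factorization_neighbourhood by blast
  have "factor C p = 0" by (rule factor_vanishes[OF N assms N(2)])
  then show ?thesis unfolding factor_def by auto
qed

text \<open>Each \<open>factor C\<close> is a multiple \<open>b C\<close> of the reduced equation of \<open>C\<close>, and the product of these
  equations is a multiple of the reduced equation \<open>f\<close>, the product of the factors; hence every
  \<open>b C\<close> is a unit.\<close>

lemma factor_associated:
  assumes V: "open V" "p \<in> V"
    and g: "\<And>C. C \<in> irr_components A D \<Longrightarrow> C \<inter> V \<noteq> {} \<Longrightarrow> reduced_eq A C V (g C)"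
    and C: "C \<in> irr_components A D" "C \<inter> V \<noteq> {}"
  shows "\<exists>b N. open N \<and> p \<in> N \<and> N \<subseteq> V \<and> mholo_on A b N \<and> b p \<noteq> 0 \<and>
    (\<forall>y\<in>N. factor C y = b y * g C y)"
proof (cases "p \<in> C")
  \<comment> \<open>If \<open>C\<close> misses \<open>p\<close>, then \<open>factor C\<close> is 1
    and \<open>g C\<close> is invertible off \<open>C\<close>; the required unit is its
    inverse.\<close>
  case False
  have "closed C" using C(1) by (auto simp: irr_components_def)
  then have o: "open (V - C)" using V by auto
  note gC = reduced_eqD[OF g[OF C]]
  have nz: "g C y \<noteq> 0" if "y \<in> V - C" for y using gC(3) that by auto
  have "mholo_on A (\<lambda>y. inverse (g C y)) (V - C)"
    by (rule mholo_on_inverse[OF A mholo_on_subset[OF A gC(1) o]]) (use nz in auto)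
  then show ?thesis using o V nz False
    by (intro exI[of _ "\<lambda>y. inverse (g C y)"] exI[of _ "V - C"]) (auto simp: factor_not_through_p)
next
  case True
  obtain N where N: "open N" "p \<in> N" "N \<subseteq> W" "\<And>k. k < m \<Longrightarrow> mholo_on A (fs k) N"
    "\<And>y. y \<in> N \<Longrightarrow> f y = (\<Prod>k<m. fs k y)" "\<And>k y. k < m \<Longrightarrow> y \<in> N \<Longrightarrow> fs k y = 0 \<Longrightarrow> y \<in> comp k"
    using factorization_neighbourhood by blast
  let ?R = "comp ` {..<m}"
  have R: "C' \<in> irr_components A D" "p \<in> C'" "C' \<inter> V \<noteq> {}" if "C' \<in> ?R" for C'
    using that comp p_in_comp V by auto
  have "\<exists>b N'. p \<in> N' \<and> N' \<subseteq> N \<and> N' \<subseteq> V \<and> mholo_on A b N' \<and> (\<forall>y\<in>N'. factor C' y = b y * g C' y)"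
    if C': "C' \<in> ?R" for C'
  proof -
    have v: "\<And>y. y \<in> N \<Longrightarrow> y \<in> C' \<Longrightarrow> factor C' y = 0"
      by (rule factor_vanishes[OF N R(1)[OF C']])
    have fh: "mholo_on A (factor C') N" by (rule factor_holo[OF N])
    show ?thesis
    proof (rule reduced_eq_divides[OF g[OF R(1,3)[OF C']] V(2) N(2) fh])
      show "factor C' y = 0" if "y \<in> N" "y \<in> C'" for y by (rule v[OF that])
    qed (intro exI conjI ballI)
  qed
  then obtain b Nb where b: "\<And>C'. C' \<in> ?R \<Longrightarrow> p \<in> Nb C' \<and> Nb C' \<subseteq> N \<and> Nb C' \<subseteq> V \<and>
      mholo_on A (b C') (Nb C') \<and> (\<forall>y\<in>Nb C'. factor C' y = b C' y * g C' y)"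
    by metis
  have "mholo_on A (\<lambda>y. \<Prod>C'\<in>?R. g C' y) V"
    by (rule mholo_on_prod[OF A V(1)]) (use reduced_eqD(1)[OF g[OF R(1,3)]] in blast)
  then have G: "mholo_on A (\<lambda>y. \<Prod>C'\<in>?R. g C' y) (V \<inter> N)"
    by (rule mholo_on_subset[OF A]) (use V N in auto)
  \<comment> \<open>Divisibility in the opposite direction: the product of the component equations
    vanishes on \<open>D\<close> near \<open>p\<close> and is therefore a multiple of the reduced
    equation \<open>f\<close>.\<close>
  obtain h N' where h: "p \<in> N'" "N' \<subseteq> V \<inter> N" "N' \<subseteq> W" "mholo_on A h N'"
    "\<And>y. y \<in> N' \<Longrightarrow> (\<Prod>C'\<in>?R. g C' y) = h y * f y"
  proof (rule reduced_eq_divides[OF f pW _ G])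
    fix y assume y: "y \<in> V \<inter> N" "y \<in> D"
    then obtain k where k: "k < m" "y \<in> comp k" using divisor_point_factor[OF N] by blast
    have "comp k \<in> ?R" using k by auto
    from reduced_eqD(3)[OF g[OF R(1,3)[OF this]]] k y have "g (comp k) y = 0" by auto
    then show "(\<Prod>C'\<in>?R. g C' y) = 0" using k by (intro prod_zero) auto
  qed (use V N in auto)
  define M where "M = N' \<inter> (\<Inter>C'\<in>?R. Nb C')"
  have oNb: "open (Nb C')" if "C' \<in> ?R" for C' using b[OF that] mholo_on_open by blast
  have "open M" unfolding M_def
    by (intro open_Int open_INT ballI mholo_on_open[OF h(4)] oNb) auto
  moreover have "p \<in> M" unfolding M_def using b h by blast
  ultimately have M: "open M" "p \<in> M" .
  have bM: "mholo_on A (b C') M" if "C' \<in> ?R" for C'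
  proof (rule mholo_on_subset[OF A _ M(1)])
    show "mholo_on A (b C') (Nb C')" using b[OF that] by blast
    show "M \<subseteq> Nb C'" using that by (auto simp: M_def)
  qed
  \<comment> \<open>Passing from \<open>f\<close> to the component equations and back multiplies
    \<open>f\<close> by \<open>u\<close>. As \<open>D\<close> has no interior, \<open>u\<close> must
    be 1 at \<open>p\<close>, and then no factor of \<open>u\<close> can vanish there.\<close>
  define u where "u = (\<lambda>y. (\<Prod>C'\<in>?R. b C' y) * h y)"
  have u: "mholo_on A u M" unfolding u_def
    by (intro mholo_on_mult mholo_on_prod[OF A M(1)] bM mholo_on_subset[OF A h(4) M(1)]) (auto simp: M_def)
  have uf: "u y * f y = f y" if y: "y \<in> M" for y
  proof -
    have "f y = (\<Prod>C'\<in>?R. factor C' y)" by (rule prod_factor[OF N]) (use y h in \<open>auto simp: M_def\<close>)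
    also have "\<dots> = (\<Prod>C'\<in>?R. b C' y * g C' y)"
      by (rule prod.cong) (use b y in \<open>auto simp: M_def\<close>)
    also have "\<dots> = u y * f y" using h(5)[of y] y by (simp add: prod.distrib u_def M_def)
    finally show ?thesis by simp
  qed
  have "u p = 1"
  proof (rule ccontr)
    assume up: "u p \<noteq> 1"
    have "open (M \<inter> u -` (- {1}))"
      by (rule continuous_open_preimage[OF mholo_on_continuous[OF A u] M(1)]) auto
    moreover have "p \<in> M \<inter> u -` (- {1})" using up M by auto
    moreover have "M \<inter> u -` (- {1}) \<subseteq> D"
    proof
      fix y assume y: "y \<in> M \<inter> u -` (- {1})"
      then have "f y = 0" using uf[of y] by auto
      then show "y \<in> D" using reduced_eqD(3)[OF f, of y] y h(3) by (auto simp: M_def)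
    qed
    ultimately show False using reduced_divisor_nowhere_dense[OF D] by blast
  qed
  then have "(\<Prod>C'\<in>?R. b C' p) \<noteq> 0" unfolding u_def by (metis mult_zero_left zero_neq_one)
  moreover have CR: "C \<in> ?R" by (rule component_through_p[OF C(1) True])
  ultimately have "b C p \<noteq> 0" by (meson finite_imageI finite_lessThan prod_zero_iff)
  then show ?thesis using b[OF CR] mholo_on_open by (intro exI[of _ "b C"] exI[of _ "Nb C"]) auto
qed

end


section \<open>Acyclicity in weighted homogeneous coordinates\<close>

lemma rot_invariant_ball: "rot_invariant w (ball 0 r)"
  by (simp add: rot_invariant_def)

lemma wedge1_cong:
  "(\<And>v. l v = l' v) \<Longrightarrow> (\<And>us. Suc (length us) = length vs \<Longrightarrow> m us = m' us) \<Longrightarrow> wedge1 l m vs = wedge1 l' m' vs"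
  unfolding wedge1_def by (intro sum.cong refl) auto

lemma wedge1_scale_left: "wedge1 (\<lambda>v. l v * c) m vs = c * wedge1 l m vs"
  by (simp add: wedge1_def sum_distrib_left algebra_simps)

lemma twisted_holo_on_subset: "twisted_holo_on A L s V \<Longrightarrow> V' \<subseteq> V \<Longrightarrow> twisted_holo_on A L s V'"
  unfolding twisted_holo_on_def by (meson subset_trans)

text \<open>The local normal form at \<open>p\<close>, separated from its construction: a ball in
  weighted coordinates, a generator \<open>s\<close> of \<open>LX\<close> over it, and the
  connection form \<theta> of \<open>s\<close>. As \<theta> may have poles along \<open>D\<close>,
  its invariance and its value on the Euler field are required only where \<open>f\<close> is
  nonzero.\<close>

locale twisted_chart =
  fixes A :: "('a::t2_space, 'n::finite) chart set" and D :: "'a set"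
    and L LX :: "'a set \<Rightarrow> ('a \<Rightarrow> complex) set" and p :: 'a and U :: "'a set" and \<phi> :: "'a \<Rightarrow> complex^'n"
    and w :: "'n \<Rightarrow> real" and T r :: real and a :: complex and s :: "'a \<Rightarrow> complex"
    and \<theta> :: "complex^'n \<Rightarrow> complex^'n \<Rightarrow> complex" and f :: "'a \<Rightarrow> complex"
  assumes A: "complex_manifold A" and L: "rank1_local_system (- D) L"
    and c: "holo_chart A (U, \<phi>)" and p: "p \<in> U" "\<phi> p = 0"
    and r: "0 < r" "ball 0 r \<subseteq> \<phi> ` U"
    and LX_sheaf: "function_sheaf UNIV (- D) LX"
    and LX: "\<And>W. open W \<Longrightarrow> W \<subseteq> inv_into U \<phi> ` ball 0 r \<Longrightarrow>
      LX W = {s'. \<exists>h. mholo_on A h W \<and> (\<forall>y\<in>W - D. s' y = h y * s y)}"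
    and s: "twisted_holo_on A L s (inv_into U \<phi> ` ball 0 r - D)"
      "\<And>y. y \<in> inv_into U \<phi> ` ball 0 r - D \<Longrightarrow> s y \<noteq> 0"
    and conn_s: "\<And>y v. y \<in> inv_into U \<phi> ` ball 0 r - D \<Longrightarrow> conn D L (U, \<phi>) s y v = \<theta> (\<phi> y) v * s y"
    and f: "reduced_eq A D (inv_into U \<phi> ` ball 0 r) f"
    and f_rot: "\<And>z t. z \<in> ball 0 r \<Longrightarrow>
      f (inv_into U \<phi> (rot w (of_real t) z)) = exp (\<i> * of_real t) * f (inv_into U \<phi> z)"
    and \<theta>_inv: "\<And>z t v. z \<in> ball 0 r \<Longrightarrow> f (inv_into U \<phi> z) \<noteq> 0 \<Longrightarrow>
      \<theta> (rot w (of_real t) z) (rot w (of_real t) v) = \<theta> z v"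
    and \<theta>_euler: "\<And>z. z \<in> ball 0 r \<Longrightarrow> f (inv_into U \<phi> z) \<noteq> 0 \<Longrightarrow> \<theta> z (euler w z) = a"
    and T: "0 \<le> T" "\<And>z. rot w (of_real T) z = z" and mono: "exp (\<i> * a * of_real T) \<noteq> 1"
begin

abbreviation "inv\<phi> \<equiv> inv_into U \<phi>"

definition nbh :: "real \<Rightarrow> 'a set" where "nbh \<rho> = inv\<phi> ` ball 0 \<rho>"

definition P :: "complex^'n \<Rightarrow> complex" where "P z = f (inv\<phi> z)"

definition S :: "real \<Rightarrow> (complex^'n) set" where "S \<rho> = {z \<in> ball 0 \<rho>. P z \<noteq> 0}"

lemmas tc = holo_chart_topological[OF c]

lemma closed_D: "closed D"
  using rank1_local_system_open[OF L] by (simp add: closed_def)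

lemma f': "reduced_eq A D (nbh r) f" using f by (simp add: nbh_def)

context
  fixes \<rho> :: real
  assumes \<rho>: "0 < \<rho>" "\<rho> \<le> r"
begin

lemma ball_sub: "ball 0 \<rho> \<subseteq> ball (0 :: complex^'n) r" "ball 0 \<rho> \<subseteq> \<phi> ` U"
  using \<rho> r by auto

lemma \<phi>_inv: "z \<in> ball 0 \<rho> \<Longrightarrow> \<phi> (inv\<phi> z) = z" and inv_in: "z \<in> ball 0 \<rho> \<Longrightarrow> inv\<phi> z \<in> U"
  using chart_inv'[OF tc] chart_inv_in[OF tc] ball_sub by auto

lemma nbh: "open (nbh \<rho>)" "p \<in> nbh \<rho>" "nbh \<rho> \<subseteq> U" "nbh \<rho> \<subseteq> nbh r" "\<phi> ` nbh \<rho> = ball 0 \<rho>"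
proof -
  show "open (nbh \<rho>)" unfolding nbh_def by (rule chart_inv_image_open[OF tc open_ball ball_sub(2)])
  have "p = inv\<phi> 0" using chart_inv[OF tc p(1)] p(2) by simp
  then show "p \<in> nbh \<rho>" using \<rho> by (auto simp: nbh_def)
  show "nbh \<rho> \<subseteq> U" "nbh \<rho> \<subseteq> nbh r" "\<phi> ` nbh \<rho> = ball 0 \<rho>"
    using inv_in ball_sub(1) \<phi>_inv by (auto simp: nbh_def image_image)
qed

lemma inv_\<phi>: "y \<in> nbh \<rho> \<Longrightarrow> inv\<phi> (\<phi> y) = y"
  using chart_inv[OF tc] nbh(3) by blast

lemma S_image: "S \<rho> = \<phi> ` (nbh \<rho> - D)"
proof -
  have "P z \<noteq> 0 \<longleftrightarrow> inv\<phi> z \<notin> D" if "z \<in> ball 0 \<rho>" for z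
    using reduced_eqD(3)[OF f', of "inv\<phi> z"] that ball_sub by (auto simp: P_def nbh_def)
  then have "S \<rho> = {z \<in> ball 0 \<rho>. inv\<phi> z \<notin> D}" by (auto simp: S_def)
  also have "\<dots> = \<phi> ` (nbh \<rho> - D)" using nbh(5) inv_\<phi> \<phi>_inv by (force simp: nbh_def)
  finally show ?thesis .
qed

lemma S_open: "open (S \<rho>)"
  unfolding S_image by (rule chart_image_open[OF tc]) (use nbh closed_D in auto)

lemma S_ball: "S \<rho> \<subseteq> ball 0 \<rho>" by (auto simp: S_def)

lemma P_rot: "z \<in> S \<rho> \<Longrightarrow> P (rot w (of_real t) z) = exp (\<i> * of_real t) * P z"
  using f_rot[of z t] ball_sub by (auto simp: P_def S_def)

lemma S_invariant: "rot_invariant w (S \<rho>)"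
  unfolding rot_invariant_def
proof (intro ballI allI)
  fix z t assume "z \<in> S \<rho>"
  then show "rot w (of_real t) z \<in> S \<rho>" using P_rot[of z t] by (simp add: S_def)
qed

lemma P_holo: "cholo_on P (ball 0 \<rho>)"
proof -
  have "cholo_on (\<lambda>z. f (inv\<phi> z)) (\<phi> ` (U \<inter> nbh r))"
    by (rule mholo_on_chart[OF A c reduced_eqD(1)[OF f']])
  then have "cholo_on (\<lambda>z. f (inv\<phi> z)) (ball 0 \<rho>)"
  proof (rule cholo_on_subset)
    show "ball 0 \<rho> \<subseteq> \<phi> ` (U \<inter> nbh r)" unfolding nbh(5)[symmetric] using nbh(3,4) by blast
  qed simp
  then show ?thesis by (simp add: P_def[abs_def])
qed

lemma S_\<theta>: "z \<in> S \<rho> \<Longrightarrow> \<theta> (rot w (of_real t) z) (rot w (of_real t) v) = \<theta> z v"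
  "z \<in> S \<rho> \<Longrightarrow> \<theta> z (euler w z) = a"
  using \<theta>_inv[of z t v] \<theta>_euler[of z] ball_sub by (auto simp: S_def P_def)

lemma s_\<rho>: "twisted_holo_on A L s (nbh \<rho> - D)"
  by (rule twisted_holo_on_subset[OF s(1)[folded nbh_def]]) (use nbh(4) in blast)

lemmas lie_inverse_props = S_invariant T mono S_\<theta>

end

text \<open>Balls in the weighted coordinates form a neighbourhood basis at \<open>p\<close> and are
  invariant under the rotation, so every germ has a representative on a set where averaging makes
  sense.\<close>

lemma small_nbh:
  assumes "open V" "p \<in> V" "0 < \<rho>" "\<rho> \<le> r"
  obtains \<rho>' where "0 < \<rho>'" "\<rho>' \<le> \<rho>" "nbh \<rho>' \<subseteq> V"
proof -
  have "open (\<phi> ` (V \<inter> U))" "0 \<in> \<phi> ` (V \<inter> U)"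
    using chart_image_open[OF tc] chart_open_domain[OF tc] assms p by (auto intro!: image_eqI[of _ _ p])
  then obtain e where e: "0 < e" "ball 0 e \<subseteq> \<phi> ` (V \<inter> U)" using openE by blast
  have "nbh (min e \<rho>) \<subseteq> V"
  proof
    fix y assume "y \<in> nbh (min e \<rho>)"
    then obtain z where z: "z \<in> ball 0 (min e \<rho>)" "y = inv\<phi> z" by (auto simp: nbh_def)
    then obtain y' where "y' \<in> V \<inter> U" "z = \<phi> y'" using e by auto
    then show "y \<in> V" using z chart_inv[OF tc] by simp
  qed
  then show ?thesis using that[of "min e \<rho>"] e assms by auto
qed

text \<open>A section of \<open>LX\<close> is a holomorphic multiple of \<open>s\<close>, and the
  multiplier \<open>k\<close> is shifted to the form. It is kept separate because the abstract
  family \<open>\<Omega>\<close> is not assumed to be stable under multiplication by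
  functions.\<close>

lemma stalk_decompose:
  assumes "\<omega> \<in> tensor_stalk D LX p (U, \<phi>) \<Omega> j"
  obtains \<eta> \<rho> k where "\<eta> \<in> \<Omega> j" "0 < \<rho>" "\<rho> \<le> r" "cholo_on k (ball 0 \<rho>)"
    "\<And>y vs. y \<in> nbh \<rho> - D \<Longrightarrow> length vs = j \<Longrightarrow> \<omega> (\<phi> y) vs = s y * (k (\<phi> y) * \<eta> (\<phi> y) vs)"
proof -
  obtain \<eta> V s' where V: "\<eta> \<in> \<Omega> j" "open V" "p \<in> V" "V \<subseteq> U" "s' \<in> LX V"
    "\<And>y vs. y \<in> V - D \<Longrightarrow> length vs = j \<Longrightarrow> \<omega> (\<phi> y) vs = s' y * \<eta> (\<phi> y) vs"
    using assms unfolding tensor_stalk_def by auto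
  obtain \<rho> where \<rho>: "0 < \<rho>" "\<rho> \<le> r" "nbh \<rho> \<subseteq> V" using small_nbh[OF V(2,3) r(1) order_refl] by blast
  note n = nbh[OF \<rho>(1,2)]
  have "s' \<in> LX (nbh \<rho>)"
    using function_sheaf_restrict[OF LX_sheaf V(2) _ V(5) n(1) \<rho>(3)] by simp
  then obtain h where h: "mholo_on A h (nbh \<rho>)" "\<forall>y\<in>nbh \<rho> - D. s' y = h y * s y"
    using LX[OF n(1)] n(4) by (auto simp: nbh_def)
  have "U \<inter> nbh \<rho> = nbh \<rho>" using n(3) by auto
  then have "cholo_on (\<lambda>z. h (inv\<phi> z)) (ball 0 \<rho>)"
    using mholo_on_chart[OF A c h(1)] n(5) by simp
  moreover have "\<omega> (\<phi> y) vs = s y * (h (inv\<phi> (\<phi> y)) * \<eta> (\<phi> y) vs)"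
    if "y \<in> nbh \<rho> - D" "length vs = j" for y vs
    using V(6)[of y vs] h(2) that \<rho>(3) inv_\<phi>[OF \<rho>(1,2)] by auto
  ultimately show ?thesis using that[OF V(1) \<rho>(1,2)] by blast
qed

lemma nabla_twisted:
  assumes \<rho>: "0 < \<rho>" "\<rho> \<le> r" and \<eta>: "holo_form j (S \<rho>) \<eta>"
    and \<omega>: "\<And>y us. y \<in> nbh \<rho> - D \<Longrightarrow> length us = j \<Longrightarrow> \<omega> (\<phi> y) us = s y * \<eta> (\<phi> y) us"
    and y: "y \<in> nbh \<rho> - D" and len: "length vs = Suc j"
  shows "nabla D L (U, \<phi>) \<omega> (\<phi> y) vs = s y * (ext_d \<eta> (\<phi> y) vs + wedge1 (\<theta> (\<phi> y)) (\<eta> (\<phi> y)) vs)"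
proof -
  note n = nbh[OF \<rho>]
  have "nabla D L (U, \<phi>) \<omega> (\<phi> y) vs =
      s y * ext_d \<eta> (\<phi> y) vs + wedge1 (conn D L (U, \<phi>) s y) (\<eta> (\<phi> y)) vs"
    by (rule nabla_tensor[OF A L c n(1,3) s_\<rho>[OF \<rho>] \<eta>[unfolded S_image[OF \<rho>]] \<omega> y len])
  also have "wedge1 (conn D L (U, \<phi>) s y) (\<eta> (\<phi> y)) vs = wedge1 (\<lambda>v. \<theta> (\<phi> y) v * s y) (\<eta> (\<phi> y)) vs"
    using conn_s[of y] y n(4) by (intro wedge1_cong) (auto simp: nbh_def)
  finally show ?thesis by (simp add: wedge1_scale_left distrib_left)
qed

lemma s_nonzero: "\<rho> \<le> r \<Longrightarrow> 0 < \<rho> \<Longrightarrow> y \<in> nbh \<rho> - D \<Longrightarrow> s y \<noteq> 0"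
  using s(2)[of y] nbh(4)[of \<rho>] by (auto simp: nbh_def)

lemma s_LX: "0 < \<rho> \<Longrightarrow> \<rho> \<le> r \<Longrightarrow> s \<in> LX (nbh \<rho>)"
  using LX[OF nbh(1)] nbh(4) mholo_on_const[OF A nbh(1), of \<rho> 1] by (fastforce simp: nbh_def)

text \<open>The hypothesis isolates what has to be checked for each complex: the scalar form is
  holomorphic off \<open>D\<close>, and its homotopy primitive stays in the family. The second
  radius is there because closedness is known only where the cocycle condition holds, possibly on a
  smaller ball. The primitive is the same for all radii, being a pointwise integral over
  orbits.\<close>

lemma twisted_acyclic:
  assumes \<Omega>: "\<And>j \<eta> k \<rho>. \<eta> \<in> \<Omega> j \<Longrightarrow> 0 < \<rho> \<Longrightarrow> \<rho> \<le> r \<Longrightarrow> cholo_on k (ball 0 \<rho>) \<Longrightarrow>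
    \<exists>\<rho>'. 0 < \<rho>' \<and> \<rho>' \<le> \<rho> \<and> holo_form j (S \<rho>') (\<lambda>z vs. k z * \<eta> z vs) \<and>
      (\<forall>i \<rho>''. j = Suc i \<longrightarrow> 0 < \<rho>'' \<longrightarrow> \<rho>'' \<le> \<rho>' \<longrightarrow>
        (\<forall>z\<in>S \<rho>''. \<forall>vs. length vs = Suc j \<longrightarrow>
          ext_d (\<lambda>z vs. k z * \<eta> z vs) z vs + wedge1 (\<theta> z) (\<lambda>vs. k z * \<eta> z vs) vs = 0) \<longrightarrow>
        contr (euler w) (lie_inverse w T a (\<lambda>z vs. k z * \<eta> z vs)) \<in> \<Omega> i)"
  shows "acyclic_complex (zero_germ D p (U, \<phi>)) (nabla D L (U, \<phi>)) (tensor_stalk D LX p (U, \<phi>) \<Omega>)"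
  unfolding acyclic_complex_def
proof (intro allI impI)
  fix j \<omega>
  assume cocycle: "cocycle (zero_germ D p (U, \<phi>)) (nabla D L (U, \<phi>)) (tensor_stalk D LX p (U, \<phi>) \<Omega>) j \<omega>"
  then obtain V0 where V0: "open V0" "p \<in> V0" "V0 \<subseteq> U"
    "\<And>y vs. y \<in> V0 - D \<Longrightarrow> length vs = Suc j \<Longrightarrow> nabla D L (U, \<phi>) \<omega> (\<phi> y) vs = 0"
    unfolding cocycle_def zero_germ_def by auto
  have "\<omega> \<in> tensor_stalk D LX p (U, \<phi>) \<Omega> j" using cocycle by (simp add: cocycle_def)
  then obtain \<eta>0 \<rho>0 k where d: "\<eta>0 \<in> \<Omega> j" "0 < \<rho>0" "\<rho>0 \<le> r" "cholo_on k (ball 0 \<rho>0)"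
    "\<And>y vs. y \<in> nbh \<rho>0 - D \<Longrightarrow> length vs = j \<Longrightarrow> \<omega> (\<phi> y) vs = s y * (k (\<phi> y) * \<eta>0 (\<phi> y) vs)"
    using stalk_decompose by metis
  define \<eta> where "\<eta> = (\<lambda>z vs. k z * \<eta>0 z vs)"
  obtain \<rho>1 where \<rho>1: "0 < \<rho>1" "\<rho>1 \<le> \<rho>0" "holo_form j (S \<rho>1) \<eta>"
    and in\<Omega>: "\<And>i \<rho>''. j = Suc i \<Longrightarrow> 0 < \<rho>'' \<Longrightarrow> \<rho>'' \<le> \<rho>1 \<Longrightarrow>
        \<forall>z\<in>S \<rho>''. \<forall>vs. length vs = Suc j \<longrightarrow> ext_d \<eta> z vs + wedge1 (\<theta> z) (\<eta> z) vs = 0 \<Longrightarrow>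
        contr (euler w) (lie_inverse w T a \<eta>) \<in> \<Omega> i"
    using \<Omega>[OF d(1-4)] unfolding \<eta>_def by auto
  have "\<rho>1 \<le> r" using \<rho>1 d by simp
  obtain \<rho> where \<rho>: "0 < \<rho>" "\<rho> \<le> \<rho>1" "nbh \<rho> \<subseteq> V0"
    using small_nbh[OF V0(1,2) \<rho>1(1) \<open>\<rho>1 \<le> r\<close>] by blast
  have \<rho>r: "\<rho> \<le> r" using \<rho> \<open>\<rho>1 \<le> r\<close> by simp
  note n = nbh[OF \<rho>(1) \<rho>r]
  have "S \<rho> \<subseteq> S \<rho>1" using \<rho>(2) by (auto simp: S_def)
  then have \<eta>: "holo_form j (S \<rho>) \<eta>" by (rule holo_form_subset[OF \<rho>1(3) S_open[OF \<rho>(1) \<rho>r]])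
  have "nbh \<rho> \<subseteq> nbh \<rho>0" using \<rho>(2) \<rho>1(2) by (auto simp: nbh_def)
  then have \<omega>: "\<omega> (\<phi> y) vs = s y * \<eta> (\<phi> y) vs" if "y \<in> nbh \<rho> - D" "length vs = j" for y vs
    using d(5)[of y vs] that by (auto simp: \<eta>_def)
  \<comment> \<open>\<open>s\<close> has no zeros off \<open>D\<close>, so it can be cancelled and
    the cocycle condition becomes one for the scalar form under d + \<theta>.\<close>
  have closed: "ext_d \<eta> z vs + wedge1 (\<theta> z) (\<eta> z) vs = 0" if z: "z \<in> S \<rho>" and len: "length vs = Suc j" for z vs
  proof -
    obtain y where y: "y \<in> nbh \<rho> - D" "z = \<phi> y" using z S_image[OF \<rho>(1) \<rho>r] by auto
    have "s y * (ext_d \<eta> z vs + wedge1 (\<theta> z) (\<eta> z) vs) = nabla D L (U, \<phi>) \<omega> (\<phi> y) vs"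
      unfolding y(2) by (rule nabla_twisted[OF \<rho>(1) \<rho>r \<eta> \<omega> y(1) len, symmetric])
    also have "\<dots> = 0" using V0(4)[of y vs] y \<rho>(3) len by auto
    finally show ?thesis using s_nonzero[OF \<rho>r \<rho>(1) y(1)] by simp
  qed
  note hp = lie_inverse_props[OF \<rho>(1) \<rho>r]
  show "coboundary (zero_germ D p (U, \<phi>)) (nabla D L (U, \<phi>)) (tensor_stalk D LX p (U, \<phi>) \<Omega>) j \<omega>"
  proof (cases j)
    case 0
    have "\<omega> (\<phi> y) [] = 0" if y: "y \<in> nbh \<rho> - D" for y
    proof -
      have z: "\<phi> y \<in> S \<rho>" using y S_image[OF \<rho>(1) \<rho>r] by auto
      have "\<eta> (\<phi> y) [] = 0" by (rule homotopy_degree_0[OF hp \<eta> closed 0 z])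
      then show ?thesis using \<omega>[OF y, of "[]"] 0 by simp
    qed
    then have "zero_germ D p (U, \<phi>) 0 \<omega>"
      unfolding zero_germ_def using n by (auto intro!: exI[of _ "nbh \<rho>"])
    then show ?thesis using 0 by (simp add: coboundary_def)
  next
    case (Suc i)
    let ?\<zeta> = "contr (euler w) (lie_inverse w T a \<eta>)"
    define \<xi> where "\<xi> = (\<lambda>z vs. s (inv\<phi> z) * ?\<zeta> z vs)"
    have \<zeta>\<Omega>: "?\<zeta> \<in> \<Omega> i" by (rule in\<Omega>[OF Suc \<rho>(1,2)]) (use closed in blast)
    have \<xi>s: "\<xi> (\<phi> y) us = s y * ?\<zeta> (\<phi> y) us" if "y \<in> nbh \<rho> - D" for y us
      using inv_\<phi>[OF \<rho>(1) \<rho>r, of y] that by (simp add: \<xi>_def)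
    have "\<xi> \<in> tensor_stalk D LX p (U, \<phi>) \<Omega> i"
      unfolding tensor_stalk_def using \<zeta>\<Omega> n s_LX[OF \<rho>(1) \<rho>r] \<xi>s
      by (auto intro!: bexI[of _ ?\<zeta>] exI[of _ "nbh \<rho>"] exI[of _ s])
    moreover have "zero_germ D p (U, \<phi>) j (\<lambda>z vs. \<omega> z vs - nabla D L (U, \<phi>) \<xi> z vs)"
    proof -
      have "\<omega> (\<phi> y) vs - nabla D L (U, \<phi>) \<xi> (\<phi> y) vs = 0" if y: "y \<in> nbh \<rho> - D" and len: "length vs = j" for y vs
      proof -
        have z: "\<phi> y \<in> S \<rho>" using y S_image[OF \<rho>(1) \<rho>r] by auto
        have "holo_form (Suc i) (S \<rho>) (lie_inverse w T a \<eta>)"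
          using holo_form_lie_inverse[OF hp \<eta> closed] Suc by simp
        then have "holo_form i (S \<rho>) ?\<zeta>"
          by (rule holo_form_contr(1)[OF _ cholo_map_euler[OF S_open[OF \<rho>(1) \<rho>r]]])
        from nabla_twisted[OF \<rho>(1) \<rho>r this \<xi>s y, of vs] len Suc
        have "nabla D L (U, \<phi>) \<xi> (\<phi> y) vs = s y * (ext_d ?\<zeta> (\<phi> y) vs + wedge1 (\<theta> (\<phi> y)) (?\<zeta> (\<phi> y)) vs)"
          by simp
        also have "\<dots> = s y * \<eta> (\<phi> y) vs"
          by (simp only: homotopy_formula(1)[OF hp \<eta> closed Suc z len])
        finally show ?thesis using \<omega>[OF y len] by simp
      qed
      then show ?thesis unfolding zero_germ_def using n by (auto intro!: exI[of _ "nbh \<rho>"])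
    qed
    ultimately show ?thesis using Suc by (auto simp: coboundary_def)
  qed
qed

text \<open>The poles of a germ are measured by an arbitrary reduced equation \<open>g\<close>, but
  only the weighted equation transforms well under the rotation. Since \<open>f\<close> vanishes on
  \<open>D\<close> it is a multiple of \<open>g\<close> near \<open>p\<close>, so whatever
  \<open>g\<close> clears is cleared by \<open>P\<close> as well.\<close>

lemma extends_in_coordinates:
  assumes V: "p \<in> V" "V \<subseteq> U" "reduced_eq A D V g" and \<rho>: "0 < \<rho>" "\<rho> \<le> r"
  obtains \<rho>' q where "0 < \<rho>'" "\<rho>' \<le> \<rho>" "nbh \<rho>' \<subseteq> V" "cholo_on q (ball 0 \<rho>')"
    "\<And>z. z \<in> ball 0 \<rho>' \<Longrightarrow> P z = q z * g (inv\<phi> z)"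
proof -
  note n = nbh[OF r(1) order_refl]
  have "f y = 0" if "y \<in> nbh r" "y \<in> D" for y using reduced_eqD(3)[OF f'] that by auto
  from reduced_eq_divides[OF V(3,1) n(2) reduced_eqD(1)[OF f'] this]
  obtain h V' where h: "p \<in> V'" "V' \<subseteq> nbh r" "V' \<subseteq> V" "mholo_on A h V'" "\<And>y. y \<in> V' \<Longrightarrow> f y = h y * g y"
    by metis
  obtain \<rho>' where \<rho>': "0 < \<rho>'" "\<rho>' \<le> \<rho>" "nbh \<rho>' \<subseteq> V'"
    using small_nbh[OF mholo_on_open[OF h(4)] h(1) \<rho>] by blast
  have le: "\<rho>' \<le> r" using \<rho>' \<rho> by simp
  note n' = nbh[OF \<rho>'(1) le]
  have "cholo_on (\<lambda>z. h (inv\<phi> z)) (\<phi> ` (U \<inter> nbh \<rho>'))"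
    by (rule mholo_on_chart[OF A c mholo_on_subset[OF A h(4) n'(1) \<rho>'(3)]])
  moreover have "U \<inter> nbh \<rho>' = nbh \<rho>'" using n'(3) by auto
  ultimately have "cholo_on (\<lambda>z. h (inv\<phi> z)) (ball 0 \<rho>')" using n'(5) by simp
  moreover have "P z = h (inv\<phi> z) * g (inv\<phi> z)" if "z \<in> ball 0 \<rho>'" for z
  proof -
    have "inv\<phi> z \<in> V'" using that \<rho>'(3) unfolding nbh_def by blast
    then show ?thesis using h(5) by (simp add: P_def)
  qed
  ultimately show ?thesis using that \<rho>' h(3) by blast
qed

section \<open>Extension across the divisor in weighted coordinates\<close>

lemma extends_holo_coordinates:
  assumes \<rho>: "0 < \<rho>" "\<rho> \<le> r" and V: "nbh \<rho> \<subseteq> V" and \<eta>: "extends_holo D (U, \<phi>) j V g \<eta>"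
  obtains \<omega> where "holo_form j (ball 0 \<rho>) \<omega>"
    "\<And>z vs. z \<in> S \<rho> \<Longrightarrow> length vs = j \<Longrightarrow> g (inv\<phi> z) * \<eta> z vs = \<omega> z vs"
proof -
  note n = nbh[OF \<rho>]
  obtain \<omega> where \<omega>: "holo_form j (\<phi> ` V) \<omega>"
    "\<And>y vs. y \<in> V - D \<Longrightarrow> length vs = j \<Longrightarrow> g y * \<eta> (\<phi> y) vs = \<omega> (\<phi> y) vs"
    using \<eta> unfolding extends_holo_def by auto
  show ?thesis
  proof
    show "holo_form j (ball 0 \<rho>) \<omega>"
      by (rule holo_form_subset[OF \<omega>(1) open_ball]) (use V in \<open>simp add: n(5)[symmetric] image_mono\<close>)
    fix z and vs :: "(complex^'n) list" assume "z \<in> S \<rho>" "length vs = j"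
    then obtain y where y: "y \<in> nbh \<rho> - D" "z = \<phi> y" using S_image[OF \<rho>] by auto
    show "g (inv\<phi> z) * \<eta> z vs = \<omega> z vs"
      using \<omega>(2)[of y vs] y V \<open>length vs = j\<close> inv_\<phi>[OF \<rho>, of y] by auto
  qed
qed

lemma extends_holo_fromI:
  assumes \<rho>: "0 < \<rho>" "\<rho> \<le> r" and \<omega>: "holo_form j (ball 0 \<rho>) \<omega>"
    "\<And>z vs. z \<in> S \<rho> \<Longrightarrow> length vs = j \<Longrightarrow> g (inv\<phi> z) * \<eta> z vs = \<omega> z vs"
  shows "extends_holo D (U, \<phi>) j (nbh \<rho>) g \<eta>"
  unfolding extends_holo_def
proof (clarify, intro exI conjI ballI allI impI)
  note n = nbh[OF \<rho>]
  show "holo_form j (\<phi> ` nbh \<rho>) \<omega>" using \<omega>(1) n(5) by simp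
  show "g y * \<eta> (\<phi> y) vs = \<omega> (\<phi> y) vs" if "y \<in> nbh \<rho> - D" "length vs = j" for y vs
    using \<omega>(2)[of "\<phi> y" vs] S_image[OF \<rho>] inv_\<phi>[OF \<rho>, of y] that by auto
qed

lemma holo_form_from_extension:
  assumes \<rho>: "0 < \<rho>" "\<rho> \<le> r" and \<omega>: "holo_form j (ball 0 \<rho>) \<omega>"
    "\<And>z vs. z \<in> S \<rho> \<Longrightarrow> length vs = j \<Longrightarrow> P z ^ k * \<eta> z vs = \<omega> z vs"
  shows "holo_form j (S \<rho>) \<eta>"
proof (rule holo_form_cong)
  have "cholo_on (\<lambda>z. inverse (P z ^ k)) (S \<rho>)"
    by (intro cholo_on_inverse cholo_on_power cholo_on_subset[OF P_holo[OF \<rho>] S_open[OF \<rho>] S_ball[OF \<rho>]])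
      (auto simp: S_def)
  then show "holo_form j (S \<rho>) (\<lambda>z vs. inverse (P z ^ k) * \<omega> z vs)"
    by (rule holo_form_mult[OF _ holo_form_subset[OF \<omega>(1) S_open[OF \<rho>] S_ball[OF \<rho>]]])
  show "inverse (P z ^ k) * \<omega> z vs = \<eta> z vs" if "z \<in> S \<rho>" "length vs = j" for z vs
  proof -
    have "P z ^ k \<noteq> 0" using that by (simp add: S_def)
    then show ?thesis unfolding \<omega>(2)[OF that, symmetric] by simp
  qed
qed

lemma nbh_reduced: "0 < \<rho> \<Longrightarrow> \<rho> \<le> r \<Longrightarrow> reduced_eq A D (nbh \<rho>) f"
  by (rule reduced_eq_subset[OF A f']) (use nbh in auto)

lemma holo_form_ball_mult:
  "cholo_on k (ball 0 \<rho>) \<Longrightarrow> \<rho>' \<le> \<rho> \<Longrightarrow> holo_form j (ball 0 \<rho>') \<omega> \<Longrightarrow> holo_form j (ball 0 \<rho>') (\<lambda>z vs. k z * \<omega> z vs)"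
  by (rule holo_form_mult[OF cholo_on_subset]) auto

text \<open>The Euler field is holomorphic on the whole ball, so contracting the extension of the
  average extends the contraction without a further pole.\<close>

lemma contr_lie_inverse_extends:
  assumes \<rho>: "0 < \<rho>" "\<rho> \<le> r" and \<eta>: "holo_form (Suc i) (S \<rho>) \<eta>" and \<omega>: "holo_form (Suc i) (ball 0 \<rho>) \<omega>"
    "\<And>z vs. z \<in> S \<rho> \<Longrightarrow> length vs = Suc i \<Longrightarrow> P z ^ k * \<eta> z vs = \<omega> z vs"
  shows "extends_holo D (U, \<phi>) i (nbh \<rho>) (\<lambda>y. f y ^ k) (contr (euler w) (lie_inverse w T a \<eta>))"
proof -
  note hp = lie_inverse_props[OF \<rho>]
  obtain \<omega>' where \<omega>': "holo_form (Suc i) (ball 0 \<rho>) \<omega>'"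
    "\<forall>z\<in>S \<rho>. \<forall>vs. length vs = Suc i \<longrightarrow> P z ^ k * lie_inverse w T a \<eta> z vs = \<omega>' z vs"
    using lie_inverse_extends[OF hp \<eta> rot_invariant_ball S_ball[OF \<rho>] \<omega>(1) P_rot[OF \<rho>] \<omega>(2)] by blast
  show ?thesis
  proof (rule extends_holo_fromI[OF \<rho>])
    show "holo_form i (ball 0 \<rho>) (contr (euler w) \<omega>')"
      by (rule holo_form_contr(1)[OF \<omega>'(1) cholo_map_euler[OF open_ball]])
    show "f (inv\<phi> z) ^ k * contr (euler w) (lie_inverse w T a \<eta>) z vs = contr (euler w) \<omega>' z vs"
      if "z \<in> S \<rho>" "length vs = i" for z vs
      using \<omega>'(2)[rule_format, of z "euler w z # vs"] that by (simp add: contr_def P_def)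
  qed
qed

lemma mero_acyclic:
  "acyclic_complex (zero_germ D p (U, \<phi>)) (nabla D L (U, \<phi>)) (mero_stalk A D LX p (U, \<phi>))"
  unfolding mero_stalk_def
proof (rule twisted_acyclic)
  fix j \<eta> \<rho> and k :: "complex^'n \<Rightarrow> complex"
  assume \<eta>: "\<eta> \<in> mero_forms A D p (U, \<phi>) j" and \<rho>: "0 < \<rho>" "\<rho> \<le> r" and k: "cholo_on k (ball 0 \<rho>)"
  obtain V g m where V: "p \<in> V" "V \<subseteq> U" "reduced_eq A D V g" "extends_holo D (U, \<phi>) j V (\<lambda>y. g y ^ m) \<eta>"
    using \<eta> unfolding mero_forms_def by auto
  obtain \<rho>' q where \<rho>': "0 < \<rho>'" "\<rho>' \<le> \<rho>" "nbh \<rho>' \<subseteq> V" and q: "cholo_on q (ball 0 \<rho>')"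
    "\<And>z. z \<in> ball 0 \<rho>' \<Longrightarrow> P z = q z * g (inv\<phi> z)"
    using extends_in_coordinates[OF V(1-3) \<rho>] by blast
  have le: "\<rho>' \<le> r" using \<rho> \<rho>' by simp
  obtain \<omega>0 where \<omega>0: "holo_form j (ball 0 \<rho>') \<omega>0"
    "\<And>z vs. z \<in> S \<rho>' \<Longrightarrow> length vs = j \<Longrightarrow> g (inv\<phi> z) ^ m * \<eta> z vs = \<omega>0 z vs"
    using extends_holo_coordinates[OF \<rho>'(1) le \<rho>'(3) V(4)] by metis
  \<comment> \<open>From P = q g follows P ^ m (k \<eta>) = k q ^ m (g ^ m \<eta>), and g ^ m \<eta>
    extends by assumption.\<close>
  define \<omega> where "\<omega> = (\<lambda>z vs. k z * (q z ^ m * \<omega>0 z vs))"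
  have \<omega>: "holo_form j (ball 0 \<rho>') \<omega>" unfolding \<omega>_def
    by (intro holo_form_ball_mult[OF k \<rho>'(2)] holo_form_mult[OF cholo_on_power[OF q(1)]] \<omega>0(1))
  have ext: "P z ^ m * (k z * \<eta> z vs) = \<omega> z vs" if "z \<in> S \<rho>'" "length vs = j" for z vs
    using q(2)[of z] \<omega>0(2)[OF that, symmetric] that(1) by (simp add: \<omega>_def S_def power_mult_distrib)
  have holo: "holo_form j (S \<rho>') (\<lambda>z vs. k z * \<eta> z vs)"
    by (rule holo_form_from_extension[OF \<rho>'(1) le \<omega> ext])
  have "contr (euler w) (lie_inverse w T a (\<lambda>z vs. k z * \<eta> z vs)) \<in> mero_forms A D p (U, \<phi>) i" if j: "j = Suc i" for i
  proof -
    have "extends_holo D (U, \<phi>) i (nbh \<rho>') (\<lambda>y. f y ^ m) (contr (euler w) (lie_inverse w T a (\<lambda>z vs. k z * \<eta> z vs)))"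
      by (rule contr_lie_inverse_extends[OF \<rho>'(1) le holo[unfolded j] \<omega>[unfolded j]]) (use ext j in auto)
    then show ?thesis unfolding mero_forms_def
      using nbh[OF \<rho>'(1) le] nbh_reduced[OF \<rho>'(1) le] by auto
  qed
  then show "\<exists>\<rho>'. 0 < \<rho>' \<and> \<rho>' \<le> \<rho> \<and> holo_form j (S \<rho>') (\<lambda>z vs. k z * \<eta> z vs) \<and>
      (\<forall>i \<rho>''. j = Suc i \<longrightarrow> 0 < \<rho>'' \<longrightarrow> \<rho>'' \<le> \<rho>' \<longrightarrow>
        (\<forall>z\<in>S \<rho>''. \<forall>vs. length vs = Suc j \<longrightarrow>
          ext_d (\<lambda>z vs. k z * \<eta> z vs) z vs + wedge1 (\<theta> z) (\<lambda>vs. k z * \<eta> z vs) vs = 0) \<longrightarrow>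
        contr (euler w) (lie_inverse w T a (\<lambda>z vs. k z * \<eta> z vs)) \<in> mero_forms A D p (U, \<phi>) i)"
    using \<rho>' holo by blast
qed

lemma log_acyclic:
  "acyclic_complex (zero_germ D p (U, \<phi>)) (nabla D L (U, \<phi>)) (log_stalk A D LX p (U, \<phi>))"
  unfolding log_stalk_def
proof (rule twisted_acyclic)
  fix j \<eta> \<rho> and k :: "complex^'n \<Rightarrow> complex"
  assume \<eta>: "\<eta> \<in> log_forms A D p (U, \<phi>) j" and \<rho>: "0 < \<rho>" "\<rho> \<le> r" and k: "cholo_on k (ball 0 \<rho>)"
  obtain V g where V: "p \<in> V" "V \<subseteq> U" "reduced_eq A D V g" "extends_holo D (U, \<phi>) j V g \<eta>"
    "extends_holo D (U, \<phi>) (Suc j) V g (ext_d \<eta>)"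
    using \<eta> unfolding log_forms_def by auto
  obtain \<rho>1 q where \<rho>1: "0 < \<rho>1" "\<rho>1 \<le> \<rho>" "nbh \<rho>1 \<subseteq> V" and q: "cholo_on q (ball 0 \<rho>1)"
    "\<And>z. z \<in> ball 0 \<rho>1 \<Longrightarrow> P z = q z * g (inv\<phi> z)"
    using extends_in_coordinates[OF V(1-3) \<rho>] by blast
  have le1: "\<rho>1 \<le> r" using \<rho> \<rho>1 by simp
  let ?\<eta> = "\<lambda>z vs. k z * \<eta> z vs"
  obtain \<omega>0 where \<omega>0: "holo_form j (ball 0 \<rho>1) \<omega>0"
    "\<And>z vs. z \<in> S \<rho>1 \<Longrightarrow> length vs = j \<Longrightarrow> g (inv\<phi> z) * \<eta> z vs = \<omega>0 z vs"
    using extends_holo_coordinates[OF \<rho>1(1) le1 \<rho>1(3) V(4)] by metis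
  obtain \<omega>1 where \<omega>1: "holo_form (Suc j) (ball 0 \<rho>1) \<omega>1"
    "\<And>z vs. z \<in> S \<rho>1 \<Longrightarrow> length vs = Suc j \<Longrightarrow> g (inv\<phi> z) * ext_d \<eta> z vs = \<omega>1 z vs"
    using extends_holo_coordinates[OF \<rho>1(1) le1 \<rho>1(3) V(5)] by metis
  have k1: "cholo_on k (ball 0 \<rho>1)" by (rule cholo_on_subset[OF k]) (use \<rho>1 in auto)
  have q\<omega>0: "holo_form j (ball 0 \<rho>1) (\<lambda>z vs. q z * \<omega>0 z vs)" by (rule holo_form_mult[OF q(1) \<omega>0(1)])
  have ext0: "P z * \<eta> z vs = q z * \<omega>0 z vs" if "z \<in> S \<rho>1" "length vs = j" for z vs
    using q(2)[of z] \<omega>0(2)[OF that, symmetric] that(1) by (simp add: S_def)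
  have ext1: "P z * ext_d \<eta> z vs = q z * \<omega>1 z vs" if "z \<in> S \<rho>1" "length vs = Suc j" for z vs
    using q(2)[of z] \<omega>1(2)[OF that, symmetric] that(1) by (simp add: S_def)
  have holo0: "holo_form j (S \<rho>1) \<eta>"
    by (rule holo_form_from_extension[OF \<rho>1(1) le1 q\<omega>0, where k = 1]) (simp add: ext0)
  define \<omega> where "\<omega> = (\<lambda>z vs. k z * (q z * \<omega>0 z vs))"
  \<comment> \<open>Leibniz: d (k \<eta>) is k d \<eta> plus the product of dk with \<eta>. After
    multiplication by \<open>P\<close> both summands extend, so a holomorphic multiple of a
    logarithmic form is again logarithmic.\<close>
  define \<omega>' where "\<omega>' = (\<lambda>z vs. k z * (q z * \<omega>1 z vs) + wedge1 (fd k z) (\<lambda>us. q z * \<omega>0 z us) vs)"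
  have \<omega>: "holo_form j (ball 0 \<rho>1) \<omega>" unfolding \<omega>_def by (rule holo_form_mult[OF k1 q\<omega>0])
  have \<omega>': "holo_form (Suc j) (ball 0 \<rho>1) \<omega>'" unfolding \<omega>'_def
    by (intro holo_form_add holo_form_mult[OF k1] holo_form_mult[OF q(1)] \<omega>1(1) holo_form_wedge1[OF k1 q\<omega>0])
  have ext: "P z * (k z * \<eta> z vs) = \<omega> z vs" if "z \<in> S \<rho>1" "length vs = j" for z vs
    using ext0[OF that] by (simp add: \<omega>_def)
  have kS: "cholo_on k (S \<rho>1)" by (rule cholo_on_subset[OF k1 S_open[OF \<rho>1(1) le1] S_ball[OF \<rho>1(1) le1]])
  have ext': "P z * ext_d ?\<eta> z vs = \<omega>' z vs" if z: "z \<in> S \<rho>1" and len: "length vs = Suc j" for z vs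
  proof -
    have "wedge1 (fd k z) (\<lambda>us. q z * \<omega>0 z us) vs = wedge1 (fd k z) (\<lambda>us. P z * \<eta> z us) vs"
      using ext0[OF z] len by (intro wedge1_cong) auto
    then show ?thesis
      unfolding ext_d_mult[OF kS holo0 z len] \<omega>'_def
      using ext1[OF z len] by (simp add: wedge1_scale distrib_left)
  qed
  have holo: "holo_form j (S \<rho>1) ?\<eta>" by (rule holo_form_mult[OF kS holo0])
  have mem: "contr (euler w) (lie_inverse w T a ?\<eta>) \<in> log_forms A D p (U, \<phi>) i"
    if j: "j = Suc i" and \<rho>2: "0 < \<rho>2" "\<rho>2 \<le> \<rho>1"
      and closed: "\<forall>z\<in>S \<rho>2. \<forall>vs. length vs = Suc j \<longrightarrow> ext_d ?\<eta> z vs + wedge1 (\<theta> z) (?\<eta> z) vs = 0" for i \<rho>2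
  proof -
    have le2: "\<rho>2 \<le> r" using \<rho>2 le1 by simp
    note hp = lie_inverse_props[OF \<rho>2(1) le2]
    have sub: "S \<rho>2 \<subseteq> S \<rho>1" "ball (0 :: complex^'n) \<rho>2 \<subseteq> ball 0 \<rho>1"
      using \<rho>2 by (auto simp: S_def)
    let ?B = "lie_inverse w T a ?\<eta>"
    have holo2: "holo_form j (S \<rho>2) ?\<eta>" by (rule holo_form_subset[OF holo S_open[OF \<rho>2(1) le2] sub(1)])
    have \<omega>2: "holo_form j (ball 0 \<rho>2) \<omega>" by (rule holo_form_subset[OF \<omega> open_ball sub(2)])
    have \<omega>2': "holo_form (Suc j) (ball 0 \<rho>2) \<omega>'" by (rule holo_form_subset[OF \<omega>' open_ball sub(2)])
    have ext2: "P z ^ 1 * ?\<eta> z vs = \<omega> z vs" if "z \<in> S \<rho>2" "length vs = j" for z vs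
      using ext[of z vs] sub that by auto
    have ext2': "P z * ext_d ?\<eta> z vs = \<omega>' z vs" if "z \<in> S \<rho>2" "length vs = Suc j" for z vs
      using ext'[of z vs] sub that by auto
    have "extends_holo D (U, \<phi>) i (nbh \<rho>2) (\<lambda>y. f y ^ 1) (contr (euler w) ?B)"
      by (rule contr_lie_inverse_extends[OF \<rho>2(1) le2 holo2[unfolded j] \<omega>2[unfolded j]]) (use ext2 j in auto)
    then have 1: "extends_holo D (U, \<phi>) i (nbh \<rho>2) f (contr (euler w) ?B)" by simp
    obtain \<omega>3 where \<omega>3: "holo_form j (ball 0 \<rho>2) \<omega>3"
      "\<forall>z\<in>S \<rho>2. \<forall>vs. length vs = j \<longrightarrow> P z ^ 1 * ?B z vs = \<omega>3 z vs"
      using lie_inverse_extends[OF hp holo2 rot_invariant_ball S_ball[OF \<rho>2(1) le2] \<omega>2 P_rot[OF \<rho>2(1) le2] ext2] by blast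
    obtain \<omega>4 where \<omega>4: "holo_form (Suc j) (ball 0 \<rho>2) \<omega>4"
      "\<forall>z\<in>S \<rho>2. \<forall>vs. length vs = Suc j \<longrightarrow> P z * ext_d ?B z vs = \<omega>4 z vs"
      using lie_inverse_ext_d_extends[OF hp holo2 rot_invariant_ball S_ball[OF \<rho>2(1) le2] \<omega>2' P_rot[OF \<rho>2(1) le2] ext2'] by blast
    \<comment> \<open>By Cartan's formula the derivative of the primitive is \<eta> - a B - \<iota>
      dB with the scaled form as \<eta>, and each summand extends after one multiplication by
      \<open>P\<close>. The other expression for it, through \<theta>, would bring in the poles of
      \<theta> on top of those of B.\<close>
    have 2: "extends_holo D (U, \<phi>) (Suc i) (nbh \<rho>2) f (ext_d (contr (euler w) ?B))"
    proof (rule extends_holo_fromI[OF \<rho>2(1) le2])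
      show "holo_form (Suc i) (ball 0 \<rho>2) (\<lambda>z vs. (\<omega> z vs + (- a) * \<omega>3 z vs) + (- 1) * contr (euler w) \<omega>4 z vs)"
        using \<omega>2 \<omega>3(1) holo_form_contr(1)[OF \<omega>4(1) cholo_map_euler[OF open_ball]] unfolding j
        by (intro holo_form_add holo_form_scale)
      fix z and vs :: "(complex^'n) list" assume z: "z \<in> S \<rho>2" and len: "length vs = Suc i"
      have len': "length vs = j" using len j by simp
      have "ext_d (contr (euler w) ?B) z vs = ?\<eta> z vs - a * ?B z vs - contr (euler w) (ext_d ?B) z vs"
        by (rule homotopy_formula(2)[OF hp holo2 closed[rule_format] j z len'])
      then have "P z * ext_d (contr (euler w) ?B) z vs =
          P z ^ 1 * ?\<eta> z vs - a * (P z ^ 1 * ?B z vs) - P z * contr (euler w) (ext_d ?B) z vs"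
        by (simp only: right_diff_distrib power_one_right mult.left_commute[of "P z" a])
      also have "P z ^ 1 * ?\<eta> z vs = \<omega> z vs" by (rule ext2[OF z len'])
      also have "P z ^ 1 * ?B z vs = \<omega>3 z vs" using \<omega>3(2) z len' by blast
      also have "P z * contr (euler w) (ext_d ?B) z vs = contr (euler w) \<omega>4 z vs"
        using \<omega>4(2)[rule_format, OF z, of "euler w z # vs"] len' by (simp add: contr_def)
      finally show "f (inv\<phi> z) * ext_d (contr (euler w) ?B) z vs =
          (\<omega> z vs + (- a) * \<omega>3 z vs) + (- 1) * contr (euler w) \<omega>4 z vs"
        by (simp add: P_def)
    qed
    show ?thesis unfolding log_forms_def
      using nbh[OF \<rho>2(1) le2] nbh_reduced[OF \<rho>2(1) le2] 1 2 by auto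
  qed
  show "\<exists>\<rho>'. 0 < \<rho>' \<and> \<rho>' \<le> \<rho> \<and> holo_form j (S \<rho>') (\<lambda>z vs. k z * \<eta> z vs) \<and>
      (\<forall>i \<rho>''. j = Suc i \<longrightarrow> 0 < \<rho>'' \<longrightarrow> \<rho>'' \<le> \<rho>' \<longrightarrow>
        (\<forall>z\<in>S \<rho>''. \<forall>vs. length vs = Suc j \<longrightarrow>
          ext_d (\<lambda>z vs. k z * \<eta> z vs) z vs + wedge1 (\<theta> z) (\<lambda>vs. k z * \<eta> z vs) vs = 0) \<longrightarrow>
        contr (euler w) (lie_inverse w T a (\<lambda>z vs. k z * \<eta> z vs)) \<in> log_forms A D p (U, \<phi>) i)"
    using \<rho>1 holo mem by blast
qed

end


section \<open>Weighted homogeneity and the period of the action\<close>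

lemma of_real_of_rat: "complex_of_real (real_of_rat q) = of_rat q"
  by (cases q) (simp add: of_rat_rat)

text \<open>The product of all denominators is a positive common multiple, so the minimum is taken
  over a nonempty set.\<close>

lemma weight_denominator:
  fixes w :: "'n::finite \<Rightarrow> rat"
  shows "0 < weight_denominator w" "of_nat (weight_denominator w) * w i \<in> \<int>"
proof -
  define b where "b = (\<lambda>i. nat (snd (quotient_of (w i))))"
  have b: "0 < b i" "of_nat (b i) * w i \<in> \<int>" for i
  proof -
    obtain n d where q: "quotient_of (w i) = (n, d)" by force
    have d: "0 < d" using quotient_of_denom_pos[OF q] .
    then show "0 < b i" by (simp add: b_def q)
    have bd: "of_nat (b i) = (of_int d :: rat)" using d by (simp add: b_def q)
    have "of_nat (b i) * w i = of_int n"
      unfolding bd quotient_of_div[OF q] using d by simp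
    then show "of_nat (b i) * w i \<in> \<int>" by simp
  qed
  have "0 < (\<Prod>i\<in>UNIV. b i) \<and> (\<forall>i. of_nat (\<Prod>i\<in>UNIV. b i) * w i \<in> \<int>)"
  proof (intro conjI allI)
    show "0 < (\<Prod>i\<in>UNIV. b i)" using b(1) by (simp add: prod_pos)
    fix i
    have "of_nat (\<Prod>i\<in>UNIV. b i) * w i = of_nat (\<Prod>i\<in>UNIV - {i}. b i) * (of_nat (b i) * w i)"
      by (simp add: prod.remove[of UNIV i] mult_ac)
    then show "of_nat (\<Prod>i\<in>UNIV. b i) * w i \<in> \<int>"
      using Ints_mult[OF Ints_of_nat b(2)] by metis
  qed
  then have "0 < weight_denominator w \<and> (\<forall>i. of_nat (weight_denominator w) * w i \<in> \<int>)"
    unfolding weight_denominator_def by (rule LeastI)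
  then show "0 < weight_denominator w" "of_nat (weight_denominator w) * w i \<in> \<int>" by auto
qed

lemma rot_period:
  fixes w :: "'n::finite \<Rightarrow> rat"
  shows "rot (\<lambda>i. real_of_rat (w i)) (of_real (2 * pi * weight_denominator w)) z = z"
proof -
  have "exp (\<i> * of_real (real_of_rat (w i)) * of_real (2 * pi * weight_denominator w)) = 1" for i
  proof -
    obtain k where k: "of_nat (weight_denominator w) * w i = of_int k"
      using weight_denominator(2)[of w i] by (auto elim: Ints_cases)
    then have "(of_rat (of_nat (weight_denominator w) * w i) :: complex) = of_rat (of_int k)" by simp
    then have "of_nat (weight_denominator w) * of_rat (w i) = (of_int k :: complex)"
      by (simp add: of_rat_mult)
    then have "\<i> * of_real (real_of_rat (w i)) * of_real (2 * pi * weight_denominator w) =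
        0 + of_real (of_int (2 * k) * pi) * \<i>"
      by (simp add: of_real_of_rat algebra_simps)
    then have "exp (\<i> * of_real (real_of_rat (w i)) * of_real (2 * pi * weight_denominator w)) = exp 0"
      unfolding exp_eq by blast
    then show ?thesis by simp
  qed
  then show ?thesis by (simp add: vec_eq_iff)
qed

lemma period_monodromy:
  assumes "of_nat e * a \<notin> \<int>"
  shows "exp (\<i> * a * of_real (2 * pi * real e)) \<noteq> 1"
proof
  assume "exp (\<i> * a * of_real (2 * pi * real e)) = 1"
  then obtain n :: int where "\<i> * a * of_real (2 * pi * real e) = 0 + of_int (2 * n) * of_real pi * \<i>"
    using exp_eq[of "\<i> * a * of_real (2 * pi * real e)" 0] by auto
  then have "(2 * of_real pi * \<i>) * (of_nat e * a) = (2 * of_real pi * \<i>) * of_int n"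
    by (simp add: algebra_simps)
  then have "of_nat e * a = of_int n" by (simp add: mult_left_cancel)
  then show False using assms by simp
qed

text \<open>Each monomial is multiplied by the exponential of i t times its weighted degree, and all
  these degrees are 1.\<close>

lemma weighted_homogeneous_rot:
  fixes w :: "'n::finite \<Rightarrow> rat"
  assumes "\<And>\<nu>. \<nu> \<in> S \<Longrightarrow> (\<Sum>i\<in>UNIV. w i * of_nat (\<nu> i)) = 1"
  shows "(\<Sum>\<nu>\<in>S. a \<nu> * (\<Prod>i\<in>UNIV. (rot (\<lambda>i. real_of_rat (w i)) t z $ i) ^ \<nu> i)) =
    exp (\<i> * t) * (\<Sum>\<nu>\<in>S. a \<nu> * (\<Prod>i\<in>UNIV. (z $ i) ^ \<nu> i))"
  unfolding sum_distrib_left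
proof (rule sum.cong[OF refl])
  fix \<nu> assume \<nu>: "\<nu> \<in> S"
  have "(\<Sum>i\<in>UNIV. of_rat (w i) * of_nat (\<nu> i)) = (of_rat (\<Sum>i\<in>UNIV. w i * of_nat (\<nu> i)) :: complex)"
    by (simp add: of_rat_sum of_rat_mult)
  then have 1: "(\<Sum>i\<in>UNIV. of_rat (w i) * of_nat (\<nu> i)) = (1 :: complex)" by (simp add: assms[OF \<nu>])
  have "(\<Prod>i\<in>UNIV. exp (\<i> * of_real (real_of_rat (w i)) * t) ^ \<nu> i) =
      exp (\<Sum>i\<in>UNIV. \<i> * t * (of_rat (w i) * of_nat (\<nu> i)))"
    by (simp add: exp_sum exp_of_nat_mult[symmetric] of_real_of_rat mult_ac)
  also have "\<dots> = exp (\<i> * t)" by (simp add: sum_distrib_left[symmetric] 1)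
  finally show "a \<nu> * (\<Prod>i\<in>UNIV. (rot (\<lambda>i. real_of_rat (w i)) t z $ i) ^ \<nu> i) =
      exp (\<i> * t) * (a \<nu> * (\<Prod>i\<in>UNIV. (z $ i) ^ \<nu> i))"
    by (simp add: power_mult_distrib prod.distrib)
qed

text \<open>The local factors are holomorphic germs rather than explicit polynomials, so their
  transformation rule has to come from the Euler equation: exp (- i d t) F
  (\<open>rot w t z\<close>) has derivative zero in \<open>t\<close>. On a ball the whole orbit
  stays in the domain.\<close>

lemma euler_eigenfunction_rot:
  assumes F: "cholo_on F (ball 0 r)" and d: "\<And>z. z \<in> ball 0 r \<Longrightarrow> fd F z (euler w z) = d * F z"
    and z: "z \<in> ball 0 r"
  shows "F (rot w (of_real t) z) = exp (\<i> * d * of_real t) * F z"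
proof -
  define h where "h = (\<lambda>t. exp (- (\<i> * d * t)) * F (rot w t z))"
  have zr: "rot w (of_real t) z \<in> ball 0 r" for t using z by simp
  have hol: "holo_form 0 (ball 0 r) (\<lambda>z vs. F z)"
    using F by (auto simp: holo_form_def alternating_def)
  have "(h has_field_derivative 0) (at (of_real t))" for t
  proof -
    have "((\<lambda>t. F (rot w t z)) has_field_derivative \<i> * (d * F (rot w (of_real t) z))) (at (of_real t))"
      using has_field_derivative_rot_form[OF hol, of "[]" w "of_real t" z] zr d[OF zr] by (simp add: lie_def)
    then show ?thesis unfolding h_def
      by (auto intro!: derivative_eq_intros)
  qed
  then have "((\<lambda>t. h (of_real t)) has_vector_derivative 0) (at t within UNIV)" for t
    using has_vector_derivative_real_field by blast
  then have "\<exists>k. \<forall>t\<in>UNIV. h (of_real t) = k"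
    by (intro has_derivative_zero_constant) (auto simp: has_vector_derivative_def)
  then obtain k where k: "\<And>t::real. h (of_real t) = k" by blast
  have "h (of_real t) = h (of_real 0)" unfolding k ..
  then show ?thesis by (simp add: h_def exp_minus field_simps)
qed

section \<open>Logarithmic derivatives and differentials in two charts\<close>

lemma fd_prod_log:
  assumes "finite K" "z \<in> S" "open S" "\<And>k. k \<in> K \<Longrightarrow> cholo_on (F k) S" "\<And>k. k \<in> K \<Longrightarrow> F k z \<noteq> 0"
  shows "fd (\<lambda>z. \<Prod>k\<in>K. F k z) z v = (\<Prod>k\<in>K. F k z) * (\<Sum>k\<in>K. fd (F k) z v / F k z)"
  using assms(1,4,5)
proof (induction K)
  case (insert k K)
  have "fd (\<lambda>z. F k z * (\<Prod>k\<in>K. F k z)) z v =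
      F k z * fd (\<lambda>z. \<Prod>k\<in>K. F k z) z v + fd (F k) z v * (\<Prod>k\<in>K. F k z)"
    by (rule fd_mult[OF _ cholo_on_prod[OF assms(3)] assms(2)]) (use insert in auto)
  then show ?case using insert by (simp add: algebra_simps)
qed simp

lemma fd_chart_change:
  assumes A: "complex_manifold A" and c: "holo_chart A (U, \<phi>)" and c': "holo_chart A (V, \<psi>)"
    and h: "mholo_on A h W" and y: "y \<in> U" "y \<in> V" "y \<in> W"
  shows "fd (\<lambda>z. h (inv_into U \<phi> z)) (\<phi> y) (frechet_derivative (transition (U, \<phi>) (V, \<psi>)) (at (\<psi> y)) v) =
    fd (\<lambda>z. h (inv_into V \<psi> z)) (\<psi> y) v"
proof -
  note tc = holo_chart_topological[OF c] and tc' = holo_chart_topological[OF c']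
  have G: "transition (U, \<phi>) (V, \<psi>) (\<psi> y) = \<phi> y" if "y \<in> V" for y
    using chart_inv[OF tc' that] by (simp add: transition_def)
  have o: "open (\<psi> ` (V \<inter> U))"
    by (rule chart_image_open[OF tc']) (use chart_open_domain[OF tc] chart_open_domain[OF tc'] in auto)
  have "fd (\<lambda>z. h (inv_into V \<psi> z)) (\<psi> y) v = fd (\<lambda>z. h (inv_into U \<phi> (transition (U, \<phi>) (V, \<psi>) z))) (\<psi> y) v"
    by (subst fd_cong[OF o]) (use y in \<open>auto simp: G chart_inv[OF tc] chart_inv[OF tc']\<close>)
  also have "\<dots> = fd (\<lambda>z. h (inv_into U \<phi> z)) (transition (U, \<phi>) (V, \<psi>) (\<psi> y))
      (frechet_derivative (transition (U, \<phi>) (V, \<psi>)) (at (\<psi> y)) v)"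
    by (rule fd_compose[OF mholo_on_chart[OF A c h] _ cholo_map_transition[OF A c' c]])
      (use y in \<open>auto simp: G\<close>)
  finally show ?thesis using y by (simp add: G)
qed


section \<open>The generator with logarithmic connection form\<close>

lemma residue_extension_at:
  assumes "residue_extension A D L \<alpha> LX"
  obtains V \<sigma> g where "open V" "q \<in> V" "twisted_holo_on A L \<sigma> (V - D)" "\<And>y. y \<in> V - D \<Longrightarrow> \<sigma> y \<noteq> 0"
    "finite {C \<in> irr_components A D. C \<inter> V \<noteq> {}}"
    "\<And>C. C \<in> irr_components A D \<Longrightarrow> C \<inter> V \<noteq> {} \<Longrightarrow> reduced_eq A C V (g C)"
    "\<And>U \<phi> y v. (U, \<phi>) \<in> A \<Longrightarrow> y \<in> U \<inter> V - D \<Longrightarrow> conn D L (U, \<phi>) \<sigma> y v =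
       (\<Sum>C | C \<in> irr_components A D \<and> C \<inter> V \<noteq> {}.
          \<alpha> C * fd (\<lambda>z. g C (inv_into U \<phi> z)) (\<phi> y) v / g C y) * \<sigma> y"
    "\<And>W. open W \<Longrightarrow> W \<subseteq> V \<Longrightarrow> LX W = {s. \<exists>h. mholo_on A h W \<and> (\<forall>y\<in>W - D. s y = h y * \<sigma> y)}"
proof -
  obtain V \<sigma> g where V: "open V" "q \<in> V" "twisted_holo_on A L \<sigma> (V - D)" "\<forall>y\<in>V - D. \<sigma> y \<noteq> 0"
    "finite {C \<in> irr_components A D. C \<inter> V \<noteq> {}}"
    "\<forall>C\<in>irr_components A D. C \<inter> V \<noteq> {} \<longrightarrow> reduced_eq A C V (g C)"
    and conn: "\<forall>(U, \<phi>)\<in>A. \<forall>y\<in>U \<inter> V - D. \<forall>v.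
           nabla D L (U, \<phi>) (\<lambda>z us. \<sigma> (inv_into U \<phi> z)) (\<phi> y) [v] =
           (\<Sum>C | C \<in> irr_components A D \<and> C \<inter> V \<noteq> {}.
              \<alpha> C * frechet_derivative (\<lambda>z. g C (inv_into U \<phi> z)) (at (\<phi> y)) v / g C y) * \<sigma> y"
    and LX: "\<forall>W. open W \<and> W \<subseteq> V \<longrightarrow> LX W = {s. \<exists>h. mholo_on A h W \<and> (\<forall>y\<in>W - D. s y = h y * \<sigma> y)}"
    using assms[unfolded residue_extension_def, THEN conjunct2, THEN spec, of q]
    by (elim exE conjE) (rule that)
  show ?thesis
  proof (rule that[OF V(1-3) _ V(5)])
    show "conn D L (U, \<phi>) \<sigma> y v =
       (\<Sum>C | C \<in> irr_components A D \<and> C \<inter> V \<noteq> {}.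
          \<alpha> C * fd (\<lambda>z. g C (inv_into U \<phi> z)) (\<phi> y) v / g C y) * \<sigma> y"
      if "(U, \<phi>) \<in> A" "y \<in> U \<inter> V - D" for U \<phi> y v
      using conn that unfolding conn_def fst_conv snd_conv by blast
    show "LX W = {s. \<exists>h. mholo_on A h W \<and> (\<forall>y\<in>W - D. s y = h y * \<sigma> y)}" if "open W" "W \<subseteq> V" for W
      using LX[rule_format, of W] that by simp
  qed (use V in auto)
qed

lemma residue_extension_twisted_holo:
  assumes A: "complex_manifold A" and res: "residue_extension A D L \<alpha> LX"
    and V: "open V" "p \<in> V" "s \<in> LX V"
  shows "\<exists>V'. open V' \<and> p \<in> V' \<and> V' \<subseteq> V \<and> twisted_holo_on A L s (V' - D)"
proof -
  obtain V0 \<sigma> g where V0: "open V0" "p \<in> V0" "twisted_holo_on A L \<sigma> (V0 - D)"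
    "\<And>W. open W \<Longrightarrow> W \<subseteq> V0 \<Longrightarrow> LX W = {s. \<exists>h. mholo_on A h W \<and> (\<forall>y\<in>W - D. s y = h y * \<sigma> y)}"
    by (rule residue_extension_at[OF res, of p]) (rule that)
  have o: "open (V \<inter> V0)" using V V0 by auto
  have sheaf: "function_sheaf UNIV (- D) LX" using res by (simp add: residue_extension_def)
  have "s \<in> LX (V \<inter> V0)" by (rule function_sheaf_restrict[OF sheaf V(1) _ V(3) o]) auto
  then obtain h where h: "mholo_on A h (V \<inter> V0)" "\<forall>y\<in>V \<inter> V0 - D. s y = h y * \<sigma> y"
    using V0(4)[OF o] by auto
  have "mholo_on A (\<lambda>y. s y / e y) W"
    if W: "open W" "W \<subseteq> V \<inter> V0 - D" "e \<in> L W" "\<forall>y\<in>W. e y \<noteq> 0" for W e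
  proof -
    have "mholo_on A (\<lambda>y. \<sigma> y / e y) W" using V0(3) W unfolding twisted_holo_on_def by blast
    moreover have "mholo_on A h W" by (rule mholo_on_subset[OF A h(1) W(1)]) (use W in auto)
    ultimately have "mholo_on A (\<lambda>y. h y * (\<sigma> y / e y)) W" by (intro mholo_on_mult)
    then show ?thesis by (rule mholo_on_cong[OF A]) (use h(2) W in auto)
  qed
  then have "twisted_holo_on A L s (V \<inter> V0 - D)" unfolding twisted_holo_on_def by blast
  then show ?thesis using o V V0 by (intro exI[of _ "V \<inter> V0"]) auto
qed

text \<open>The given generator \<sigma> has connection form \<Sum> \<alpha> C dg / g with g the
  equations of the components. Since \<open>factor C\<close> is a unit times g, multiplying \<sigma>
  by the powers of these units with exponents \<open>\<alpha> C\<close> replaces g by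
  \<open>factor C\<close>. The logarithmic derivative of \<open>factor C\<close> splits over its
  branches, and their behaviour under the Euler field is known.\<close>

lemma twisted_chart_exists:
  fixes A :: "('a::t2_space, 'n::finite) chart set" and comp :: "nat \<Rightarrow> 'a set"
  assumes A: "complex_manifold A" and D: "reduced_divisor A D" and L: "rank1_local_system (- D) L"
    and res: "residue_extension A D L \<alpha> LX" and pD: "p \<in> D"
    and wh: "weighted_homogeneous_eq A D p (U, \<phi>) w f"
    and fact: "irreducible_factorization A p f m fs"
    and comp: "\<And>k. k < m \<Longrightarrow> comp k \<in> irr_components A D"
    and fs_comp: "\<And>k. k < m \<Longrightarrow> \<forall>\<^sub>F y in nhds p. fs k y = 0 \<longrightarrow> y \<in> comp k"
    and wd: "\<And>k. k < m \<Longrightarrow> weighted_degree (U, \<phi>) p w (fs k) (d k)"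
    and nonint: "of_nat (weight_denominator w) * (\<Sum>k<m. d k * \<alpha> (comp k)) \<notin> \<int>"
  shows "\<exists>r s \<theta>. twisted_chart A D L LX p U \<phi> (\<lambda>i. real_of_rat (w i)) (2 * pi * weight_denominator w) r
    (\<Sum>k<m. d k * \<alpha> (comp k)) s \<theta> f"
proof -
  have closed_D: "closed D" using rank1_local_system_open[OF L] by (simp add: closed_def)
  have "holo_chart A (U, \<phi>) \<and> p \<in> U \<and> \<phi> p = 0 \<and> (\<exists>W S a. p \<in> W \<and> W \<subseteq> U \<and> reduced_eq A D W f \<and>
      (\<forall>\<nu>\<in>S. (\<Sum>i\<in>UNIV. w i * of_nat (\<nu> i)) = 1) \<and>
      (\<forall>y\<in>W. f y = (\<Sum>\<nu>\<in>S. a \<nu> * (\<Prod>i\<in>UNIV. (\<phi> y $ i) ^ \<nu> i))))"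
    using wh unfolding weighted_homogeneous_eq_def prod.case by blast
  then obtain W S a where c: "holo_chart A (U, \<phi>)" "p \<in> U" "\<phi> p = 0" and W: "p \<in> W" "W \<subseteq> U" "reduced_eq A D W f"
    and S': "\<forall>\<nu>\<in>S. (\<Sum>i\<in>UNIV. w i * of_nat (\<nu> i)) = 1"
    and fW': "\<forall>y\<in>W. f y = (\<Sum>\<nu>\<in>S. a \<nu> * (\<Prod>i\<in>UNIV. (\<phi> y $ i) ^ \<nu> i))"
    by (elim conjE exE) (rule that)
  note S = S'[rule_format] and fW = fW'[rule_format]
  note tc = holo_chart_topological[OF c(1)]
  interpret divisor_factorization A D p f W m fs comp
    using A D closed_D pD W fact comp fs_comp by unfold_locales
  obtain V \<sigma> g where V: "open V" "p \<in> V" "twisted_holo_on A L \<sigma> (V - D)" "\<And>y. y \<in> V - D \<Longrightarrow> \<sigma> y \<noteq> 0"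
    "finite {C \<in> irr_components A D. C \<inter> V \<noteq> {}}"
    "\<And>C. C \<in> irr_components A D \<Longrightarrow> C \<inter> V \<noteq> {} \<Longrightarrow> reduced_eq A C V (g C)"
    and conn\<sigma>: "\<And>U \<phi> y v. (U, \<phi>) \<in> A \<Longrightarrow> y \<in> U \<inter> V - D \<Longrightarrow> conn D L (U, \<phi>) \<sigma> y v =
       (\<Sum>C | C \<in> irr_components A D \<and> C \<inter> V \<noteq> {}.
          \<alpha> C * fd (\<lambda>z. g C (inv_into U \<phi> z)) (\<phi> y) v / g C y) * \<sigma> y"
    and LX: "\<And>W. open W \<Longrightarrow> W \<subseteq> V \<Longrightarrow> LX W = {s. \<exists>h. mholo_on A h W \<and> (\<forall>y\<in>W - D. s y = h y * \<sigma> y)}"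
    by (rule residue_extension_at[OF res, of p]) (rule that)
  \<comment> \<open>\<open>V\<close> may meet components that miss \<open>p\<close>. Their
    \<open>factor\<close> is 1, so the unit is the inverse of their equation and the correction
    removes their contribution to the connection form.\<close>
  define \<C> where "\<C> = {C. C \<in> irr_components A D \<and> C \<inter> V \<noteq> {}}"
  have fin: "finite \<C>" using V(5) by (simp add: \<C>_def)
  have "\<forall>C\<in>\<C>. \<exists>b N. open N \<and> p \<in> N \<and> N \<subseteq> V \<and> mholo_on A b N \<and> b p \<noteq> 0 \<and>
      (\<forall>y\<in>N. factor C y = b y * g C y)"
    using factor_associated[OF V(1,2,6)] by (simp add: \<C>_def)
  then obtain b Nb where b: "\<And>C. C \<in> \<C> \<Longrightarrow> open (Nb C) \<and> p \<in> Nb C \<and> Nb C \<subseteq> V \<and> mholo_on A (b C) (Nb C) \<and>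
      b C p \<noteq> 0 \<and> (\<forall>y\<in>Nb C. factor C y = b C y * g C y)"
    by metis
  obtain N0 where N0: "open N0" "p \<in> N0" "N0 \<subseteq> W" "\<And>k. k < m \<Longrightarrow> mholo_on A (fs k) N0"
    "\<And>y. y \<in> N0 \<Longrightarrow> f y = (\<Prod>k<m. fs k y)"
    by (rule factorization_neighbourhood) (rule that)
  let ?inv = "inv_into U \<phi>" and ?w = "\<lambda>i. real_of_rat (w i)"
  define E where "E = (\<lambda>k y. (\<Sum>i\<in>UNIV. of_rat (w i) * (\<phi> y $ i) *
        fd (\<lambda>z. fs k (?inv z)) (\<phi> y) (axis i 1)) = d k * fs k y)"
  \<comment> \<open>The condition on the real part confines each unit, normalised to 1 at
    \<open>p\<close>, to the right half plane, where \<open>Ln\<close> is holomorphic.\<close>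
  have ev: "\<forall>\<^sub>F y in nhds p. y \<in> U \<inter> N0 \<inter> V \<and> (\<forall>C\<in>\<C>. y \<in> Nb C \<and> 0 < Re (b C y / b C p)) \<and> (\<forall>k\<in>{..<m}. E k y)"
  proof (intro eventually_conj eventually_ball_finite ballI fin)
    show "\<forall>\<^sub>F y in nhds p. y \<in> U \<inter> N0 \<inter> V"
      using c N0 V chart_open_domain[OF tc] by (intro eventually_nhds_in_open) auto
    show "\<forall>\<^sub>F y in nhds p. E k y" if "k \<in> {..<m}" for k
      using wd[of k] that unfolding weighted_degree_def E_def by simp
    fix C assume C: "C \<in> \<C>"
    note bC = b[OF C]
    show "\<forall>\<^sub>F y in nhds p. y \<in> Nb C" using bC by (intro eventually_nhds_in_open) auto
    have "open (Nb C \<inter> (\<lambda>y. b C y / b C p) -` {z. 0 < Re z})"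
    proof (rule continuous_open_preimage)
      show "continuous_on (Nb C) (\<lambda>y. b C y / b C p)"
        using bC mholo_on_continuous[OF A] by (intro continuous_intros) auto
      show "open {z. 0 < Re z}" by (rule open_halfspace_Re_gt)
    qed (use bC in auto)
    then have "\<forall>\<^sub>F y in nhds p. y \<in> Nb C \<inter> (\<lambda>y. b C y / b C p) -` {z. 0 < Re z}"
      using bC by (intro eventually_nhds_in_open) auto
    then show "\<forall>\<^sub>F y in nhds p. 0 < Re (b C y / b C p)" by (rule eventually_mono) auto
  qed auto
  then obtain N1 where N1: "open N1" "p \<in> N1" "\<And>y. y \<in> N1 \<Longrightarrow> y \<in> U \<inter> N0 \<inter> V"
    "\<And>y C. y \<in> N1 \<Longrightarrow> C \<in> \<C> \<Longrightarrow> y \<in> Nb C \<and> 0 < Re (b C y / b C p)"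
    "\<And>y k. y \<in> N1 \<Longrightarrow> k < m \<Longrightarrow> E k y"
    unfolding eventually_nhds by blast
  have N1U: "N1 \<subseteq> U" using N1(3) by auto
  have "open (\<phi> ` N1)" "0 \<in> \<phi> ` N1"
    using chart_image_open[OF tc N1(1) N1U] N1(2) c(3) by force+
  then obtain r where r: "0 < r" "ball 0 r \<subseteq> \<phi> ` N1" using openE by blast
  define B where "B = (ball 0 r :: (complex^'n) set)"
  have oB: "open B" by (simp add: B_def)
  define N where "N = ?inv ` B"
  have \<phi>_inv: "\<phi> (?inv z) = z" and inv_N1: "?inv z \<in> N1" if z: "z \<in> B" for z
  proof -
    obtain y where "y \<in> N1" "z = \<phi> y" using r(2) z by (auto simp: B_def)
    then show "\<phi> (?inv z) = z" "?inv z \<in> N1" using chart_inv[OF tc] N1U by auto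
  qed
  have N_N1: "N \<subseteq> N1" using inv_N1 by (auto simp: N_def)
  have \<phi>N: "\<phi> ` N = B" using \<phi>_inv by (force simp: N_def)
  have BU: "B \<subseteq> \<phi> ` U" using r(2) N1U by (auto simp: B_def)
  have oN: "open N" unfolding N_def by (rule chart_inv_image_open[OF tc oB BU])
  have NU: "N \<subseteq> U" "N \<subseteq> V" "N \<subseteq> N0" "N \<subseteq> W" using N_N1 N1(3) N0(3) by blast+
  have inv_\<phi>: "?inv (\<phi> y) = y" if "y \<in> N" for y using chart_inv[OF tc] NU(1) that by blast
  have holoB: "cholo_on (\<lambda>z. h (?inv z)) B" if "mholo_on A h M" "N \<subseteq> M" for h M
  proof -
    have "U \<inter> N = N" using NU by auto
    then show ?thesis
      using mholo_on_chart[OF A c(1) mholo_on_subset[OF A that(1) oN that(2)]] \<phi>N by simp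
  qed

  define F where "F = (\<lambda>k z. fs k (?inv z))"
  define G where "G = (\<lambda>C z. g C (?inv z))"
  define \<beta> where "\<beta> = (\<lambda>C z. b C (?inv z))"
  have F: "cholo_on (F k) B" if "k < m" for k unfolding F_def by (rule holoB[OF N0(4)[OF that] NU(3)])
  have G: "cholo_on (G C) B" if "C \<in> \<C>" for C
    unfolding G_def by (rule holoB[OF reduced_eqD(1)[OF V(6)] NU(2)]) (use that in \<open>auto simp: \<C>_def\<close>)
  have N_Nb: "N \<subseteq> Nb C" if "C \<in> \<C>" for C using N_N1 N1(4) that by blast
  have \<beta>: "cholo_on (\<beta> C) B" if "C \<in> \<C>" for C
    unfolding \<beta>_def by (rule holoB[OF _ N_Nb[OF that]]) (use b that in blast)
  have \<beta>_re: "0 < Re (\<beta> C z / b C p)" if "C \<in> \<C>" "z \<in> B" for C z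
    unfolding \<beta>_def using N1(4)[OF inv_N1[OF that(2)] that(1)] by blast
  have \<beta>_nz: "\<beta> C z \<noteq> 0" if "C \<in> \<C>" "z \<in> B" for C z using \<beta>_re[OF that] by auto

  \<comment> \<open>\<open>weighted_degree\<close> is phrased with partial derivatives; linearity of
    the differential turns it into the derivative along the Euler vector.\<close>
  have fdF: "fd (F k) z (euler ?w z) = d k * F k z" if k: "k < m" and z: "z \<in> B" for k z
  proof -
    have "fd (F k) z (euler ?w z) = (\<Sum>i\<in>UNIV. euler ?w z $ i * fd (F k) z (axis i 1))"
      by (rule linear_functional_expand[of "fd (F k) z"])
        (simp add: cholo_on_fd_add[OF F[OF k] z] cholo_on_fd_scale[OF F[OF k] z])
    then show ?thesis
      using N1(5)[OF inv_N1[OF z] k] by (simp add: E_def \<phi>_inv[OF z] F_def of_real_of_rat)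
  qed
  have F_rot: "F k (rot ?w (of_real t) z) = exp (\<i> * d k * of_real t) * F k z" if "k < m" "z \<in> B" for k z t
    using euler_eigenfunction_rot[of "F k" r ?w "d k" z t] F fdF that by (simp add: B_def)
  have rotB: "rot ?w (of_real t) z \<in> B" if "z \<in> B" for t z using that by (simp add: B_def)
  \<comment> \<open>The differential picks up the same factor as the function, so the factors cancel
    in each logarithmic derivative. This is the invariance of \<theta>.\<close>
  have fdF_rot: "fd (F k) (rot ?w (of_real t) z) (rot ?w (of_real t) v) = exp (\<i> * d k * of_real t) * fd (F k) z v"
    if k: "k < m" and z: "z \<in> B" for k z t v
  proof -
    have "fd (F k) (rot ?w (of_real t) z) (rot ?w (of_real t) v) = fd (\<lambda>z. F k (rot ?w (of_real t) z)) z v"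
      using fd_compose[OF F[OF k] rotB[OF z] cholo_map_rot[OF oB] z] by simp
    also have "\<dots> = fd (\<lambda>z. exp (\<i> * d k * of_real t) * F k z) z v"
      by (subst fd_cong[OF oB z F_rot[OF k]]) auto
    finally show ?thesis by (simp add: fd_cmult[OF F[OF k] z])
  qed
  define \<theta> where "\<theta> = (\<lambda>z v. \<Sum>k<m. \<alpha> (comp k) * (fd (F k) z v / F k z))"
  have fF: "f (?inv z) = (\<Prod>k<m. F k z)" if "z \<in> B" for z
    using N0(5)[of "?inv z"] that NU(3) by (auto simp: F_def N_def)
  have F_nz: "F k z \<noteq> 0" if "z \<in> B" "f (?inv z) \<noteq> 0" "k < m" for k z
    using fF[OF that(1)] that by auto

  \<comment> \<open>\<mu> is the product over C of the units, normalised at \<open>p\<close>, raised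
    to the power \<open>\<alpha> C\<close>; the exponents are complex, hence the passage through
    logarithms.\<close>
  define ell where "ell = (\<lambda>z. \<Sum>C\<in>\<C>. \<alpha> C * Ln (\<beta> C z / b C p))"
  define \<mu> where "\<mu> = (\<lambda>z. exp (ell z))"
  have Ln_der: "((\<lambda>s. Ln (s / b C p)) has_field_derivative 1 / \<beta> C z) (at (\<beta> C z))" if "C \<in> \<C>" "z \<in> B" for C z
  proof -
    have "\<beta> C z / b C p \<notin> \<real>\<^sub>\<le>\<^sub>0" using \<beta>_re[OF that] by (auto simp: complex_nonpos_Reals_iff)
    then show ?thesis using b[OF that(1)] \<beta>_nz[OF that]
      by (auto intro!: derivative_eq_intros)
  qed
  have Ln\<beta>: "cholo_on (\<lambda>z. Ln (\<beta> C z / b C p)) B" if "C \<in> \<C>" for C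
    by (rule cholo_on_outer[OF \<beta>[OF that], where h = "\<lambda>s. Ln (s / b C p)"])
      (use Ln_der that in \<open>auto simp: field_differentiable_def\<close>)
  have ell: "cholo_on ell B" unfolding ell_def by (intro cholo_on_sum oB cholo_on_cmult Ln\<beta>)
  have \<mu>: "cholo_on \<mu> B" unfolding \<mu>_def by (rule cholo_on_exp[OF ell])
  have fd\<mu>: "fd \<mu> z v = \<mu> z * (\<Sum>C\<in>\<C>. \<alpha> C * (fd (\<beta> C) z v / \<beta> C z))" if z: "z \<in> B" for z v
  proof -
    have "fd \<mu> z v = exp (ell z) * fd ell z v"
      unfolding \<mu>_def by (rule fd_outer[OF ell z DERIV_exp])
    also have "fd ell z v = (\<Sum>C\<in>\<C>. fd (\<lambda>z. \<alpha> C * Ln (\<beta> C z / b C p)) z v)"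
      unfolding ell_def by (rule fd_sum[OF z cholo_on_cmult[OF Ln\<beta>]])
    also have "\<dots> = (\<Sum>C\<in>\<C>. \<alpha> C * (fd (\<beta> C) z v / \<beta> C z))"
    proof (rule sum.cong[OF refl])
      fix C assume C: "C \<in> \<C>"
      have "fd (\<lambda>z. \<alpha> C * Ln (\<beta> C z / b C p)) z v = \<alpha> C * fd (\<lambda>z. Ln (\<beta> C z / b C p)) z v"
        by (rule fd_cmult[OF Ln\<beta>[OF C] z])
      also have "fd (\<lambda>z. Ln (\<beta> C z / b C p)) z v = 1 / \<beta> C z * fd (\<beta> C) z v"
        by (rule fd_outer[OF \<beta>[OF C] z Ln_der[OF C z]])
      finally show "fd (\<lambda>z. \<alpha> C * Ln (\<beta> C z / b C p)) z v = \<alpha> C * (fd (\<beta> C) z v / \<beta> C z)" by simp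
    qed
    finally show ?thesis by (simp add: \<mu>_def)
  qed
  define s where "s = (\<lambda>y. \<mu> (\<phi> y) * \<sigma> y)"
  have \<mu>m: "mholo_on A (\<lambda>y. \<mu> (\<phi> y)) N"
    by (rule mholo_on_from_chart[OF A c(1) oN NU(1)]) (use \<mu> \<phi>N in simp)
  have \<mu>im: "mholo_on A (\<lambda>y. inverse (\<mu> (\<phi> y))) N"
    by (rule mholo_on_inverse[OF A \<mu>m]) (simp add: \<mu>_def)

  have logd: "(\<Sum>k | k < m \<and> comp k = C. fd (F k) z v / F k z) = fd (G C) z v / G C z + fd (\<beta> C) z v / \<beta> C z"
    if C: "C \<in> \<C>" and z: "z \<in> B" and nz: "f (?inv z) \<noteq> 0" for C z v
  proof -
    let ?K = "{k. k < m \<and> comp k = C}"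
    have eq: "(\<Prod>k\<in>?K. F k z) = \<beta> C z * G C z" if "z \<in> B" for z
    proof -
      have "?inv z \<in> Nb C" using that N_Nb[OF C] by (auto simp: N_def)
      then have "factor C (?inv z) = b C (?inv z) * g C (?inv z)" using b[OF C] by blast
      then show ?thesis by (simp add: factor_def F_def \<beta>_def G_def)
    qed
    have nzK: "(\<Prod>k\<in>?K. F k z) \<noteq> 0" using F_nz[OF z nz] by auto
    have Gnz: "G C z \<noteq> 0" using nzK eq[OF z] by auto
    have "(\<Prod>k\<in>?K. F k z) * (\<Sum>k\<in>?K. fd (F k) z v / F k z) = fd (\<lambda>z. \<Prod>k\<in>?K. F k z) z v"
      by (rule fd_prod_log[symmetric]) (use z oB F F_nz[OF z nz] in auto)
    also have "\<dots> = fd (\<lambda>z. \<beta> C z * G C z) z v" by (subst fd_cong[OF oB z eq]) auto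
    also have "\<dots> = \<beta> C z * fd (G C) z v + fd (\<beta> C) z v * G C z"
      by (rule fd_mult[OF \<beta>[OF C] G[OF C] z])
    finally show ?thesis using \<beta>_nz[OF C z] Gnz unfolding eq[OF z] by (simp add: field_simps)
  qed
  \<comment> \<open>Components that miss \<open>p\<close> have no branches and contribute empty
    sums; the others collect their branches through \<open>comp\<close>.\<close>
  have regroup: "(\<Sum>C\<in>\<C>. \<alpha> C * (\<Sum>k | k < m \<and> comp k = C. q k)) = (\<Sum>k<m. \<alpha> (comp k) * q k)" for q :: "nat \<Rightarrow> complex"
  proof -
    have "comp ` {..<m} \<subseteq> \<C>" using comp p_in_comp V(2) by (auto simp: \<C>_def)
    from sum.group[OF _ fin this, of "\<lambda>k. \<alpha> (comp k) * q k"]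
    have "(\<Sum>k<m. \<alpha> (comp k) * q k) = (\<Sum>C\<in>\<C>. \<Sum>k | k < m \<and> comp k = C. \<alpha> (comp k) * q k)" by simp
    also have "\<dots> = (\<Sum>C\<in>\<C>. \<alpha> C * (\<Sum>k | k < m \<and> comp k = C. q k))"
      by (intro sum.cong refl) (simp add: sum_distrib_left)
    finally show ?thesis by simp
  qed
  have fD: "f y \<noteq> 0" if "y \<in> N - D" for y using reduced_eqD(3)[OF W(3), of y] that NU(4) by auto
  have \<sigma>N: "twisted_holo_on A L \<sigma> (N - D)" by (rule twisted_holo_on_subset[OF V(3)]) (use NU(2) in auto)

  have "twisted_chart A D L LX p U \<phi> ?w (2 * pi * weight_denominator w) r (\<Sum>k<m. d k * \<alpha> (comp k)) s \<theta> f"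
    unfolding twisted_chart_def B_def[symmetric] N_def[symmetric]
  proof (intro conjI allI impI)
    show "function_sheaf UNIV (- D) LX" using res by (simp add: residue_extension_def)
    show "LX W' = {s'. \<exists>h. mholo_on A h W' \<and> (\<forall>y\<in>W' - D. s' y = h y * s y)}" if W': "open W'" "W' \<subseteq> N" for W'
    proof -
      have "W' \<subseteq> V" using W' NU by blast
      have 1: "mholo_on A (\<lambda>y. h y * inverse (\<mu> (\<phi> y))) W'" "mholo_on A (\<lambda>y. h y * \<mu> (\<phi> y)) W'" if "mholo_on A h W'" for h
        using that mholo_on_subset[OF A \<mu>m W'] mholo_on_subset[OF A \<mu>im W'] by (auto intro: mholo_on_mult)
      show ?thesis unfolding LX[OF W'(1) \<open>W' \<subseteq> V\<close>]
      proof (intro Collect_cong iffI; elim exE conjE)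
        fix s' h assume h: "mholo_on A h W'" "\<forall>y\<in>W' - D. s' y = h y * \<sigma> y"
        then show "\<exists>h. mholo_on A h W' \<and> (\<forall>y\<in>W' - D. s' y = h y * s y)"
          by (intro exI[of _ "\<lambda>y. h y * inverse (\<mu> (\<phi> y))"] conjI 1) (auto simp: s_def \<mu>_def)
      next
        fix s' h assume h: "mholo_on A h W'" "\<forall>y\<in>W' - D. s' y = h y * s y"
        then show "\<exists>h. mholo_on A h W' \<and> (\<forall>y\<in>W' - D. s' y = h y * \<sigma> y)"
          by (intro exI[of _ "\<lambda>y. h y * \<mu> (\<phi> y)"] conjI 1) (auto simp: s_def)
      qed
    qed
    show "twisted_holo_on A L s (N - D)"
      unfolding twisted_holo_on_def
    proof (intro allI impI)
      fix W' e assume W': "open W' \<and> W' \<subseteq> N - D \<and> e \<in> L W' \<and> (\<forall>y\<in>W'. e y \<noteq> 0)"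
      then have "mholo_on A (\<lambda>y. \<sigma> y / e y) W'" using \<sigma>N unfolding twisted_holo_on_def by blast
      moreover have "mholo_on A (\<lambda>y. \<mu> (\<phi> y)) W'" by (rule mholo_on_subset[OF A \<mu>m]) (use W' in auto)
      ultimately have "mholo_on A (\<lambda>y. \<mu> (\<phi> y) * (\<sigma> y / e y)) W'" by (intro mholo_on_mult)
      then show "mholo_on A (\<lambda>y. s y / e y) W'" by (simp add: s_def)
    qed
    show "s y \<noteq> 0" if "y \<in> N - D" for y using V(4)[of y] that NU(2) by (auto simp: s_def \<mu>_def)
    show "conn D L (U, \<phi>) s y v = \<theta> (\<phi> y) v * s y" if y: "y \<in> N - D" for y v
    proof -
      obtain U1 \<phi>1 where U1: "(U1, \<phi>1) \<in> A" "y \<in> U1" using atlas_covers[OF A] by blast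
      note c1 = atlas_holo_chart[OF A U1(1)]
      let ?Dv = "frechet_derivative (transition (U1, \<phi>1) (U, \<phi>)) (at (\<phi> y)) v"
      have yU: "y \<in> U" "y \<in> V" using y NU by auto
      have z: "\<phi> y \<in> B" using y \<phi>N by auto
      have iz: "?inv (\<phi> y) = y" using inv_\<phi> y by auto
      have nz: "f (?inv (\<phi> y)) \<noteq> 0" using fD[OF y] iz by simp
      \<comment> \<open>The residue formula is stated for charts of \<open>A\<close>, while the
        weighted chart is only known to lie in the maximal atlas. The formula is therefore carried
        over from a chart of \<open>A\<close> at \<open>y\<close>.\<close>
      have "conn D L (U, \<phi>) \<sigma> y v = conn D L (U1, \<phi>1) \<sigma> y ?Dv"
      proof (rule conn_transition[OF A L c1 c(1), where W = "U1 \<inter> N"])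
        show "open (U1 \<inter> N)" using oN chart_open_domain[OF holo_chart_topological[OF c1]] by auto
        show "twisted_holo_on A L \<sigma> (U1 \<inter> N - D)" by (rule twisted_holo_on_subset[OF \<sigma>N]) auto
      qed (use NU y U1 closed_D in auto)
      also have "\<dots> = (\<Sum>C\<in>\<C>. \<alpha> C * fd (\<lambda>z. g C (inv_into U1 \<phi>1 z)) (\<phi>1 y) ?Dv / g C y) * \<sigma> y"
        unfolding \<C>_def by (rule conn\<sigma>[OF U1(1)]) (use U1 yU y in auto)
      also have "(\<Sum>C\<in>\<C>. \<alpha> C * fd (\<lambda>z. g C (inv_into U1 \<phi>1 z)) (\<phi>1 y) ?Dv / g C y) =
          (\<Sum>C\<in>\<C>. \<alpha> C * (fd (G C) (\<phi> y) v / G C (\<phi> y)))"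
      proof (rule sum.cong[OF refl])
        fix C assume C: "C \<in> \<C>"
        then have "mholo_on A (g C) V" using reduced_eqD(1)[OF V(6)] by (auto simp: \<C>_def)
        from fd_chart_change[OF A c1 c(1) this U1(2) yU]
        show "\<alpha> C * fd (\<lambda>z. g C (inv_into U1 \<phi>1 z)) (\<phi>1 y) ?Dv / g C y = \<alpha> C * (fd (G C) (\<phi> y) v / G C (\<phi> y))"
          by (simp add: G_def iz)
      qed
      finally have c\<sigma>: "conn D L (U, \<phi>) \<sigma> y v = (\<Sum>C\<in>\<C>. \<alpha> C * (fd (G C) (\<phi> y) v / G C (\<phi> y))) * \<sigma> y" .
      have "conn D L (U, \<phi>) s y v = \<mu> (\<phi> y) * conn D L (U, \<phi>) \<sigma> y v + fd \<mu> (\<phi> y) v * \<sigma> y"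
        unfolding s_def by (rule conn_mult[OF A L c(1) oN NU(1) \<sigma>N _ y]) (use \<mu> \<phi>N in simp)
      also have "\<dots> = (\<Sum>C\<in>\<C>. \<alpha> C * (fd (G C) (\<phi> y) v / G C (\<phi> y) + fd (\<beta> C) (\<phi> y) v / \<beta> C (\<phi> y))) * s y"
        unfolding c\<sigma> fd\<mu>[OF z] by (simp add: s_def distrib_left distrib_right sum.distrib mult_ac)
      also have "\<dots> = (\<Sum>C\<in>\<C>. \<alpha> C * (\<Sum>k | k < m \<and> comp k = C. fd (F k) (\<phi> y) v / F k (\<phi> y))) * s y"
        using logd[OF _ z nz] by simp
      also have "\<dots> = \<theta> (\<phi> y) v * s y" unfolding regroup \<theta>_def ..
      finally show ?thesis .
    qed
    show "reduced_eq A D N f" by (rule reduced_eq_subset[OF A W(3) oN NU(4)])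
    show "f (?inv (rot ?w (of_real t) z)) = exp (\<i> * of_real t) * f (?inv z)" if z: "z \<in> B" for z t
    proof -
      have "?inv z \<in> W" "?inv (rot ?w (of_real t) z) \<in> W" using z rotB NU(4) by (auto simp: N_def)
      then show ?thesis
        using fW weighted_homogeneous_rot[OF S, of S a "of_real t" z] \<phi>_inv[OF z] \<phi>_inv[OF rotB[OF z]]
        by (simp del: rot_nth)
    qed
    show "\<theta> (rot ?w (of_real t) z) (rot ?w (of_real t) v) = \<theta> z v" if "z \<in> B" for z t v
      unfolding \<theta>_def using fdF_rot F_rot that by (intro sum.cong refl) simp
    show "\<theta> z (euler ?w z) = (\<Sum>k<m. d k * \<alpha> (comp k))" if "z \<in> B" "f (?inv z) \<noteq> 0" for z
      unfolding \<theta>_def using fdF F_nz that by (intro sum.cong refl) simp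
    show "rot ?w (of_real (2 * pi * weight_denominator w)) z = z" for z by (rule rot_period)
    show "exp (\<i> * (\<Sum>k<m. d k * \<alpha> (comp k)) * of_real (2 * pi * weight_denominator w)) \<noteq> 1"
      by (rule period_monodromy[OF nonint])
  qed (use A L c r BU in \<open>auto simp: B_def\<close>)
  then show ?thesis by blast
qed

lemma zero_in_log_stalk:
  assumes f: "reduced_eq A D W f" "p \<in> W" "W \<subseteq> U" and c: "topological_chart (U, \<phi>)"
    and LX: "open V" "p \<in> V" "V \<subseteq> U" "s \<in> LX V"
  shows "(\<lambda>z vs. 0) \<in> log_stalk A D LX p (U, \<phi>) j"
proof -
  have "open (\<phi> ` W)" by (rule chart_image_open[OF c reduced_eqD(2)[OF f(1)] f(3)])
  then have h: "holo_form i (\<phi> ` W) (\<lambda>z vs. 0)" for i by (rule holo_form_zero)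
  have e: "extends_holo D (U, \<phi>) i W f \<eta>" if "\<And>z vs. \<eta> z vs = 0" for i \<eta>
    unfolding extends_holo_def prod.case
    by (intro exI[of _ "\<lambda>z vs. 0"] conjI h) (simp add: that)
  have "(\<lambda>z vs. 0) \<in> log_forms A D p (U, \<phi>) j"
    unfolding log_forms_def mem_Collect_eq fst_conv
    by (intro exI[of _ W] exI[of _ f] conjI f e) (simp_all add: ext_d_remove_nth)
  then show ?thesis unfolding log_stalk_def tensor_stalk_def prod.case mem_Collect_eq
    by (intro bexI[of _ "\<lambda>z vs. 0"] exI[of _ V] exI[of _ s] conjI LX) simp_all
qed

section \<open>Acyclicity of the stalks\<close>

theorem theorem1:
  fixes A :: "('a::t2_space, 'n::finite) chart set"
    and D :: "'a set"
    and L LX :: "'a set \<Rightarrow> ('a \<Rightarrow> complex) set"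
    and \<alpha> lam :: "'a set \<Rightarrow> complex"
    and p :: 'a
    and x c :: "('a, 'n) chart"
    and w :: "'n \<Rightarrow> rat"
    and f :: "'a \<Rightarrow> complex"
    and m :: nat
    and fs :: "nat \<Rightarrow> 'a \<Rightarrow> complex"
    and comp :: "nat \<Rightarrow> 'a set"
    and d :: "nat \<Rightarrow> complex"
  assumes "complex_manifold A"
    and "reduced_divisor A D"
    and "rank1_local_system (- D) L"
    and "\<And>C. C \<in> irr_components A D \<Longrightarrow> local_monodromy A D L C (lam C)"
    and "\<And>C. C \<in> irr_components A D \<Longrightarrow> exp (- 2 * of_real pi * \<i> * \<alpha> C) = lam C"
    and "residue_extension A D L \<alpha> LX"
    and "p \<in> D"
    and "weighted_homogeneous_eq A D p x w f"
    and "irreducible_factorization A p f m fs"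
    and "\<And>k. k < m \<Longrightarrow> comp k \<in> irr_components A D"
    and "\<And>k. k < m \<Longrightarrow> \<forall>\<^sub>F y in nhds p. fs k y = 0 \<longrightarrow> y \<in> comp k"
    and "\<And>k. k < m \<Longrightarrow> weighted_degree x p w (fs k) (d k)"
    and "of_nat (weight_denominator w) * (\<Sum>k<m. d k * \<alpha> (comp k)) \<notin> \<int>"
    and "holo_chart A c" and "p \<in> fst c"
  shows "acyclic_complex (zero_germ D p c) (nabla D L c) (log_stalk A D LX p c) \<and>
         acyclic_complex (zero_germ D p c) (nabla D L c) (mero_stalk A D LX p c) \<and>
         quasi_iso_inclusion (zero_germ D p c) (nabla D L c)
           (log_stalk A D LX p c) (mero_stalk A D LX p c)"
proof -
  note A = assms(1) and L = assms(3) and res = assms(6)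
  obtain U \<phi> V \<psi> where xc: "x = (U, \<phi>)" "c = (V, \<psi>)" by (metis prod.collapse)
  obtain r s \<theta> where "twisted_chart A D L LX p U \<phi> (\<lambda>i. real_of_rat (w i)) (2 * pi * weight_denominator w) r
      (\<Sum>k<m. d k * \<alpha> (comp k)) s \<theta> f"
    using twisted_chart_exists[OF assms(1-3,6,7) assms(8)[unfolded xc] assms(9-11) assms(12)[unfolded xc] assms(13)]
    by blast
  then interpret twisted_chart A D L LX p U \<phi> "\<lambda>i. real_of_rat (w i)" "2 * pi * weight_denominator w" r
    "\<Sum>k<m. d k * \<alpha> (comp k)" s \<theta> f .
  have c': "holo_chart A (V, \<psi>)" "p \<in> V" using assms(14,15) by (simp_all add: xc)
  \<comment> \<open>The homotopy lives in the weighted chart \<open>x\<close>; the result is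
    transferred to the arbitrary chart \<open>c\<close>.\<close>
  have acyc_log: "acyclic_complex (zero_germ D p c) (nabla D L c) (log_stalk A D LX p c)"
    unfolding xc log_stalk_def
  proof (rule acyclic_complex_chart_change[where \<Omega> = "\<lambda>c. log_forms A D p c",
        OF A L LX_sheaf residue_extension_twisted_holo[OF A res] _ _ c p(1) c' log_acyclic[unfolded log_stalk_def]])
    show "pullback (transition c1 c2) \<eta> \<in> log_forms A D p c2 j"
      if "holo_chart A c1" "holo_chart A c2" "p \<in> fst c1" "p \<in> fst c2" "\<eta> \<in> log_forms A D p c1 j"
      for c1 c2 :: "('a, 'n) chart" and j \<eta> by (rule log_forms_pullback[OF A closed_D that])
    show "\<exists>V. open V \<and> p \<in> V \<and> V \<subseteq> fst c1 \<and> holo_form j (snd c1 ` (V - D)) \<eta>"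
      if "holo_chart A c1" "p \<in> fst c1" "\<eta> \<in> log_forms A D p c1 j" for c1 :: "('a, 'n) chart" and j \<eta>
      by (rule mero_forms_holo[OF A closed_D that(1) subsetD[OF log_forms_subset_mero_forms that(3)]])
  qed
  have acyc_mero: "acyclic_complex (zero_germ D p c) (nabla D L c) (mero_stalk A D LX p c)"
    unfolding xc mero_stalk_def
  proof (rule acyclic_complex_chart_change[where \<Omega> = "\<lambda>c. mero_forms A D p c",
        OF A L LX_sheaf residue_extension_twisted_holo[OF A res] _ _ c p(1) c' mero_acyclic[unfolded mero_stalk_def]])
    show "pullback (transition c1 c2) \<eta> \<in> mero_forms A D p c2 j"
      if "holo_chart A c1" "holo_chart A c2" "p \<in> fst c1" "p \<in> fst c2" "\<eta> \<in> mero_forms A D p c1 j"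
      for c1 c2 :: "('a, 'n) chart" and j \<eta> by (rule mero_forms_pullback[OF A that])
    show "\<exists>V. open V \<and> p \<in> V \<and> V \<subseteq> fst c1 \<and> holo_form j (snd c1 ` (V - D)) \<eta>"
      if "holo_chart A c1" "p \<in> fst c1" "\<eta> \<in> mero_forms A D p c1 j" for c1 :: "('a, 'n) chart" and j \<eta>
      by (rule mero_forms_holo[OF A closed_D that(1,3)])
  qed
  have sub: "log_stalk A D LX p c j \<subseteq> mero_stalk A D LX p c j" for j
    using log_forms_subset_mero_forms[of A D p c j]
    unfolding log_stalk_def mero_stalk_def tensor_stalk_def xc by auto
  \<comment> \<open>As the target is acyclic, every class to be hit is zero and the zero form
    represents it. Membership still needs a reduced equation and a section of \<open>LX\<close> near
    \<open>p\<close>, both supplied by the weighted neighbourhood.\<close>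
  have zero: "(\<lambda>z vs. 0) \<in> log_stalk A D LX p c j" for j
  proof -
    note n = nbh[OF r(1) order_refl]
    have o: "open (nbh r \<inter> V)" using n chart_open_domain[OF holo_chart_topological[OF c'(1)]] by auto
    have "s \<in> LX (nbh r \<inter> V)"
      by (rule function_sheaf_restrict[OF LX_sheaf n(1) _ s_LX[OF r(1) order_refl] o]) auto
    then show ?thesis unfolding xc
      by (intro zero_in_log_stalk[OF reduced_eq_subset[OF A f' o] _ _ holo_chart_topological[OF c'(1)] o])
        (use n c' in auto)
  qed
  have nabla_0: "nabla D L c (\<lambda>z vs. 0) z vs = 0" for z vs
    unfolding xc nabla_frame by (simp add: ext_d_remove_nth)
  have "quasi_iso_inclusion (zero_germ D p c) (nabla D L c) (log_stalk A D LX p c) (mero_stalk A D LX p c)"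
    unfolding quasi_iso_inclusion_def
  proof (intro conjI allI impI sub)
    fix j \<omega>
    show "coboundary (zero_germ D p c) (nabla D L c) (log_stalk A D LX p c) j \<omega>"
      if "cocycle (zero_germ D p c) (nabla D L c) (log_stalk A D LX p c) j \<omega> \<and>
        coboundary (zero_germ D p c) (nabla D L c) (mero_stalk A D LX p c) j \<omega>"
      using acyc_log that unfolding acyclic_complex_def by blast
    assume "cocycle (zero_germ D p c) (nabla D L c) (mero_stalk A D LX p c) j \<omega>"
    then have "coboundary (zero_germ D p c) (nabla D L c) (mero_stalk A D LX p c) j \<omega>"
      using acyc_mero unfolding acyclic_complex_def by blast
    moreover have "zero_germ D p c (Suc j) (nabla D L c (\<lambda>z vs. 0))"
      using c'(2) chart_open_domain[OF holo_chart_topological[OF c'(1)]] nabla_0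
      unfolding zero_germ_def xc by (auto intro!: exI[of _ V])
    ultimately show "\<exists>\<omega>'. cocycle (zero_germ D p c) (nabla D L c) (log_stalk A D LX p c) j \<omega>' \<and>
        coboundary (zero_germ D p c) (nabla D L c) (mero_stalk A D LX p c) j (\<lambda>z vs. \<omega> z vs - \<omega>' z vs)"
      using zero[of j] by (intro exI[of _ "\<lambda>z vs. 0"]) (simp add: cocycle_def)
  qed
  then show ?thesis using acyc_log acyc_mero by blast
qed

end
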